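(* Let $\mathcal{D}=\langle\mathcal{A},\mathcal{B}\rangle$ be a triangulated category with a semiorthogonal decomposition, and let $\sigma_{\mathcal{A}}=(Z_{\mathcal{A}},\mathcal{P}_{\mathcal{A}})$ and $\sigma_{\mathcal{B}}=(Z_{\mathcal{B}},\mathcal{P}_{\mathcal{B}})$ be stability conditions (satisfying the support property) on $\mathcal{A}$ and $\mathcal{B}$ respectively. Suppose that (CP1) $\mathrm{Hom}^{\le0}_{\mathcal{D}}(\mathcal{P}_{\mathcal{A}}(0,1],\mathcal{P}_{\mathcal{B}}(0,1])=0$; and (CP2) $\mathrm{Hom}^{\le0}_{\mathcal{D}}(\mathcal{P}_{\mathcal{A}}(\alpha,\alpha+1],\mathcal{P}_{\mathcal{B}}(\alpha,\alpha+1])=0$ for some $\alpha\in(0,1)$. Then $\sigma_{\mathcal{A}}$ and $\sigma_{\mathcal{B}}$ glue to a stability condition (satisfying the support property) on $\mathcal{D}$.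
   Context: Semiorthogonal decomposition $\mathcal{D}=\langle\mathcal{A},\mathcal{B}\rangle$: full triangulated subcategories with $\mathrm{Hom}_{\mathcal{D}}(\mathcal{B},\mathcal{A})=0$ and every $E\in\mathcal{D}$ in a triangle $B\to E\to A\to B[1]$, $A\in\mathcal{A}$, $B\in\mathcal{B}$; $i_{\mathcal{A}}^*$ is the left adjoint of $\mathcal{A}\hookrightarrow\mathcal{D}$ and $i_{\mathcal{B}}^!$ the right adjoint of $\mathcal{B}\hookrightarrow\mathcal{D}$. $\mathrm{Hom}^{\le0}_{\mathcal{D}}(\mathcal{X},\mathcal{Y})=0$ means $\mathrm{Hom}_{\mathcal{D}}(X,Y[i])=0$ for all $X\in\mathcal{X},Y\in\mathcal{Y}$, $i\le0$. A pre-stability condition on a triangulated category $\mathcal{T}$ is a locally finite stability condition $(Z,\mathcal{P})$ in Bridgeland's original sense ($Z\colon K_0(\mathcal{T})\to\mathbb{C}$ a homomorphism, $\mathcal{P}$ a slicing, $Z(E)\in\mathbb{R}_{>0}e^{i\pi\phi}$ for $0\ne E\in\mathcal{P}(\phi)$); for an interval $I$, $\mathcal{P}(I)$ is the extension closure of the $\mathcal{P}(\phi)$, $\phi\in I$. Equivalently it is given by the pair $(\mathcal{P}(0,1],Z)$ of the heart of a bounded $t$-structure and a stability function with the Harder–Narasimhan property. A stability condition is a pre-stability condition with the support property: there are a finite-rank free abelian group $\Lambda$, a factorization $Z\colon K_0(\mathcal{T})\xrightarrow{u}\Lambda\to\mathbb{C}$, a norm on $\Lambda\otimes\mathbb{R}$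 and $C>0$ with $\|u([E])\|\le C|Z(E)|$ for all semistable $E$. Gluing: let $\mathcal{A}_0=\mathcal{P}_{\mathcal{A}}(0,1]$, $\mathcal{B}_0=\mathcal{P}_{\mathcal{B}}(0,1]$. Under (CP1) the extension closure $\mathrm{gl}(\mathcal{A}_0,\mathcal{B}_0)$ of $\mathcal{A}_0$ and $\mathcal{B}_0$ is the heart of a bounded $t$-structure on $\mathcal{D}$. "$\sigma_{\mathcal{A}},\sigma_{\mathcal{B}}$ glue to a stability condition on $\mathcal{D}$" means that $(\mathrm{gl}(\mathcal{A}_0,\mathcal{B}_0),Z_{\mathrm{gl}})$ is a stability condition on $\mathcal{D}$, where $Z_{\mathrm{gl}}(E)=Z_{\mathcal{A}}(i_{\mathcal{A}}^*E)+Z_{\mathcal{B}}(i_{\mathcal{B}}^!E)$. *)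

theory Defs
  imports Complex_Main "HOL-Algebra.Free_Abelian_Groups"
begin

section \<open>Categories, functors and adjunctions\<close>

record ('o, 'm) cat =
  Ob :: "'o set"
  Hom :: "'o \<Rightarrow> 'o \<Rightarrow> 'm set"
  ident :: "'o \<Rightarrow> 'm"
  cmp :: "'m \<Rightarrow> 'm \<Rightarrow> 'm"  (infixl \<open>\<cdot>\<index>\<close> 70)

text \<open>Composition is written in the usual order: \<open>g \<cdot> f\<close> is \<open>g\<close> after \<open>f\<close>.
  An arrow determines its source and target (\<open>Hom_disjoint\<close>).\<close>

locale category =
  fixes C :: "('o, 'm, 'z) cat_scheme" (structure)
  assumes ident_in_Hom: "X \<in> Ob C \<Longrightarrow> ident C X \<in> Hom C X X"
    and cmp_in_Hom:
      "\<lbrakk>X \<in> Ob C; Y \<in> Ob C; Z \<in> Ob C; f \<in> Hom C X Y; g \<in> Hom C Y Z\<rbrakk> \<Longrightarrow> g \<cdot> f \<in> Hom C X Z"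
    and cmp_ident: "\<lbrakk>X \<in> Ob C; Y \<in> Ob C; f \<in> Hom C X Y\<rbrakk> \<Longrightarrow> f \<cdot> ident C X = f"
    and ident_cmp: "\<lbrakk>X \<in> Ob C; Y \<in> Ob C; f \<in> Hom C X Y\<rbrakk> \<Longrightarrow> ident C Y \<cdot> f = f"
    and cmp_assoc:
      "\<lbrakk>W \<in> Ob C; X \<in> Ob C; Y \<in> Ob C; Z \<in> Ob C; f \<in> Hom C W X; g \<in> Hom C X Y; h \<in> Hom C Y Z\<rbrakk>
        \<Longrightarrow> h \<cdot> g \<cdot> f = h \<cdot> (g \<cdot> f)"
    and Hom_disjoint:
      "\<lbrakk>X \<in> Ob C; Y \<in> Ob C; X' \<in> Ob C; Y' \<in> Ob C; f \<in> Hom C X Y; f \<in> Hom C X' Y'\<rbrakk>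
        \<Longrightarrow> X = X' \<and> Y = Y'"

definition iso_arrow :: "('o, 'm, 'z) cat_scheme \<Rightarrow> 'm \<Rightarrow> 'o \<Rightarrow> 'o \<Rightarrow> bool" where
  "iso_arrow C f X Y \<longleftrightarrow> f \<in> Hom C X Y \<and>
     (\<exists>g \<in> Hom C Y X. g \<cdot>\<^bsub>C\<^esub> f = ident C X \<and> f \<cdot>\<^bsub>C\<^esub> g = ident C Y)"

definition isomorphic :: "('o, 'm, 'z) cat_scheme \<Rightarrow> 'o \<Rightarrow> 'o \<Rightarrow> bool" where
  "isomorphic C X Y \<longleftrightarrow> X \<in> Ob C \<and> Y \<in> Ob C \<and> (\<exists>f. iso_arrow C f X Y)"

definition zero_object :: "('o, 'm, 'z) cat_scheme \<Rightarrow> 'o \<Rightarrow> bool" where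
  "zero_object C Z \<longleftrightarrow> Z \<in> Ob C \<and>
     (\<forall>X \<in> Ob C. (\<exists>!f. f \<in> Hom C X Z) \<and> (\<exists>!f. f \<in> Hom C Z X))"

text \<open>A functor is a pair of maps, on objects and on arrows.\<close>

definition functor_between ::
  "('o, 'm, 'y) cat_scheme \<Rightarrow> ('p, 'n, 'z) cat_scheme \<Rightarrow> ('o \<Rightarrow> 'p) \<times> ('m \<Rightarrow> 'n) \<Rightarrow> bool" where
  "functor_between C D F \<longleftrightarrow>
     (\<forall>X \<in> Ob C. fst F X \<in> Ob D \<and> snd F (ident C X) = ident D (fst F X)) \<and>
     (\<forall>X \<in> Ob C. \<forall>Y \<in> Ob C. \<forall>f \<in> Hom C X Y. snd F f \<in> Hom D (fst F X) (fst F Y)) \<and>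
     (\<forall>X \<in> Ob C. \<forall>Y \<in> Ob C. \<forall>Z \<in> Ob C. \<forall>f \<in> Hom C X Y. \<forall>g \<in> Hom C Y Z.
        snd F (g \<cdot>\<^bsub>C\<^esub> f) = snd F g \<cdot>\<^bsub>D\<^esub> snd F f)"

text \<open>\<open>adjunction C D F G\<close>: the functor \<open>F : C \<rightarrow> D\<close> is left adjoint to \<open>G : D \<rightarrow> C\<close>.\<close>

definition adjunction ::
  "('o, 'm, 'y) cat_scheme \<Rightarrow> ('p, 'n, 'z) cat_scheme \<Rightarrow>
   ('o \<Rightarrow> 'p) \<times> ('m \<Rightarrow> 'n) \<Rightarrow> ('p \<Rightarrow> 'o) \<times> ('n \<Rightarrow> 'm) \<Rightarrow> bool" where
  "adjunction C D F G \<longleftrightarrow> functor_between C D F \<and> functor_between D C G \<and>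
     (\<exists>\<Phi>. (\<forall>X \<in> Ob C. \<forall>Y \<in> Ob D. bij_betw (\<Phi> X Y) (Hom D (fst F X) Y) (Hom C X (fst G Y))) \<and>
          (\<forall>X \<in> Ob C. \<forall>X' \<in> Ob C. \<forall>Y \<in> Ob D. \<forall>Y' \<in> Ob D.
           \<forall>a \<in> Hom C X' X. \<forall>b \<in> Hom D Y Y'. \<forall>h \<in> Hom D (fst F X) Y.
             \<Phi> X' Y' (b \<cdot>\<^bsub>D\<^esub> h \<cdot>\<^bsub>D\<^esub> snd F a) = snd G b \<cdot>\<^bsub>C\<^esub> \<Phi> X Y h \<cdot>\<^bsub>C\<^esub> a))"


section \<open>Triangulated categories\<close>

text \<open>A tuple \<open>(X, Y, Z, f, g, h)\<close> in \<open>Tri\<close> stands for the distinguished triangle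
  \<open>X -f\<rightarrow> Y -g\<rightarrow> Z -h\<rightarrow> X[1]\<close>; \<open>sh_ob\<close> and \<open>sh_ar\<close> are the shift functor.\<close>

record ('o, 'm) tricat = "('o, 'm) cat" +
  hadd :: "'m \<Rightarrow> 'm \<Rightarrow> 'm"
  hzero :: "'o \<Rightarrow> 'o \<Rightarrow> 'm"
  sh_ob :: "'o \<Rightarrow> 'o"
  sh_ar :: "'m \<Rightarrow> 'm"
  Tri :: "('o \<times> 'o \<times> 'o \<times> 'm \<times> 'm \<times> 'm) set"

definition hom_group :: "('o, 'm, 'z) tricat_scheme \<Rightarrow> 'o \<Rightarrow> 'o \<Rightarrow> 'm monoid" where
  "hom_group D X Y = \<lparr>carrier = Hom D X Y, monoid.mult = hadd D, one = hzero D X Y\<rparr>"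

definition biproduct ::
  "('o, 'm, 'z) tricat_scheme \<Rightarrow> 'o \<Rightarrow> 'o \<Rightarrow> 'o \<Rightarrow> bool" where
  "biproduct D X Y S \<longleftrightarrow> S \<in> Ob D \<and>
     (\<exists>i \<in> Hom D X S. \<exists>j \<in> Hom D Y S. \<exists>p \<in> Hom D S X. \<exists>q \<in> Hom D S Y.
        p \<cdot>\<^bsub>D\<^esub> i = ident D X \<and> q \<cdot>\<^bsub>D\<^esub> j = ident D Y \<and>
        p \<cdot>\<^bsub>D\<^esub> j = hzero D Y X \<and> q \<cdot>\<^bsub>D\<^esub> i = hzero D X Y \<and>
        hadd D (i \<cdot>\<^bsub>D\<^esub> p) (j \<cdot>\<^bsub>D\<^esub> q) = ident D S)"

locale additive_category = category D
  for D :: "('o, 'm, 'z) tricat_scheme" (structure) +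
  assumes comm_group_hom_group: "\<lbrakk>X \<in> Ob D; Y \<in> Ob D\<rbrakk> \<Longrightarrow> comm_group (hom_group D X Y)"
    and cmp_hadd_left:
      "\<lbrakk>X \<in> Ob D; Y \<in> Ob D; Z \<in> Ob D; f \<in> Hom D X Y; g \<in> Hom D Y Z; g' \<in> Hom D Y Z\<rbrakk>
        \<Longrightarrow> hadd D g g' \<cdot> f = hadd D (g \<cdot> f) (g' \<cdot> f)"
    and cmp_hadd_right:
      "\<lbrakk>X \<in> Ob D; Y \<in> Ob D; Z \<in> Ob D; f \<in> Hom D X Y; f' \<in> Hom D X Y; g \<in> Hom D Y Z\<rbrakk>
        \<Longrightarrow> g \<cdot> hadd D f f' = hadd D (g \<cdot> f) (g \<cdot> f')"
    and ex_zero_object: "\<exists>Z. zero_object D Z"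
    and ex_biproduct: "\<lbrakk>X \<in> Ob D; Y \<in> Ob D\<rbrakk> \<Longrightarrow> \<exists>S. biproduct D X Y S"

text \<open>The shift is an additive autoequivalence; it is not required to be bijective on objects.\<close>

locale triangulated_category = additive_category D
  for D :: "('o, 'm, 'z) tricat_scheme" (structure) +
  assumes shift_functor: "functor_between D D (sh_ob D, sh_ar D)"
    and shift_hadd: "\<lbrakk>X \<in> Ob D; Y \<in> Ob D; f \<in> Hom D X Y; f' \<in> Hom D X Y\<rbrakk>
        \<Longrightarrow> sh_ar D (hadd D f f') = hadd D (sh_ar D f) (sh_ar D f')"
    and shift_fully_faithful: "\<lbrakk>X \<in> Ob D; Y \<in> Ob D\<rbrakk>
        \<Longrightarrow> bij_betw (sh_ar D) (Hom D X Y) (Hom D (sh_ob D X) (sh_ob D Y))"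
    and shift_ess_surj: "X \<in> Ob D \<Longrightarrow> \<exists>W \<in> Ob D. isomorphic D (sh_ob D W) X"
    and Tri_typed: "(X, Y, Z, f, g, h) \<in> Tri D
        \<Longrightarrow> X \<in> Ob D \<and> Y \<in> Ob D \<and> Z \<in> Ob D \<and>
            f \<in> Hom D X Y \<and> g \<in> Hom D Y Z \<and> h \<in> Hom D Z (sh_ob D X)"
    and Tri_iso:
      "\<lbrakk>(X, Y, Z, f, g, h) \<in> Tri D; X' \<in> Ob D; Y' \<in> Ob D; Z' \<in> Ob D;
        f' \<in> Hom D X' Y'; g' \<in> Hom D Y' Z'; h' \<in> Hom D Z' (sh_ob D X');
        iso_arrow D a X X'; iso_arrow D b Y Y'; iso_arrow D c Z Z';
        b \<cdot> f = f' \<cdot> a; c \<cdot> g = g' \<cdot> b; sh_ar D a \<cdot> h = h' \<cdot> c\<rbrakk>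
        \<Longrightarrow> (X', Y', Z', f', g', h') \<in> Tri D"
    and TR1_ident: "\<lbrakk>X \<in> Ob D; zero_object D Z\<rbrakk>
        \<Longrightarrow> (X, X, Z, ident D X, hzero D X Z, hzero D Z (sh_ob D X)) \<in> Tri D"
    and TR1_cone: "\<lbrakk>X \<in> Ob D; Y \<in> Ob D; f \<in> Hom D X Y\<rbrakk> \<Longrightarrow> \<exists>Z g h. (X, Y, Z, f, g, h) \<in> Tri D"
    and TR2_rotate:
      "\<lbrakk>X \<in> Ob D; Y \<in> Ob D; Z \<in> Ob D; f \<in> Hom D X Y; g \<in> Hom D Y Z; h \<in> Hom D Z (sh_ob D X)\<rbrakk>
        \<Longrightarrow> (X, Y, Z, f, g, h) \<in> Tri D \<longleftrightarrow>
            (Y, Z, sh_ob D X, g, h, inv\<^bsub>hom_group D (sh_ob D X) (sh_ob D Y)\<^esub> (sh_ar D f)) \<in> Tri D"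
    and TR3_morphism:
      "\<lbrakk>(X, Y, Z, f, g, h) \<in> Tri D; (X', Y', Z', f', g', h') \<in> Tri D;
        a \<in> Hom D X X'; b \<in> Hom D Y Y'; b \<cdot> f = f' \<cdot> a\<rbrakk>
        \<Longrightarrow> \<exists>c \<in> Hom D Z Z'. c \<cdot> g = g' \<cdot> b \<and> sh_ar D a \<cdot> h = h' \<cdot> c"
    and TR4_octahedron:
      "\<lbrakk>(X, Y, Z', f, i, i') \<in> Tri D; (Y, Z, X', g, j, j') \<in> Tri D;
        (X, Z, Y', g \<cdot> f, k, k') \<in> Tri D\<rbrakk>
        \<Longrightarrow> \<exists>u v. (Z', Y', X', u, v, sh_ar D i \<cdot> j') \<in> Tri D \<and>
              u \<cdot> i = k \<cdot> g \<and> k' \<cdot> u = i' \<and> v \<cdot> k = j \<and> j' \<cdot> v = sh_ar D f \<cdot> k'"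

text \<open>\<open>E[i]\<close> for an integer \<open>i\<close>. As the shift is only an equivalence, \<open>E[-1]\<close> is a chosen
  preimage of \<open>E\<close> up to isomorphism.\<close>

definition unshift :: "('o, 'm, 'z) tricat_scheme \<Rightarrow> 'o \<Rightarrow> 'o" where
  "unshift D X = (SOME W. W \<in> Ob D \<and> isomorphic D (sh_ob D W) X)"

definition shift :: "('o, 'm, 'z) tricat_scheme \<Rightarrow> int \<Rightarrow> 'o \<Rightarrow> 'o" where
  "shift D i X = (if 0 \<le> i then (sh_ob D ^^ nat i) X else (unshift D ^^ nat (- i)) X)"

definition Hom_le0_vanishes :: "('o, 'm, 'z) tricat_scheme \<Rightarrow> 'o set \<Rightarrow> 'o set \<Rightarrow> bool" where
  "Hom_le0_vanishes D \<X> \<Y> \<longleftrightarrow>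
     (\<forall>X \<in> \<X>. \<forall>Y \<in> \<Y>. \<forall>i \<le> 0. Hom D X (shift D i Y) = {hzero D X (shift D i Y)})"

text \<open>Full subcategories are given by their sets of objects, and are taken to be closed under
  isomorphism.\<close>

definition full_sub :: "('o, 'm) tricat \<Rightarrow> 'o set \<Rightarrow> ('o, 'm) tricat" where
  "full_sub D S = D\<lparr>Ob := S, Tri := {(X, Y, Z, f, g, h) \<in> Tri D. X \<in> S \<and> Y \<in> S \<and> Z \<in> S}\<rparr>"

text \<open>Closure under isomorphism is implied by closure under cones.\<close>

definition triangulated_subcategory :: "('o, 'm) tricat \<Rightarrow> 'o set \<Rightarrow> bool" where
  "triangulated_subcategory D S \<longleftrightarrow> S \<subseteq> Ob D \<and> S \<noteq> {} \<and>
     (\<forall>X \<in> Ob D. X \<in> S \<longleftrightarrow> sh_ob D X \<in> S) \<and>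
     (\<forall>X Y Z f g h. (X, Y, Z, f, g, h) \<in> Tri D \<longrightarrow> X \<in> S \<longrightarrow> Y \<in> S \<longrightarrow> Z \<in> S)"

definition additive_subcategory :: "('o, 'm) tricat \<Rightarrow> 'o set \<Rightarrow> bool" where
  "additive_subcategory D S \<longleftrightarrow> S \<subseteq> Ob D \<and>
     (\<forall>X \<in> S. \<forall>Y \<in> Ob D. isomorphic D X Y \<longrightarrow> Y \<in> S) \<and>
     (\<forall>Z. zero_object D Z \<longrightarrow> Z \<in> S) \<and>
     (\<forall>X \<in> S. \<forall>Y \<in> S. \<forall>W. biproduct D X Y W \<longrightarrow> W \<in> S)"

inductive_set extension_closure :: "('o, 'm) tricat \<Rightarrow> 'o set \<Rightarrow> 'o set"
  for D :: "('o, 'm) tricat" and S :: "'o set" where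
  base: "X \<in> S \<Longrightarrow> X \<in> extension_closure D S"
| extension: "\<lbrakk>X \<in> extension_closure D S; Z \<in> extension_closure D S; (X, Y, Z, f, g, h) \<in> Tri D\<rbrakk>
    \<Longrightarrow> Y \<in> extension_closure D S"

definition semiorthogonal_decomposition :: "('o, 'm) tricat \<Rightarrow> 'o set \<Rightarrow> 'o set \<Rightarrow> bool" where
  "semiorthogonal_decomposition D \<A> \<B> \<longleftrightarrow>
     triangulated_subcategory D \<A> \<and> triangulated_subcategory D \<B> \<and>
     (\<forall>B \<in> \<B>. \<forall>A \<in> \<A>. Hom D B A = {hzero D B A}) \<and>
     (\<forall>E \<in> Ob D. \<exists>B \<in> \<B>. \<exists>A \<in> \<A>. \<exists>f g h. (B, E, A, f, g, h) \<in> Tri D)"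

text \<open>The object parts of the left and right adjoints of the inclusion \<open>(id, id)\<close> of a full
  subcategory, that is, \<open>i\<^sup>*\<close> and \<open>i\<^sup>!\<close>. They are unique up to isomorphism, and both
  exist for the respective parts of a semiorthogonal decomposition.\<close>

definition incl_left_adj :: "('o, 'm) tricat \<Rightarrow> 'o set \<Rightarrow> 'o \<Rightarrow> 'o" where
  "incl_left_adj D \<A> = fst (SOME F. adjunction D (full_sub D \<A>) F (id, id))"

definition incl_right_adj :: "('o, 'm) tricat \<Rightarrow> 'o set \<Rightarrow> 'o \<Rightarrow> 'o" where
  "incl_right_adj D \<B> = fst (SOME G. adjunction (full_sub D \<B>) D (id, id) G)"


section \<open>The Grothendieck group\<close>

definition K0 :: "('o, 'm) tricat \<Rightarrow> ('o \<Rightarrow>\<^sub>0 int) set monoid" where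
  "K0 D = free_Abelian_group (Ob D) Mod
     generate (free_Abelian_group (Ob D))
       {frag_of Y - frag_of X - frag_of Z | X Y Z f g h. (X, Y, Z, f, g, h) \<in> Tri D}"

definition K0_class :: "('o, 'm) tricat \<Rightarrow> 'o \<Rightarrow> ('o \<Rightarrow>\<^sub>0 int) set" where
  "K0_class D E =
     generate (free_Abelian_group (Ob D))
       {frag_of Y - frag_of X - frag_of Z | X Y Z f g h. (X, Y, Z, f, g, h) \<in> Tri D}
     #>\<^bsub>free_Abelian_group (Ob D)\<^esub> frag_of E"

definition complex_group :: "complex monoid" where
  "complex_group = \<lparr>carrier = UNIV, monoid.mult = (+), one = 0\<rparr>"


section \<open>Slicings and stability conditions\<close>

definition slicing :: "('o, 'm) tricat \<Rightarrow> (real \<Rightarrow> 'o set) \<Rightarrow> bool" where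
  "slicing D P \<longleftrightarrow>
     (\<forall>\<phi>. additive_subcategory D (P \<phi>)) \<and>
     (\<forall>\<phi>. P (\<phi> + 1) = {E. \<exists>F \<in> P \<phi>. isomorphic D (sh_ob D F) E}) \<and>
     (\<forall>\<phi> \<psi>. \<psi> < \<phi> \<longrightarrow> (\<forall>X \<in> P \<phi>. \<forall>Y \<in> P \<psi>. Hom D X Y = {hzero D X Y})) \<and>
     (\<forall>E \<in> Ob D. \<not> zero_object D E \<longrightarrow>
        (\<exists>(n::nat) F A \<phi>. zero_object D (F 0) \<and> F n = E \<and>
           (\<forall>i<n. A i \<in> P (\<phi> i) \<and> (\<exists>f g h. (F i, F (Suc i), A i, f, g, h) \<in> Tri D)) \<and>
           (\<forall>i j. i < j \<and> j < n \<longrightarrow> \<phi> j < \<phi> i)))"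

definition slice_interval :: "('o, 'm) tricat \<Rightarrow> (real \<Rightarrow> 'o set) \<Rightarrow> real set \<Rightarrow> 'o set" where
  "slice_interval D P I = extension_closure D (\<Union>\<phi>\<in>I. P \<phi>)"

text \<open>Finite length is understood as for quasi-abelian categories: with respect to strict
  subobjects, a strict monomorphism being a kernel.\<close>

definition strict_subobject :: "('o, 'm) tricat \<Rightarrow> 'o \<Rightarrow> 'm \<Rightarrow> 'o \<Rightarrow> bool" where
  "strict_subobject Q K m E \<longleftrightarrow> K \<in> Ob Q \<and> E \<in> Ob Q \<and> m \<in> Hom Q K E \<and>
     (\<exists>Z \<in> Ob Q. \<exists>g \<in> Hom Q E Z. g \<cdot>\<^bsub>Q\<^esub> m = hzero Q K Z \<and>
        (\<forall>W \<in> Ob Q. \<forall>t \<in> Hom Q W E. g \<cdot>\<^bsub>Q\<^esub> t = hzero Q W Z \<longrightarrow>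
           (\<exists>!s. s \<in> Hom Q W K \<and> m \<cdot>\<^bsub>Q\<^esub> s = t)))"

definition subobject_le :: "('o, 'm) tricat \<Rightarrow> 'o \<Rightarrow> 'm \<Rightarrow> 'o \<Rightarrow> 'm \<Rightarrow> bool" where
  "subobject_le Q K m L l \<longleftrightarrow> (\<exists>s \<in> Hom Q K L. l \<cdot>\<^bsub>Q\<^esub> s = m)"

definition finite_length :: "('o, 'm) tricat \<Rightarrow> bool" where
  "finite_length Q \<longleftrightarrow>
     (\<forall>E K m. (\<forall>n::nat. strict_subobject Q (K n) (m n) E) \<longrightarrow>
        ((\<forall>n. subobject_le Q (K n) (m n) (K (Suc n)) (m (Suc n))) \<longrightarrow>
           (\<exists>N. \<forall>n\<ge>N. subobject_le Q (K (Suc n)) (m (Suc n)) (K n) (m n))) \<and>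
        ((\<forall>n. subobject_le Q (K (Suc n)) (m (Suc n)) (K n) (m n)) \<longrightarrow>
           (\<exists>N. \<forall>n\<ge>N. subobject_le Q (K n) (m n) (K (Suc n)) (m (Suc n)))))"

text \<open>The bound \<open>\<eta> < 1/2\<close> ensures that the categories \<open>P(t - \<eta>, t + \<eta>)\<close> are quasi-abelian; the
  condition for some \<open>\<eta>\<close> implies it for all smaller ones.\<close>

definition locally_finite :: "('o, 'm) tricat \<Rightarrow> (real \<Rightarrow> 'o set) \<Rightarrow> bool" where
  "locally_finite D P \<longleftrightarrow>
     (\<exists>\<eta>>0. \<eta> < 1/2 \<and> (\<forall>t. finite_length (full_sub D (slice_interval D P {t - \<eta><..<t + \<eta>}))))"

definition pre_stability_condition ::
  "('o, 'm) tricat \<Rightarrow> (('o \<Rightarrow>\<^sub>0 int) set \<Rightarrow> complex) \<Rightarrow> (real \<Rightarrow> 'o set) \<Rightarrow> bool" where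
  "pre_stability_condition D Z P \<longleftrightarrow>
     Z \<in> hom (K0 D) complex_group \<and> slicing D P \<and>
     (\<forall>\<phi>. \<forall>E \<in> P \<phi>. \<not> zero_object D E \<longrightarrow>
        (\<exists>r>0. Z (K0_class D E) = complex_of_real r * cis (pi * \<phi>))) \<and>
     locally_finite D P"

text \<open>\<open>\<Lambda>\<close> is the free abelian group on \<open>{..<n}\<close>, and \<open>\<Lambda> \<otimes> \<real>\<close> is the space of real sequences
  supported on \<open>{..<n}\<close>.\<close>

definition norm_on_Rn :: "nat \<Rightarrow> ((nat \<Rightarrow> real) \<Rightarrow> real) \<Rightarrow> bool" where
  "norm_on_Rn n N \<longleftrightarrow>
     (\<forall>v. (\<forall>i\<ge>n. v i = 0) \<longrightarrow>
        0 \<le> N v \<and> (N v = 0 \<longleftrightarrow> v = (\<lambda>i. 0)) \<and> (\<forall>c. N (\<lambda>i. c * v i) = \<bar>c\<bar> * N v) \<and>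
        (\<forall>w. (\<forall>i\<ge>n. w i = 0) \<longrightarrow> N (\<lambda>i. v i + w i) \<le> N v + N w))"

definition support_property ::
  "('o, 'm) tricat \<Rightarrow> (('o \<Rightarrow>\<^sub>0 int) set \<Rightarrow> complex) \<Rightarrow> (real \<Rightarrow> 'o set) \<Rightarrow> bool" where
  "support_property D Z P \<longleftrightarrow>
     (\<exists>(n::nat) u z N C.
        u \<in> hom (K0 D) (free_Abelian_group {..<n}) \<and>
        z \<in> hom (free_Abelian_group {..<n}) complex_group \<and>
        (\<forall>x \<in> carrier (K0 D). Z x = z (u x)) \<and>
        norm_on_Rn n N \<and> C > 0 \<and>
        (\<forall>\<phi>. \<forall>E \<in> P \<phi>. \<not> zero_object D E \<longrightarrow>
           N (\<lambda>i. real_of_int (Poly_Mapping.lookup (u (K0_class D E)) i))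
             \<le> C * cmod (Z (K0_class D E))))"

definition stability_condition ::
  "('o, 'm) tricat \<Rightarrow> (('o \<Rightarrow>\<^sub>0 int) set \<Rightarrow> complex) \<Rightarrow> (real \<Rightarrow> 'o set) \<Rightarrow> bool" where
  "stability_condition D Z P \<longleftrightarrow> pre_stability_condition D Z P \<and> support_property D Z P"

text \<open>The pair \<open>(H, Z)\<close> of a heart and a stability function is a stability condition.\<close>

definition heart_stability_condition ::
  "('o, 'm) tricat \<Rightarrow> 'o set \<Rightarrow> (('o \<Rightarrow>\<^sub>0 int) set \<Rightarrow> complex) \<Rightarrow> bool" where
  "heart_stability_condition D H Z \<longleftrightarrow>
     (\<exists>P. stability_condition D Z P \<and> slice_interval D P {0<..1} = H)"


section \<open>Gluing\<close>

definition gl :: "('o, 'm) tricat \<Rightarrow> 'o set \<Rightarrow> 'o set \<Rightarrow> 'o set" where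
  "gl D \<A>\<^sub>0 \<B>\<^sub>0 = extension_closure D (\<A>\<^sub>0 \<union> \<B>\<^sub>0)"

definition glue_to_stability_condition ::
  "('o, 'm) tricat \<Rightarrow> 'o set \<Rightarrow> 'o set \<Rightarrow>
   (('o \<Rightarrow>\<^sub>0 int) set \<Rightarrow> complex) \<Rightarrow> (real \<Rightarrow> 'o set) \<Rightarrow>
   (('o \<Rightarrow>\<^sub>0 int) set \<Rightarrow> complex) \<Rightarrow> (real \<Rightarrow> 'o set) \<Rightarrow> bool" where
  "glue_to_stability_condition D \<A> \<B> Z\<^sub>\<A> P\<^sub>\<A> Z\<^sub>\<B> P\<^sub>\<B> \<longleftrightarrow>
     (\<exists>Z\<^sub>g\<^sub>l.
        (\<forall>E \<in> Ob D. Z\<^sub>g\<^sub>l (K0_class D E) =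
           Z\<^sub>\<A> (K0_class (full_sub D \<A>) (incl_left_adj D \<A> E)) +
           Z\<^sub>\<B> (K0_class (full_sub D \<B>) (incl_right_adj D \<B> E))) \<and>
        heart_stability_condition D
          (gl D (slice_interval (full_sub D \<A>) P\<^sub>\<A> {0<..1})
                (slice_interval (full_sub D \<B>) P\<^sub>\<B> {0<..1})) Z\<^sub>g\<^sub>l)"

end

theory Submission
  imports Defs "HOL-Analysis.Function_Topology"
begin

text \<open>Write \<open>X * Y\<close> for the class of extensions of objects of \<open>Y\<close> by objects of \<open>X\<close>; by the
  octahedral axiom this operation is associative, and \<open>X * Y \<subseteq> Y * X\<close> if \<open>Hom(Y, X[1]) = 0\<close>.
  By (CP1) and (CP2), \<open>Hom(P\<^sub>\<A>(>c), P\<^sub>\<B>(\<le>c+1)) = 0\<close> for all \<open>c\<close> in \<open>\<int> \<union> (\<alpha> + \<int>)\<close>, so the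
  truncations of the two slicings at these \<open>c\<close> can be interchanged and \<open>\<D>\<close> is cut into the sectors
  \<open>P\<^sub>\<B>(c,c'] * P\<^sub>\<A>(c,c']\<close>, where \<open>c < c'\<close> are consecutive cut points. Each sector spans
  less than a half plane, hence there the support properties of the two conditions add up to a bound
  \<open>\<parallel>u(E)\<parallel> \<le> C |Z(E)|\<close> for all objects, not only the semistable ones. In particular only finitely many
  central charges of bounded size occur in a sector, so Harder--Narasimhan filtrations in it are
  obtained by repeatedly splitting off the strict subobject of maximal phase and maximal length.
  The same bound yields local finiteness and the support property of the resulting slicing.\<close>

section \<open>Triangulated categories\<close>

text \<open>Condition (CP1) alone leads to a heart whose phases fill \<open>(0, 1]\<close>. There a
  charge with phase close to 1 and one with phase close to 0 may almost cancel, so the norm of a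
  class is not controlled by the modulus of its charge. The cut at \<alpha> leaves sectors of
  opening less than \<pi>. Projection to the bisector of a sector is additive and comparable with
  the modulus, and it replaces the modulus in all estimates. The price is that a sector is not the
  heart of a t-structure: the coimage and the image of a morphism may differ, and the role of
  subobjects is taken over by triangles with all three vertices in the sector. The lattice of the
  glued condition is the direct sum of the two given lattices with the sum of their norms.
  Filtrations are treated as membership in iterated extension classes, and such membership is
  recognised by orthogonality, which spares comparing different filtrations of one object.\<close>

locale triangulated = triangulated_category D for D :: "('o, 'm) tricat" (structure)
begin

text \<open>Membership of both ends is bundled in, since the axioms concern \<open>Hom D X Y\<close>
  only for \<open>X\<close> and \<open>Y\<close> in \<open>Ob D\<close>; composition rules can then
  be chained by \<open>OF\<close>.\<close>

definition arr :: "'m \<Rightarrow> 'o \<Rightarrow> 'o \<Rightarrow> bool" where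
  "arr f X Y \<longleftrightarrow> X \<in> Ob D \<and> Y \<in> Ob D \<and> f \<in> Hom D X Y"

definition hneg :: "'o \<Rightarrow> 'o \<Rightarrow> 'm \<Rightarrow> 'm" where
  "hneg X Y f = inv\<^bsub>hom_group D X Y\<^esub> f"

abbreviation T :: "'o \<Rightarrow> 'o \<Rightarrow> 'o \<Rightarrow> 'm \<Rightarrow> 'm \<Rightarrow> 'm \<Rightarrow> bool" where
  "T X Y Z f g h \<equiv> (X, Y, Z, f, g, h) \<in> Tri D"

abbreviation "zo \<equiv> hzero D"
abbreviation "sh \<equiv> sh_ob D"
abbreviation "sa \<equiv> sh_ar D"

section \<open>Additive calculus of arrows\<close>

lemma arr_Ob: "arr f X Y \<Longrightarrow> X \<in> Ob D" "arr f X Y \<Longrightarrow> Y \<in> Ob D"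
  by (auto simp: arr_def)

lemma arr_cmp: "\<lbrakk>arr f X Y; arr g Y Z\<rbrakk> \<Longrightarrow> arr (g \<cdot> f) X Z"
  using cmp_in_Hom by (auto simp: arr_def)

lemma arr_ident: "X \<in> Ob D \<Longrightarrow> arr (ident D X) X X"
  using ident_in_Hom by (auto simp: arr_def)

lemma cmp_id: "arr f X Y \<Longrightarrow> f \<cdot> ident D X = f" "arr f X Y \<Longrightarrow> ident D Y \<cdot> f = f"
  using cmp_ident ident_cmp by (auto simp: arr_def)

lemma assoc: "\<lbrakk>arr f W X; arr g X Y; arr h Y Z\<rbrakk> \<Longrightarrow> h \<cdot> g \<cdot> f = h \<cdot> (g \<cdot> f)"
  using cmp_assoc by (auto simp: arr_def)

lemma hom_comm_group: "\<lbrakk>X \<in> Ob D; Y \<in> Ob D\<rbrakk> \<Longrightarrow> comm_group (hom_group D X Y)"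
  by (rule comm_group_hom_group)

lemma hom_group_simps [simp]:
  "carrier (hom_group D X Y) = Hom D X Y" "x \<otimes>\<^bsub>hom_group D X Y\<^esub> y = hadd D x y"
  "\<one>\<^bsub>hom_group D X Y\<^esub> = zo X Y"
  by (auto simp: hom_group_def)

lemma arr_zero: "\<lbrakk>X \<in> Ob D; Y \<in> Ob D\<rbrakk> \<Longrightarrow> arr (zo X Y) X Y"
  using group.is_monoid[OF comm_group.axioms(2)[OF hom_comm_group[of X Y]]] monoid.one_closed
  by (fastforce simp: arr_def)

lemma arr_add: assumes "arr f X Y" "arr g X Y" shows "arr (hadd D f g) X Y"
proof -
  interpret G: comm_group "hom_group D X Y" using assms hom_comm_group by (auto simp: arr_def)
  show ?thesis using assms G.m_closed by (auto simp: arr_def)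
qed

lemma arr_neg: assumes "arr f X Y" shows "arr (hneg X Y f) X Y"
proof -
  interpret G: comm_group "hom_group D X Y" using assms hom_comm_group by (auto simp: arr_def)
  show ?thesis using assms G.inv_closed by (auto simp: arr_def hneg_def)
qed

text \<open>Cancellation in the Hom group. Applied to the image of zero under an additive map it
  yields \<open>cmp_zero\<close> and \<open>sh_zero\<close>.\<close>

lemma add_idem_zero: assumes "arr f X Y" "hadd D f f = f" shows "f = zo X Y"
proof -
  interpret G: comm_group "hom_group D X Y" using assms hom_comm_group by (auto simp: arr_def)
  show ?thesis using assms G.l_cancel_one[of f f] by (auto simp: arr_def)
qed

lemma add_zero: assumes "arr f X Y" shows "hadd D f (zo X Y) = f" "hadd D (zo X Y) f = f"
proof -
  interpret G: comm_group "hom_group D X Y" using assms hom_comm_group by (auto simp: arr_def)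
  show "hadd D f (zo X Y) = f" "hadd D (zo X Y) f = f"
    using assms G.r_one[of f] G.l_one[of f] by (auto simp: arr_def)
qed

lemma add_neg: assumes "arr f X Y" shows "hadd D f (hneg X Y f) = zo X Y" "hadd D (hneg X Y f) f =
  zo X Y"
proof -
  interpret G: comm_group "hom_group D X Y" using assms hom_comm_group by (auto simp: arr_def)
  show "hadd D f (hneg X Y f) = zo X Y" "hadd D (hneg X Y f) f = zo X Y"
    using assms G.r_inv[of f] G.l_inv[of f] by (auto simp: arr_def hneg_def)
qed

lemma neg_unique: assumes "arr f X Y" "arr g X Y" "hadd D g f = zo X Y" shows "hneg X Y f = g"
proof -
  interpret G: comm_group "hom_group D X Y" using assms hom_comm_group by (auto simp: arr_def)
  show ?thesis using assms G.inv_equality[of g f] by (auto simp: arr_def hneg_def)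
qed

lemma neg_neg: assumes "arr f X Y" shows "hneg X Y (hneg X Y f) = f"
  using neg_unique[OF arr_neg[OF assms] assms] add_neg[OF assms] by simp

lemma neg_zero: "\<lbrakk>X \<in> Ob D; Y \<in> Ob D\<rbrakk> \<Longrightarrow> hneg X Y (zo X Y) = zo X Y"
  using neg_unique[of "zo X Y" X Y "zo X Y"] arr_zero add_zero by simp

lemma neg_inj: "\<lbrakk>arr f X Y; arr g X Y; hneg X Y f = hneg X Y g\<rbrakk> \<Longrightarrow> f = g"
  using neg_neg by metis

lemma diff_zero_eq: assumes "arr f X Y" "arr g X Y" "hadd D f (hneg X Y g) = zo X Y" shows "f = g"
  using neg_unique[OF arr_neg[OF assms(2)] assms(1) assms(3)] neg_neg[OF assms(2)] by simp

lemma cmp_add: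
  "\<lbrakk>arr f X Y; arr f' X Y; arr g Y Z\<rbrakk> \<Longrightarrow> g \<cdot> hadd D f f' = hadd D (g \<cdot> f) (g \<cdot> f')"
  "\<lbrakk>arr f X Y; arr g Y Z; arr g' Y Z\<rbrakk> \<Longrightarrow> hadd D g g' \<cdot> f = hadd D (g \<cdot> f) (g' \<cdot> f)"
  using cmp_hadd_right cmp_hadd_left by (auto simp: arr_def)

lemma cmp_zero: assumes "arr g Y Z" "X \<in> Ob D" shows "g \<cdot> zo X Y = zo X Z" "zo Z X \<cdot> g = zo Y X"
proof -
  have z: "arr (zo X Y) X Y" "arr (zo Z X) Z X" using assms arr_zero arr_Ob by blast+
  show "g \<cdot> zo X Y = zo X Z"
    using add_idem_zero[OF arr_cmp[OF z(1) assms(1)]] cmp_add(1)[OF z(1) z(1) assms(1)]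
      add_zero(1)[OF z(1)] by simp
  show "zo Z X \<cdot> g = zo Y X"
    using add_idem_zero[OF arr_cmp[OF assms(1) z(2)]] cmp_add(2)[OF assms(1) z(2) z(2)]
      add_zero(1)[OF z(2)] by simp
qed

lemma cmp_neg: assumes "arr f X Y" "arr g Y Z"
  shows "g \<cdot> hneg X Y f = hneg X Z (g \<cdot> f)" "hneg Y Z g \<cdot> f = hneg X Z (g \<cdot> f)"
proof -
  have o: "X \<in> Ob D" "Y \<in> Ob D" "Z \<in> Ob D" using assms arr_Ob by blast+
  have "hadd D (g \<cdot> hneg X Y f) (g \<cdot> f) = zo X Z"
    using cmp_add(1)[OF arr_neg[OF assms(1)] assms(1) assms(2)] add_neg[OF assms(1)] cmp_zero(1)[OF
      assms(2) o(1)] by simp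
  then show "g \<cdot> hneg X Y f = hneg X Z (g \<cdot> f)"
    using neg_unique[OF arr_cmp[OF assms] arr_cmp[OF arr_neg[OF assms(1)] assms(2)]] by simp
  have "hadd D (hneg Y Z g \<cdot> f) (g \<cdot> f) = zo X Z"
    using cmp_add(2)[OF assms(1) arr_neg[OF assms(2)] assms(2)] add_neg[OF assms(2)] cmp_zero(2)[OF
      assms(1) o(3)] by simp
  then show "hneg Y Z g \<cdot> f = hneg X Z (g \<cdot> f)"
    using neg_unique[OF arr_cmp[OF assms] arr_cmp[OF assms(1) arr_neg[OF assms(2)]]] by simp
qed

section \<open>The shift functor\<close>

lemma sh_Ob: "X \<in> Ob D \<Longrightarrow> sh X \<in> Ob D"
  using shift_functor by (auto simp: functor_between_def)

lemma sh_ident: "X \<in> Ob D \<Longrightarrow> sa (ident D X) = ident D (sh X)"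
  using shift_functor by (auto simp: functor_between_def)

lemma arr_sh: "arr f X Y \<Longrightarrow> arr (sa f) (sh X) (sh Y)"
  using shift_functor by (auto simp: functor_between_def arr_def)

lemma sh_cmp: "\<lbrakk>arr f X Y; arr g Y Z\<rbrakk> \<Longrightarrow> sa (g \<cdot> f) = sa g \<cdot> sa f"
  using shift_functor unfolding functor_between_def arr_def by auto

lemma sh_inj: "\<lbrakk>arr f X Y; arr g X Y; sa f = sa g\<rbrakk> \<Longrightarrow> f = g"
  using shift_fully_faithful[of X Y] by (auto simp: arr_def bij_betw_def inj_on_def)

lemma sh_full: assumes "arr f (sh X) (sh Y)" "X \<in> Ob D" "Y \<in> Ob D" shows "\<exists>g. arr g X Y \<and> sa g = f"
proof -
  have "f \<in> sa ` Hom D X Y" using shift_fully_faithful[of X Y] assms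
    by (simp add: arr_def bij_betw_def)
  then show ?thesis using assms by (auto simp: arr_def)
qed

lemma sh_zero: assumes "X \<in> Ob D" "Y \<in> Ob D" shows "sa (zo X Y) = zo (sh X) (sh Y)"
proof -
  have z: "arr (zo X Y) X Y" using assms arr_zero by blast
  then have "sa (hadd D (zo X Y) (zo X Y)) = hadd D (sa (zo X Y)) (sa (zo X Y))"
    using shift_hadd by (auto simp: arr_def)
  then show ?thesis using add_idem_zero[OF arr_sh[OF z]] add_zero[OF z] by simp
qed

lemma sh_neg: assumes "arr f X Y" shows "sa (hneg X Y f) = hneg (sh X) (sh Y) (sa f)"
proof -
  have "sa (hadd D (hneg X Y f) f) = hadd D (sa (hneg X Y f)) (sa f)"
    using shift_hadd assms arr_neg[OF assms] by (auto simp: arr_def)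
  then show ?thesis
    using neg_unique[OF arr_sh[OF assms] arr_sh[OF arr_neg[OF assms]]] add_neg[OF assms] sh_zero
      arr_Ob[OF assms] by simp
qed

lemma T_arr: assumes "T X Y Z f g h" shows "arr f X Y" "arr g Y Z" "arr h Z (sh X)"
  using Tri_typed[OF assms] sh_Ob by (auto simp: arr_def)

lemma T_Ob: assumes "T X Y Z f g h" shows "X \<in> Ob D" "Y \<in> Ob D" "Z \<in> Ob D"
  using Tri_typed[OF assms] by auto

lemma rotate_iff: "\<lbrakk>arr f X Y; arr g Y Z; arr h Z (sh X)\<rbrakk> \<Longrightarrow>
   T X Y Z f g h \<longleftrightarrow> T Y Z (sh X) g h (hneg (sh X) (sh Y) (sa f))"
  using TR2_rotate by (auto simp: arr_def hneg_def)

lemma rotate: "T X Y Z f g h \<Longrightarrow> T Y Z (sh X) g h (hneg (sh X) (sh Y) (sa f))"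
  using rotate_iff[OF T_arr] by blast

section \<open>Isomorphisms\<close>

definition iso :: "'m \<Rightarrow> 'o \<Rightarrow> 'o \<Rightarrow> bool" where
  "iso f X Y \<longleftrightarrow> arr f X Y \<and> (\<exists>g. arr g Y X \<and> g \<cdot> f = ident D X \<and> f \<cdot> g = ident D Y)"

lemma isoI: "\<lbrakk>arr f X Y; arr g Y X; g \<cdot> f = ident D X; f \<cdot> g = ident D Y\<rbrakk> \<Longrightarrow> iso f X Y"
  by (auto simp: iso_def)

lemma iso_iso_arrow: "iso f X Y \<longleftrightarrow> X \<in> Ob D \<and> Y \<in> Ob D \<and> iso_arrow D f X Y"
  by (auto simp: iso_def iso_arrow_def arr_def)

lemma isomorphic_iso: "isomorphic D X Y \<longleftrightarrow> (\<exists>f. iso f X Y)"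
  by (auto simp: isomorphic_def iso_iso_arrow)

lemma iso_arr: "iso f X Y \<Longrightarrow> arr f X Y"
  by (auto simp: iso_def)

lemma iso_ident: "X \<in> Ob D \<Longrightarrow> iso (ident D X) X X"
  using isoI[OF arr_ident arr_ident] cmp_id[OF arr_ident] by auto

lemma iso_inv: "iso f X Y \<Longrightarrow> \<exists>g. iso g Y X \<and> g \<cdot> f = ident D X \<and> f \<cdot> g = ident D Y"
  by (auto simp: iso_def)

lemma iso_comp: assumes "iso f X Y" "iso g Y Z" shows "iso (g \<cdot> f) X Z"
proof -
  obtain f' g' where f: "arr f X Y" "arr f' Y X" "f' \<cdot> f = ident D X" "f \<cdot> f' = ident D Y"
    and g: "arr g Y Z" "arr g' Z Y" "g' \<cdot> g = ident D Y" "g \<cdot> g' = ident D Z"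
    using assms by (auto simp: iso_def)
  have "(f' \<cdot> g') \<cdot> (g \<cdot> f) = f' \<cdot> (g' \<cdot> g \<cdot> f)"
    using assoc[OF arr_cmp[OF f(1) g(1)] g(2) f(2)] assoc[OF f(1) g(1) g(2)] by simp
  then have 1: "(f' \<cdot> g') \<cdot> (g \<cdot> f) = ident D X" using f g cmp_id by simp
  have "(g \<cdot> f) \<cdot> (f' \<cdot> g') = g \<cdot> (f \<cdot> f' \<cdot> g')"
    using assoc[OF arr_cmp[OF g(2) f(2)] f(1) g(1)] assoc[OF g(2) f(2) f(1)] by simp
  then have 2: "(g \<cdot> f) \<cdot> (f' \<cdot> g') = ident D Z" using f g cmp_id by simp
  show ?thesis using isoI[OF arr_cmp[OF f(1) g(1)] arr_cmp[OF g(2) f(2)] 1 2] .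
qed

lemma isomorphic_refl: "X \<in> Ob D \<Longrightarrow> isomorphic D X X"
  using iso_ident isomorphic_iso by blast
lemma isomorphic_sym: "isomorphic D X Y \<Longrightarrow> isomorphic D Y X"
  using iso_inv isomorphic_iso by blast
lemma isomorphic_trans: "\<lbrakk>isomorphic D X Y; isomorphic D Y Z\<rbrakk> \<Longrightarrow> isomorphic D X Z"
  unfolding isomorphic_iso using iso_comp by blast
lemma isomorphic_Ob: "isomorphic D X Y \<Longrightarrow> X \<in> Ob D" "isomorphic D X Y \<Longrightarrow> Y \<in> Ob D"
  by (auto simp: isomorphic_def)

lemma iso_neg_ident: assumes "X \<in> Ob D" shows "iso (hneg X X (ident D X)) X X"
proof -
  note i = arr_ident[OF assms]
  have "hneg X X (ident D X) \<cdot> hneg X X (ident D X) = ident D X"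
    using cmp_neg(1)[OF i arr_neg[OF i]] cmp_id[OF arr_neg[OF i]] neg_neg[OF i] by simp
  then show ?thesis using isoI arr_neg[OF i] by blast
qed

lemma iso_sh: assumes "iso f X Y" shows "iso (sa f) (sh X) (sh Y)"
proof -
  obtain f' where f: "arr f X Y" "arr f' Y X" "f' \<cdot> f = ident D X" "f \<cdot> f' = ident D Y"
    using assms by (auto simp: iso_def)
  then show ?thesis
    using isoI[OF arr_sh[OF f(1)] arr_sh[OF f(2)]] sh_cmp sh_ident arr_Ob by metis
qed

lemma iso_unsh: assumes "iso f (sh X) (sh Y)" "X \<in> Ob D" "Y \<in> Ob D" shows "\<exists>g. iso g X Y \<and> sa g = f"
proof -
  obtain f' where f: "arr f (sh X) (sh Y)" "arr f' (sh Y) (sh X)" "f' \<cdot> f = ident D (sh X)" "f \<cdot> f'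
    = ident D (sh Y)"
    using assms by (auto simp: iso_def)
  obtain g g' where g: "arr g X Y" "sa g = f" "arr g' Y X" "sa g' = f'"
    using sh_full f assms by metis
  have "sa (g' \<cdot> g) = sa (ident D X)" "sa (g \<cdot> g') = sa (ident D Y)"
    using sh_cmp sh_ident f g assms by metis+
  then have "g' \<cdot> g = ident D X" "g \<cdot> g' = ident D Y"
    using sh_inj arr_cmp g arr_ident assms by metis+
  then show ?thesis using isoI g by blast
qed

lemma isomorphic_sh: "isomorphic D X Y \<Longrightarrow> isomorphic D (sh X) (sh Y)"
  using iso_sh isomorphic_iso by blast
lemma isomorphic_unsh: "\<lbrakk>isomorphic D (sh X) (sh Y); X \<in> Ob D; Y \<in> Ob D\<rbrakk> \<Longrightarrow> isomorphic D X Y"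
  using iso_unsh isomorphic_iso by blast

lemma T_iso:
  assumes "T X Y Z f g h" "iso a X X'" "iso b Y Y'" "iso c Z Z'"
    "arr f' X' Y'" "arr g' Y' Z'" "arr h' Z' (sh X')"
    "b \<cdot> f = f' \<cdot> a" "c \<cdot> g = g' \<cdot> b" "sa a \<cdot> h = h' \<cdot> c"
  shows "T X' Y' Z' f' g' h'"
  using Tri_iso[of X Y Z f g h X' Y' Z' f' g' h' a b c] assms by (auto simp: iso_iso_arrow arr_def)

lemma TR3:
  assumes "T X Y Z f g h" "T X' Y' Z' f' g' h'" "arr a X X'" "arr b Y Y'" "b \<cdot> f = f' \<cdot> a"
  shows "\<exists>c. arr c Z Z' \<and> c \<cdot> g = g' \<cdot> b \<and> sa a \<cdot> h = h' \<cdot> c"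
  using TR3_morphism[OF assms(1,2), of a b] assms T_Ob[OF assms(1)] T_Ob[OF assms(2)]
    by (auto simp: arr_def)

section \<open>Zero objects and orthogonality\<close>

lemma zero_object_iff: "zero_object D Z \<longleftrightarrow> Z \<in> Ob D \<and> ident D Z = zo Z Z"
proof
  assume "zero_object D Z"
  then have Z: "Z \<in> Ob D" "\<exists>!f. f \<in> Hom D Z Z" by (auto simp: zero_object_def)
  then show "Z \<in> Ob D \<and> ident D Z = zo Z Z" using arr_ident[OF Z(1)] arr_zero[OF Z(1) Z(1)]
    by (auto simp: arr_def)
next
  assume Z: "Z \<in> Ob D \<and> ident D Z = zo Z Z"
  { fix X f assume "arr f X Z"
    then have "f = zo X Z" using Z cmp_id(2)[of f X Z] cmp_zero(2)[of f X Z Z] by simp }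
  moreover
  { fix X f assume "arr f Z X"
    then have "f = zo Z X" using Z cmp_id(1)[of f Z X] cmp_zero(1)[of f Z X Z] by simp }
  ultimately show "zero_object D Z" using Z arr_zero unfolding zero_object_def arr_def by metis
qed

lemma zero_Ob: "zero_object D Z \<Longrightarrow> Z \<in> Ob D"
  by (simp add: zero_object_iff)

definition orth :: "'o \<Rightarrow> 'o \<Rightarrow> bool" where "orth X Y \<longleftrightarrow> (\<forall>f. arr f X Y \<longrightarrow> f = zo X Y)"

lemma orthD: "\<lbrakk>orth X Y; arr f X Y\<rbrakk> \<Longrightarrow> f = zo X Y"
  by (auto simp: orth_def)

lemma orth_zero: assumes "zero_object D Z" shows "orth X Z" "orth Z X"
  using assms arr_zero unfolding zero_object_def orth_def arr_def by metis+

lemma orth_Hom: "\<lbrakk>X \<in> Ob D; Y \<in> Ob D\<rbrakk> \<Longrightarrow> orth X Y \<longleftrightarrow> Hom D X Y = {zo X Y}"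
  using arr_zero by (auto simp: orth_def arr_def)

lemma T_ident: "\<lbrakk>X \<in> Ob D; zero_object D Z\<rbrakk> \<Longrightarrow> T X X Z (ident D X) (zo X Z) (zo Z (sh X))"
  by (rule TR1_ident)

lemma zero_sh_iff: assumes "X \<in> Ob D" shows "zero_object D (sh X) \<longleftrightarrow> zero_object D X"
proof -
  have "sa (ident D X) = ident D (sh X)" "sa (zo X X) = zo (sh X) (sh X)"
    using sh_ident sh_zero assms by auto
  then show ?thesis using sh_inj[OF arr_ident arr_zero] assms sh_Ob by (metis zero_object_iff)
qed

lemma zero_iso: assumes "isomorphic D X Y" "zero_object D X" shows "zero_object D Y"
proof -
  obtain f g where f: "arr f X Y" "arr g Y X" "f \<cdot> g = ident D Y" using assms
    by (auto simp: isomorphic_iso iso_def)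
  have "f = zo X Y" using orth_zero(2)[OF assms(2)] f orthD by blast
  then show ?thesis using f cmp_zero(2)[OF f(2)] arr_Ob[OF f(1)] zero_object_iff by metis
qed

lemma zero_zero_iso: assumes "zero_object D X" "zero_object D Y" shows "isomorphic D X Y"
proof -
  have o: "X \<in> Ob D" "Y \<in> Ob D" using assms zero_Ob by auto
  have a: "arr (zo X Y) X Y" "arr (zo Y X) Y X" using arr_zero o by auto
  have "zo Y X \<cdot> zo X Y = ident D X" "zo X Y \<cdot> zo Y X = ident D Y"
    using arr_cmp a assms orth_zero orthD arr_ident o by metis+
  then show ?thesis using isoI a isomorphic_iso by blast
qed

section \<open>Exactness of Hom along triangles\<close>

lemma T_comp_zero: assumes "T X Y Z f g h" shows "g \<cdot> f = zo X Z"
proof -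
  obtain N where N: "zero_object D N" using ex_zero_object by blast
  note a = T_arr[OF assms] and ob = T_Ob[OF assms]
  \<comment> \<open>TR3 is applied to the identity triangle of \<open>X\<close>; the third arrow
    starts at a zero object.\<close>
  obtain c where c: "arr c N Z" "c \<cdot> zo X N = g \<cdot> f"
    using TR3[OF T_ident[OF ob(1) N] assms arr_ident[OF ob(1)] a(1)] by auto
  then show ?thesis using cmp_zero(1)[OF c(1) ob(1)] by simp
qed

text \<open>The triangle \<open>W -> W -> 0\<close> rotated backwards: the rotation axiom is an
  equivalence, and \<open>sh N\<close> is again a zero object.\<close>

lemma T_zero_ident: assumes "W \<in> Ob D" "zero_object D N"
  shows "T N W W (zo N W) (ident D W) (zo W (sh N))"
proof -
  have o: "N \<in> Ob D" "sh N \<in> Ob D" "sh W \<in> Ob D" using assms zero_Ob sh_Ob by auto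
  have z: "zero_object D (sh N)" using zero_sh_iff assms o by blast
  have "hneg (sh N) (sh W) (sa (zo N W)) = zo (sh N) (sh W)" using sh_zero neg_zero o assms by simp
  then show ?thesis using rotate_iff[OF arr_zero[OF o(1) assms(1)] arr_ident[OF assms(1)]
    arr_zero[OF assms(1) o(2)]]
     T_ident[OF assms(1) z] by simp
qed

text \<open>TR3 maps the triangle to \<open>0 -> W -> W\<close>, and the third arrow obtained is the
  factorisation.\<close>

lemma T_factor: assumes "T X Y Z f g h" "arr t Y W" "t \<cdot> f = zo X W"
  shows "\<exists>s. arr s Z W \<and> s \<cdot> g = t"
proof -
  obtain N where N: "zero_object D N" using ex_zero_object by blast
  note a = T_arr[OF assms(1)] and ob = T_Ob[OF assms(1)]
  have o: "W \<in> Ob D" "N \<in> Ob D" using assms arr_Ob N zero_Ob by auto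
  have "t \<cdot> f = zo N W \<cdot> zo X N" using assms cmp_zero(1)[OF arr_zero[OF o(2,1)] ob(1)] by simp
  then obtain c where "arr c Z W" "c \<cdot> g = ident D W \<cdot> t"
    using TR3[OF assms(1) T_zero_ident[OF o(1) N] arr_zero[OF ob(1) o(2)] assms(2)] by auto
  then show ?thesis using cmp_id assms by auto
qed

text \<open>TR3 only produces third arrows, so both triangles are rotated until the wanted lift
  stands in third place. It arrives shifted and is brought back by full faithfulness of the
  shift.\<close>

lemma T_lift: assumes "T X Y Z f g h" "arr t W Y" "g \<cdot> t = zo W Z" shows "\<exists>s. arr s W X \<and> f \<cdot> s = t"
proof -
  obtain N where N: "zero_object D N" using ex_zero_object by blast
  note a = T_arr[OF assms(1)] and ob = T_Ob[OF assms(1)]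
  have o: "W \<in> Ob D" "N \<in> Ob D" "sh W \<in> Ob D" using assms arr_Ob N zero_Ob sh_Ob by auto
  have e: "zo N Z \<cdot> zo W N = g \<cdot> t" using assms cmp_zero(1)[OF arr_zero[OF o(2) ob(3)] o(1)] by simp
  obtain c where c: "arr c (sh W) (sh X)"
      "sa t \<cdot> hneg (sh W) (sh W) (sa (ident D W)) = hneg (sh X) (sh Y) (sa f) \<cdot> c"
    using TR3[OF rotate[OF T_ident[OF o(1) N]] rotate[OF assms(1)] assms(2) arr_zero[OF o(2) ob(3)]
      e] by auto
  obtain s where s: "arr s W X" "sa s = c" using sh_full[OF c(1) o(1) ob(1)] by auto
  note at = arr_sh[OF assms(2)] and af = arr_sh[OF a(1)]
  have "hneg (sh W) (sh Y) (sa t) = hneg (sh W) (sh Y) (sa f \<cdot> c)"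
    using c(2) cmp_neg(1)[OF arr_ident[OF o(3)] at] cmp_id(1)[OF at] cmp_neg(2)[OF c(1) af]
      sh_ident[OF o(1)] by simp
  then have "sa t = sa (f \<cdot> s)" using neg_inj[OF at arr_cmp[OF c(1) af]] s sh_cmp[OF s(1) a(1)]
    by simp
  then have "t = f \<cdot> s" using sh_inj[OF assms(2) arr_cmp[OF s(1) a(1)]] by simp
  then show ?thesis using s by auto
qed

lemma T_lift3: assumes "T X Y Z f g h" "arr t W (sh X)" "sa f \<cdot> t = zo W (sh Y)"
  shows "\<exists>s. arr s W Z \<and> h \<cdot> s = t"
proof -
  note a = T_arr[OF assms(1)] and ob = T_Ob[OF assms(1)]
  have "hneg (sh X) (sh Y) (sa f) \<cdot> t = zo W (sh Y)"
    using cmp_neg(2)[OF assms(2) arr_sh[OF a(1)]] assms neg_zero arr_Ob sh_Ob ob by simp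
  then show ?thesis using T_lift[OF rotate[OF assms(1)] _] T_lift[OF rotate[OF rotate[OF assms(1)]]
    assms(2)]
    T_lift[OF rotate[OF assms(1)]] assms(2) by blast
qed

text \<open>By exactness, arrows from \<open>W\<close> killed by \<open>f\<close> come, after a
  shift, from arrows \<open>sh W -> Z\<close>, and these vanish. \<open>epi_eq\<close> is the
  dual.\<close>

lemma mono_eq: assumes "T X Y Z f g h" "orth (sh W) Z" "arr t W X" "arr t' W X" "f \<cdot> t = f \<cdot> t'"
  shows "t = t'"
proof -
  note a = T_arr[OF assms(1)] and ob = T_Ob[OF assms(1)]
  define d where "d = hadd D t (hneg W X t')"
  have d: "arr d W X" using assms arr_add arr_neg d_def by simp
  have "f \<cdot> d = hadd D (f \<cdot> t) (hneg W Y (f \<cdot> t'))"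
    using d_def cmp_add(1)[OF assms(3) arr_neg[OF assms(4)] a(1)] cmp_neg(1)[OF assms(4) a(1)]
      by simp
  then have "f \<cdot> d = zo W Y" using assms add_neg[OF arr_cmp[OF assms(4) a(1)]] by simp
  then have "sa f \<cdot> sa d = zo (sh W) (sh Y)" using sh_cmp[OF d a(1)] sh_zero ob arr_Ob[OF d] by simp
  then obtain s where s: "arr s (sh W) Z" "h \<cdot> s = sa d" using T_lift3[OF assms(1) arr_sh[OF d]]
    by auto
  then have "sa d = zo (sh W) (sh X)" using orthD[OF assms(2) s(1)] cmp_zero(1)[OF a(3)] arr_Ob[OF
    s(1)] by simp
  then have "sa d = sa (zo W X)" using sh_zero arr_Ob[OF d] by simp
  then have "d = zo W X" using sh_inj[OF d arr_zero] arr_Ob[OF d] by simp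
  then show ?thesis using diff_zero_eq assms d_def by simp
qed

lemma T_factor3: assumes "T X Y Z f g h" "arr t Z W" "t \<cdot> g = zo Y W"
  shows "\<exists>s. arr s (sh X) W \<and> s \<cdot> h = t"
  using T_factor[OF rotate[OF assms(1)] assms(2,3)] .

lemma epi_eq: assumes "T X Y Z f g h" "orth (sh X) W" "arr t Z W" "arr t' Z W" "t \<cdot> g = t' \<cdot> g"
  shows "t = t'"
proof -
  note a = T_arr[OF assms(1)] and ob = T_Ob[OF assms(1)]
  define d where "d = hadd D t (hneg Z W t')"
  have d: "arr d Z W" using assms arr_add arr_neg d_def by simp
  have "d \<cdot> g = hadd D (t \<cdot> g) (hneg Y W (t' \<cdot> g))"
    using d_def cmp_add(2)[OF a(2) assms(3) arr_neg[OF assms(4)]] cmp_neg(2)[OF a(2) assms(4)]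
      by simp
  then have "d \<cdot> g = zo Y W" using assms add_neg[OF arr_cmp[OF a(2) assms(4)]] by simp
  then obtain s where s: "arr s (sh X) W" "s \<cdot> h = d" using T_factor3[OF assms(1) d] by auto
  then have "d = zo Z W" using orthD[OF assms(2) s(1)] cmp_zero(2)[OF a(3)] arr_Ob[OF s(1)] by simp
  then show ?thesis using diff_zero_eq assms d_def by simp
qed

text \<open>The axioms complete only a first arrow. The cone of \<open>g\<close> is replaced by an
  isomorphic \<open>sh X\<close>, and its connecting arrow descends along the shift; the minus sign
  undoes the one in the rotation axiom.\<close>

lemma T_fibre: assumes "arr g Y Z" shows "\<exists>X f h. T X Y Z f g h"
proof -
  obtain C p q where C: "T Y Z C g p q" using TR1_cone[of Y Z g] assms unfolding arr_def by blast
  note a = T_arr[OF C] and ob = T_Ob[OF C]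
  obtain X k where X: "X \<in> Ob D" "iso k (sh X) C" using shift_ess_surj[OF ob(3)] isomorphic_iso
    by blast
  obtain k' where k': "iso k' C (sh X)" "k' \<cdot> k = ident D (sh X)" "k \<cdot> k' = ident D C"
    using iso_inv[OF X(2)] by auto
  note k = iso_arr[OF X(2)] iso_arr[OF k'(1)]
  have h1: "arr (k' \<cdot> p) Z (sh X)" "arr (q \<cdot> k) (sh X) (sh Y)" using arr_cmp a k by blast+
  obtain m where m: "arr m X Y" "sa m = q \<cdot> k" using sh_full[OF h1(2) X(1) ob(1)] by auto
  have e: "q \<cdot> k \<cdot> k' = q" using assoc[OF k(2,1) a(3)] k' cmp_id(1)[OF a(3)] by simp
  have "T Y Z (sh X) g (k' \<cdot> p) (q \<cdot> k)"
    apply (rule T_iso[OF C iso_ident[OF ob(1)] iso_ident[OF ob(2)] k'(1) a(1) h1])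
    using cmp_id[OF a(1)] cmp_id[OF h1(1)] e sh_ident[OF ob(1)] cmp_id(2)[OF a(3)] by auto
  moreover have "hneg (sh X) (sh Y) (sa (hneg X Y m)) = q \<cdot> k"
    using sh_neg[OF m(1)] m(2) neg_neg[OF h1(2)] by simp
  ultimately have "T X Y Z (hneg X Y m) g (k' \<cdot> p)"
    using rotate_iff[OF arr_neg[OF m(1)] assms h1(1)] by simp
  then show ?thesis by blast
qed

lemma T_zero3_iso: assumes "T X Y Z f g h" "zero_object D Z" shows "iso f X Y"
proof -
  note a = T_arr[OF assms(1)] and ob = T_Ob[OF assms(1)]
  have "g \<cdot> ident D Y = zo Y Z" using orth_zero(1)[OF assms(2)] orthD arr_cmp arr_ident ob a
    by metis
  then obtain s where s: "arr s Y X" "f \<cdot> s = ident D Y"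
    using T_lift[OF assms(1) arr_ident[OF ob(2)]] by auto
  have "f \<cdot> (s \<cdot> f) = f \<cdot> ident D X" using assoc[OF a(1) s(1) a(1)] s cmp_id[OF a(1)] by simp
  then have "s \<cdot> f = ident D X"
    using mono_eq[OF assms(1) orth_zero(1)[OF assms(2)] arr_cmp[OF a(1) s(1)] arr_ident[OF ob(1)]]
      by simp
  then show ?thesis using isoI a s by blast
qed

lemma T_zero1_iso: assumes "T X Y Z f g h" "zero_object D X" shows "iso g Y Z"
proof -
  note a = T_arr[OF assms(1)] and ob = T_Ob[OF assms(1)]
  have z: "zero_object D (sh X)" using assms zero_sh_iff ob by blast
  have "ident D Y \<cdot> f = zo X Y" using orth_zero(2)[OF assms(2)] orthD arr_cmp arr_ident ob a
    by metis
  then obtain s where s: "arr s Z Y" "s \<cdot> g = ident D Y"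
    using T_factor[OF assms(1) arr_ident[OF ob(2)]] by auto
  have "(g \<cdot> s) \<cdot> g = ident D Z \<cdot> g" using assoc[OF a(2) s(1) a(2)] s cmp_id[OF a(2)] by simp
  then have "g \<cdot> s = ident D Z"
    using epi_eq[OF assms(1) orth_zero(2)[OF z] arr_cmp[OF s(1) a(2)] arr_ident[OF ob(3)]] by simp
  then show ?thesis using isoI a s by blast
qed

lemma T_zero2_iso: assumes "T X Y Z f g h" "zero_object D Y" shows "iso h Z (sh X)"
  using T_zero1_iso[OF rotate[OF assms(1)] assms(2)] .

section \<open>Shifting triangles\<close>

lemma T_rot3: "T X Y Z f g h \<Longrightarrow>
   T (sh X) (sh Y) (sh Z) (hneg (sh X) (sh Y) (sa f)) (hneg (sh Y) (sh Z) (sa g)) (hneg (sh Z) (sh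
     (sh X)) (sa h))"
  by (rule rotate[OF rotate[OF rotate]])

text \<open>Three rotations give the shifted triangle with three minus signs. The automorphism -1 of
  the middle vertex absorbs two of them, the third stays at the connecting arrow.\<close>

lemma T_sh: assumes "T X Y Z f g h" shows "T (sh X) (sh Y) (sh Z) (sa f) (sa g) (hneg (sh Z) (sh (sh
  X)) (sa h))"
proof -
  note a = T_arr[OF assms(1)] and ob = T_Ob[OF assms(1)]
  note b = arr_sh[OF a(1)] arr_sh[OF a(2)] arr_sh[OF a(3)]
    and so = sh_Ob[OF ob(1)] sh_Ob[OF ob(2)] sh_Ob[OF ob(3)]
  note i = arr_ident[OF so(2)]
  show ?thesis
    apply (rule T_iso[OF T_rot3[OF assms] iso_ident[OF so(1)] iso_neg_ident[OF so(2)] iso_ident[OF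
      so(3)] b(1,2) arr_neg[OF b(3)]])
    using cmp_neg(2)[OF arr_neg[OF b(1)] i] cmp_id[OF arr_neg[OF b(1)]] neg_neg[OF b(1)] cmp_id[OF
      b(1)]
      cmp_neg(1)[OF i b(2)] cmp_id[OF b(2)] cmp_id[OF arr_neg[OF b(2)]] sh_ident[OF so(1)] cmp_id[OF
        arr_neg[OF b(3)]]
    by auto
qed

text \<open>The arrows descend by fullness, the signs are arranged as three rotations produce them,
  and the rotation axiom is read backwards three times.\<close>

lemma T_unsh: assumes "T (sh X) (sh Y) (sh Z) u v w" "X \<in> Ob D" "Y \<in> Ob D" "Z \<in> Ob D"
  shows "\<exists>f g h. T X Y Z f g h \<and> sa f = u \<and> sa g = v"
proof -
  note a = T_arr[OF assms(1)] and ob = assms(2-4)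
  obtain f g h where f: "arr f X Y" "sa f = u" and g: "arr g Y Z" "sa g = v"
    and h: "arr h Z (sh X)" "sa h = w"
    using sh_full[OF a(1)] sh_full[OF a(2)] sh_full[OF a(3)] ob sh_Ob by metis
  note so = sh_Ob[OF ob(1)] sh_Ob[OF ob(2)] sh_Ob[OF ob(3)]
  note i = arr_ident[OF so(2)]
  have nh: "hneg (sh Z) (sh (sh X)) (sa (hneg Z (sh X) h)) = w"
    using sh_neg[OF h(1)] neg_neg[OF a(3)] h by simp
  have "T (sh X) (sh Y) (sh Z) (hneg (sh X) (sh Y) (sa f)) (hneg (sh Y) (sh Z) (sa g)) w"
    apply (rule T_iso[OF assms(1) iso_ident[OF so(1)] iso_neg_ident[OF so(2)] iso_ident[OF so(3)]])
    using f g a arr_neg cmp_neg(2)[OF a(1) i] cmp_id[OF a(1)] cmp_id[OF arr_neg[OF a(1)]]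
      cmp_neg(1)[OF i arr_neg[OF a(2)]] cmp_id[OF arr_neg[OF a(2)]] neg_neg[OF a(2)] cmp_id[OF a(2)]
      sh_ident[OF so(1)] cmp_id[OF a(3)] by auto
  then have "T X Y Z f g (hneg Z (sh X) h)"
    using rotate_iff[OF f(1) g(1) arr_neg[OF h(1)]] rotate_iff[OF g(1) arr_neg[OF h(1)] arr_neg[OF
      arr_sh[OF f(1)]]]
      rotate_iff[OF arr_neg[OF h(1)] arr_neg[OF arr_sh[OF f(1)]] arr_neg[OF arr_sh[OF g(1)]]] nh
        by simp
  then show ?thesis using f g by blast
qed

end

section \<open>Extensions of classes of objects\<close>

context triangulated
begin

definition star :: "'o set \<Rightarrow> 'o set \<Rightarrow> 'o set" where
  "star S R = {E. \<exists>X\<in>S. \<exists>Y\<in>R. \<exists>f g h. T X E Y f g h}"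

definition shifts :: "'o set \<Rightarrow> 'o set" where
  "shifts S = {E. \<exists>X\<in>S. isomorphic D (sh X) E}"

definition zeros :: "'o set" where "zeros = {Z. zero_object D Z}"

definition iso_closed :: "'o set \<Rightarrow> bool" where
  "iso_closed S \<longleftrightarrow> S \<subseteq> Ob D \<and> (\<forall>X\<in>S. \<forall>Y. isomorphic D X Y \<longrightarrow> Y \<in> S)"

definition Orth :: "'o set \<Rightarrow> 'o set \<Rightarrow> bool" where "Orth S R \<longleftrightarrow> (\<forall>X\<in>S. \<forall>Y\<in>R. orth X Y)"

lemma starI: "\<lbrakk>T X E Y f g h; X \<in> S; Y \<in> R\<rbrakk> \<Longrightarrow> E \<in> star S R"
  unfolding star_def by blast

lemma starE: assumes "E \<in> star S R" obtains X Y f g h where "X \<in> S" "Y \<in> R" "T X E Y f g h"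
  using assms unfolding star_def by blast

lemma star_sing: "E \<in> star S R \<longleftrightarrow> (\<exists>X\<in>S. \<exists>Y\<in>R. E \<in> star {X} {Y})"
  unfolding star_def by blast

lemma star_singE: assumes "E \<in> star S R" obtains X Y where "X \<in> S" "Y \<in> R" "E \<in> star {X} {Y}"
  using assms star_sing by blast

lemma star_singI: "\<lbrakk>E \<in> star {X} {Y}; X \<in> S; Y \<in> R\<rbrakk> \<Longrightarrow> E \<in> star S R"
  using star_sing by blast

lemma star_mono: "\<lbrakk>S \<subseteq> S'; R \<subseteq> R'\<rbrakk> \<Longrightarrow> star S R \<subseteq> star S' R'"
  unfolding star_def by blast

lemma star_Ob: "E \<in> star S R \<Longrightarrow> E \<in> Ob D"
  by (elim starE) (rule T_Ob)

lemma star_Ob_sub: "star S R \<subseteq> Ob D"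
  using star_Ob by blast

lemma star_sing_Ob: "E \<in> star {X} {Y} \<Longrightarrow> X \<in> Ob D" "E \<in> star {X} {Y} \<Longrightarrow> Y \<in> Ob D"
  by (auto elim!: starE dest: T_Ob)

lemma T_change:
  assumes "T X E Y f g h" "isomorphic D X X'" "isomorphic D E E'" "isomorphic D Y Y'"
  shows "\<exists>f g h. T X' E' Y' f g h"
proof -
  obtain a b c where i: "iso a X X'" "iso b E E'" "iso c Y Y'" using assms
    by (auto simp: isomorphic_iso)
  obtain a' where a': "arr a' X' X" "a' \<cdot> a = ident D X" using iso_inv[OF i(1)] iso_arr by blast
  obtain b' where b': "arr b' E' E" "b' \<cdot> b = ident D E" using iso_inv[OF i(2)] iso_arr by blast
  obtain c' where c': "arr c' Y' Y" "c' \<cdot> c = ident D Y" using iso_inv[OF i(3)] iso_arr by blast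
  note t = T_arr[OF assms(1)] and ia = iso_arr[OF i(1)] iso_arr[OF i(2)] iso_arr[OF i(3)]
  note sa = arr_sh[OF ia(1)]
  have 1: "arr (b \<cdot> f) X E'" "arr (c \<cdot> g) E Y'" "arr (sa a \<cdot> h) Y (sh X')" using arr_cmp t ia sa
    by blast+
  have 2: "arr (b \<cdot> f \<cdot> a') X' E'" "arr (c \<cdot> g \<cdot> b') E' Y'" "arr (sa a \<cdot> h \<cdot> c') Y' (sh X')"
    using arr_cmp 1 a' b' c' by blast+
  have "T X' E' Y' (b \<cdot> f \<cdot> a') (c \<cdot> g \<cdot> b') (sa a \<cdot> h \<cdot> c')"
    apply (rule T_iso[OF assms(1) i 2])
    using assoc[OF ia(1) a'(1) 1(1)] assoc[OF ia(2) b'(1) 1(2)] assoc[OF ia(3) c'(1) 1(3)]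
      a' b' c' cmp_id 1 by auto
  then show ?thesis by blast
qed

lemma star_change: "\<lbrakk>E \<in> star {X} {Y}; isomorphic D X X'; isomorphic D E E'; isomorphic D Y Y'\<rbrakk> \<Longrightarrow> E'
  \<in> star {X'} {Y'}"
  using T_change unfolding star_def by blast

lemma iso_closed_star: "iso_closed (star S R)"
  unfolding iso_closed_def
proof (intro conjI ballI allI impI)
  show "star S R \<subseteq> Ob D" by (rule star_Ob_sub)
  fix E E' assume E: "E \<in> star S R" "isomorphic D E E'"
  then obtain X Y where *: "X \<in> S" "Y \<in> R" "E \<in> star {X} {Y}" using star_sing by blast
  then show "E' \<in> star S R"
    using star_change[OF *(3) isomorphic_refl E(2) isomorphic_refl] star_sing_Ob[OF *(3)] star_singI
      by blast
qed

lemma iso_closedD: "\<lbrakk>iso_closed S; X \<in> S; isomorphic D X Y\<rbrakk> \<Longrightarrow> Y \<in> S"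
  and iso_closed_Ob: "iso_closed S \<Longrightarrow> X \<in> S \<Longrightarrow> X \<in> Ob D"
  unfolding iso_closed_def by blast+

lemma iso_closed_zeros: "iso_closed zeros"
  unfolding iso_closed_def zeros_def using zero_iso zero_Ob by blast

lemma octahedron:
  assumes "T X Y Z' f i i'" "T Y Z X' g j j'"
  shows "\<exists>Y' k k' u v w. T X Z Y' (g \<cdot> f) k k' \<and> T Z' Y' X' u v w \<and> v \<cdot> k = j"
proof -
  have "arr (g \<cdot> f) X Z" using arr_cmp T_arr(1)[OF assms(1)] T_arr(1)[OF assms(2)] by blast
  then obtain Y' k k' where "T X Z Y' (g \<cdot> f) k k'" using TR1_cone[of X Z "g \<cdot> f"] unfolding arr_def
    by blast
  then show ?thesis using TR4_octahedron[OF assms] by blast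
qed

text \<open>From left to right the octahedron is applied to \<open>x -> w -> E\<close>. Conversely,
  \<open>w\<close> is the fibre of the composite \<open>E -> v -> z\<close>; the octahedron on the
  rotated triangles gives the triangle on \<open>x\<close>, \<open>w\<close>, \<open>y\<close> only
  after a shift, whence \<open>T_unsh\<close>.\<close>

lemma star_assoc: "star (star A B) C = star A (star B C)"
proof (intro equalityI subsetI)
  fix E assume "E \<in> star (star A B) C"
  then obtain w z g j j' x y f i i' where *: "T w E z g j j'" "z \<in> C" "T x w y f i i'" "x \<in> A" "y \<in>
    B"
    by (auto elim!: starE)
  obtain v k k' u u' w' where "T x E v (g \<cdot> f) k k'" "T y v z u u' w'" using octahedron[OF *(3,1)]
    by blast
  then show "E \<in> star A (star B C)" using * starI by metis
next
  fix E assume "E \<in> star A (star B C)"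
  then obtain v x y z p k k' r q q' where *: "T x E v p k k'" "x \<in> A" "T y v z r q q'" "y \<in> B" "z \<in>
    C"
    by (auto elim!: starE)
  have "arr (q \<cdot> k) E z" using arr_cmp T_arr[OF *(1)] T_arr[OF *(3)] by blast
  then obtain w m n where w: "T w E z m (q \<cdot> k) n" using T_fibre by blast
  obtain u v' where "T (sh x) (sh w) (sh y) u v' (sa k' \<cdot> (hneg (sh y) (sh v) (sa r)))"
    using TR4_octahedron[OF rotate[OF *(1)] rotate[OF *(3)] rotate[OF w]] by blast
  then have "\<exists>f g h. T x w y f g h" using T_unsh T_Ob[OF *(1)] T_Ob[OF *(3)] T_Ob[OF w] by metis
  then show "E \<in> star (star A B) C" using * w starI by metis
qed

lemma star_zero_left: assumes "iso_closed S" shows "star zeros S = S"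
proof (intro equalityI subsetI)
  fix E assume "E \<in> star zeros S"
  then obtain X Y f g h where *: "X \<in> zeros" "Y \<in> S" "T X E Y f g h" by (elim starE)
  then have "isomorphic D E Y" using T_zero1_iso isomorphic_iso zeros_def by blast
  then show "E \<in> S" using assms * isomorphic_sym iso_closedD by blast
next
  fix E assume E: "E \<in> S"
  obtain N where "zero_object D N" using ex_zero_object by blast
  then show "E \<in> star zeros S" using starI[OF T_zero_ident[of E N]] iso_closed_Ob[OF assms E] E
    zeros_def by auto
qed

lemma star_zero_right: assumes "iso_closed S" shows "star S zeros = S"
proof (intro equalityI subsetI)
  fix E assume "E \<in> star S zeros"
  then obtain X Y f g h where *: "Y \<in> zeros" "X \<in> S" "T X E Y f g h" by (elim starE)
  then have "isomorphic D X E" using T_zero3_iso isomorphic_iso zeros_def by blast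
  then show "E \<in> S" using assms * iso_closedD by blast
next
  fix E assume E: "E \<in> S"
  obtain N where "zero_object D N" using ex_zero_object by blast
  then show "E \<in> star S zeros" using starI[OF T_ident[of E N]] iso_closed_Ob[OF assms E] E zeros_def
    by auto
qed

lemma star_sing_zero_left: "\<lbrakk>E \<in> star {X} {Y}; zero_object D X\<rbrakk> \<Longrightarrow> isomorphic D E Y"
  using T_zero1_iso isomorphic_iso by (blast elim: starE)

lemma star_sing_zero_right: "\<lbrakk>E \<in> star {X} {Y}; zero_object D Y\<rbrakk> \<Longrightarrow> isomorphic D X E"
  using T_zero3_iso isomorphic_iso by (blast elim: starE)

lemma star_sing_refl: assumes "E \<in> Ob D" "zero_object D N"
  shows "E \<in> star {E} {N}" "E \<in> star {N} {E}"
  using starI[OF T_ident[OF assms]] starI[OF T_zero_ident[OF assms]] by auto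

lemma star_rot: assumes "E \<in> star {X} {Y}" shows "Y \<in> star {E} {sh X}" "sh X \<in> star {Y} {sh E}"
proof -
  obtain f g h where t: "T X E Y f g h" using assms by (auto elim: starE)
  show "Y \<in> star {E} {sh X}" "sh X \<in> star {Y} {sh E}"
    using starI[OF rotate[OF t]] starI[OF rotate[OF rotate[OF t]]] by auto
qed

lemma star_sh: "E \<in> star {X} {Y} \<Longrightarrow> sh E \<in> star {sh X} {sh Y}"
  using T_sh starI by (blast elim!: starE)

lemma star_unsh: "\<lbrakk>sh E \<in> star {sh X} {sh Y}; X \<in> Ob D; E \<in> Ob D; Y \<in> Ob D\<rbrakk> \<Longrightarrow> E \<in> star {X} {Y}"
  using T_unsh starI by (blast elim!: starE)

lemma unsh_ex: assumes "X \<in> Ob D" shows "\<exists>W \<in> Ob D. isomorphic D (sh W) X"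
  using shift_ess_surj[OF assms] .

text \<open>The connecting arrow vanishes, so \<open>E -> Y\<close> has a section. The octahedron
  for the section, the projection and the identity of \<open>Y\<close> identifies the cone of the
  section with \<open>X\<close>.\<close>

lemma star_swap: assumes "E \<in> star {X} {Y}" "orth Y (sh X)" shows "E \<in> star {Y} {X}"
proof -
  obtain f g h where t: "T X E Y f g h" using assms by (auto elim: starE)
  note a = T_arr[OF t] and ob = T_Ob[OF t]
  have "h \<cdot> ident D Y = zo Y (sh X)" using assms orthD a cmp_id by metis
  then obtain s where s: "arr s Y E" "g \<cdot> s = ident D Y"
    using T_lift[OF rotate[OF t] arr_ident[OF ob(3)]] by auto
  obtain C i i' where C: "T Y E C s i i'" using TR1_cone[of Y E s] s unfolding arr_def by blast
  obtain N where N: "zero_object D N" using ex_zero_object by blast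
  obtain u v w where u: "T C N (sh X) u v w"
    using TR4_octahedron[OF C rotate[OF t], of N "zo Y N" "zo N (sh Y)"] T_ident[OF ob(3) N] s
      by auto
  have "isomorphic D (sh X) (sh C)" using T_zero2_iso[OF u N] isomorphic_iso by blast
  then have "isomorphic D C X" using isomorphic_unsh isomorphic_sym ob T_Ob[OF C] by blast
  then show ?thesis using star_change[of E Y C Y E X] starI[OF C] isomorphic_refl ob by blast
qed

section \<open>Orthogonality and extensions\<close>

lemma orth_star_left: assumes "E \<in> star {X} {Y}" "orth X W" "orth Y W" shows "orth E W"
proof -
  obtain f g h where t: "T X E Y f g h" using assms by (auto elim: starE)
  note a = T_arr[OF t]
  { fix q assume q: "arr q E W"
    then have "q \<cdot> f = zo X W" using assms orthD arr_cmp a by blast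
    then obtain s where s: "arr s Y W" "s \<cdot> g = q" using T_factor[OF t q] by auto
    then have "q = zo E W" using assms orthD cmp_zero(2)[OF a(2)] arr_Ob[OF s(1)] by metis }
  then show ?thesis by (simp add: orth_def)
qed

lemma orth_star_right: assumes "E \<in> star {X} {Y}" "orth W X" "orth W Y" shows "orth W E"
proof -
  obtain f g h where t: "T X E Y f g h" using assms by (auto elim: starE)
  note a = T_arr[OF t]
  { fix q assume q: "arr q W E"
    then have "g \<cdot> q = zo W Y" using assms orthD arr_cmp a by blast
    then obtain s where s: "arr s W X" "f \<cdot> s = q" using T_lift[OF t q] by auto
    then have "q = zo W E" using assms orthD cmp_zero(1)[OF a(1)] arr_Ob[OF s(1)] by metis }
  then show ?thesis by (simp add: orth_def)
qed

lemma Orth_star_left: "\<lbrakk>Orth S W; Orth R W\<rbrakk> \<Longrightarrow> Orth (star S R) W"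
  unfolding Orth_def by (blast elim: star_singE intro: orth_star_left)

lemma Orth_star_right: "\<lbrakk>Orth W S; Orth W R\<rbrakk> \<Longrightarrow> Orth W (star S R)"
  unfolding Orth_def by (blast elim: star_singE intro: orth_star_right)

lemma Orth_mono: "\<lbrakk>Orth S R; S' \<subseteq> S; R' \<subseteq> R\<rbrakk> \<Longrightarrow> Orth S' R'"
  unfolding Orth_def by blast

lemma orth_iso: assumes "orth X Y" "isomorphic D X X'" "isomorphic D Y Y'" shows "orth X' Y'"
proof -
  obtain a b where i: "iso a X X'" "iso b Y Y'" using assms by (auto simp: isomorphic_iso)
  obtain a' where a': "arr a' X' X" "a \<cdot> a' = ident D X'" using iso_inv[OF i(1)] iso_arr by blast
  obtain b' where b': "arr b' Y' Y" "b \<cdot> b' = ident D Y'" using iso_inv[OF i(2)] iso_arr by blast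
  note ia = iso_arr[OF i(1)] iso_arr[OF i(2)]
  { fix q assume q: "arr q X' Y'"
    have r: "arr (b' \<cdot> q) X' Y" using arr_cmp q b' by blast
    have z: "b' \<cdot> q \<cdot> a = zo X Y" using orthD[OF assms(1)] arr_cmp r ia by blast
    have "q = b \<cdot> (b' \<cdot> q)" using assoc[OF q b'(1) ia(2)] b' cmp_id q by simp
    also have "b' \<cdot> q = b' \<cdot> q \<cdot> a \<cdot> a'" using assoc[OF a'(1) ia(1) r] a' cmp_id r by simp
    also have "\<dots> = zo X' Y" using z cmp_zero(2)[OF a'(1)] arr_Ob r by metis
    finally have "q = zo X' Y'" using cmp_zero(1)[OF ia(2)] arr_Ob[OF q] by simp }
  then show ?thesis by (simp add: orth_def)
qed

lemma orth_sh_iff: assumes "X \<in> Ob D" "Y \<in> Ob D" shows "orth (sh X) (sh Y) \<longleftrightarrow> orth X Y"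
proof
  assume h: "orth (sh X) (sh Y)"
  { fix f assume f: "arr f X Y"
    then have "sa f = sa (zo X Y)" using orthD[OF h arr_sh] sh_zero assms by simp
    then have "f = zo X Y" using sh_inj f arr_zero assms by blast }
  then show "orth X Y" by (simp add: orth_def)
next
  assume h: "orth X Y"
  { fix f assume f: "arr f (sh X) (sh Y)"
    then obtain g where "arr g X Y" "sa g = f" using sh_full assms by blast
    then have "f = zo (sh X) (sh Y)" using orthD[OF h] sh_zero assms by metis }
  then show "orth (sh X) (sh Y)" by (simp add: orth_def)
qed

text \<open>If \<open>E -> Y\<close> vanishes, the identity of \<open>Y\<close> factors through
  \<open>sh X\<close> and is therefore zero; dually for \<open>X -> E\<close>. This is how one end
  of a truncation triangle is shown to be trivial.\<close>

lemma star_zero_end: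
  assumes "E \<in> star {X} {Y}" "orth (sh X) Y"
  shows "orth X E \<Longrightarrow> zero_object D X" "orth E Y \<Longrightarrow> zero_object D Y"
proof -
  obtain f g h where t: "T X E Y f g h" using assms by (auto elim: starE)
  note a = T_arr[OF t] and ob = T_Ob[OF t]
  show "zero_object D Y" if "orth E Y"
  proof -
    have "ident D Y \<cdot> g = zo E Y" using orthD[OF that a(2)] cmp_id[OF a(2)] by simp
    then obtain s where s: "arr s (sh X) Y" "s \<cdot> h = ident D Y"
      using T_factor3[OF t arr_ident[OF ob(3)]] by auto
    then have "ident D Y = zo Y Y" using orthD[OF assms(2) s(1)] cmp_zero(2)[OF a(3)] ob by simp
    then show ?thesis using zero_object_iff ob by blast
  qed
  show "zero_object D X" if "orth X E"
  proof -
    have "sa f = zo (sh X) (sh E)" using orthD[OF that a(1)] sh_zero ob by simp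
    then have "sa f \<cdot> ident D (sh X) = zo (sh X) (sh E)" using cmp_id arr_sh[OF a(1)] by simp
    then obtain s where s: "arr s (sh X) Y" "h \<cdot> s = ident D (sh X)"
      using T_lift3[OF t arr_ident[OF sh_Ob[OF ob(1)]]] by auto
    then have "ident D (sh X) = zo (sh X) (sh X)"
      using orthD[OF assms(2) s(1)] cmp_zero(1)[OF a(3)] ob sh_Ob by simp
    then show ?thesis using zero_object_iff zero_sh_iff ob sh_Ob by blast
  qed
qed

lemma shifts_star: "shifts (star S R) = star (shifts S) (shifts R)" if "S \<subseteq> Ob D" "R \<subseteq> Ob D"
proof (intro equalityI subsetI)
  fix E assume "E \<in> shifts (star S R)"
  then obtain E' X Y where *: "isomorphic D (sh E') E" "X \<in> S" "Y \<in> R" "E' \<in> star {X} {Y}"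
    unfolding shifts_def by (blast elim: star_singE)
  have o: "X \<in> Ob D" "Y \<in> Ob D" using that * by auto
  have "E \<in> star {sh X} {sh Y}" using star_change[OF star_sh[OF *(4)]] * isomorphic_refl sh_Ob o
    by blast
  moreover have "sh X \<in> shifts S" "sh Y \<in> shifts R" unfolding shifts_def
    using * o isomorphic_refl sh_Ob by blast+
  ultimately show "E \<in> star (shifts S) (shifts R)" by (rule star_singI)
next
  fix E assume "E \<in> star (shifts S) (shifts R)"
  then obtain X Y X' Y' where *: "X \<in> S" "isomorphic D (sh X) X'" "Y \<in> R" "isomorphic D (sh Y) Y'"
    "E \<in> star {X'} {Y'}"
    unfolding shifts_def by (blast elim: star_singE)
  obtain W where W: "W \<in> Ob D" "isomorphic D (sh W) E" using unsh_ex star_Ob[OF *(5)] by blast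
  have "sh W \<in> star {sh X} {sh Y}" using star_change[OF *(5)] * W isomorphic_sym by blast
  then have "W \<in> star {X} {Y}" using star_unsh W * that by blast
  then have "W \<in> star S R" using * by (blast intro: star_singI)
  then show "E \<in> shifts (star S R)" using W unfolding shifts_def by blast
qed

lemma shifts_zeros: "shifts zeros = zeros"
proof (intro equalityI subsetI)
  fix E assume "E \<in> shifts zeros"
  then show "E \<in> zeros" unfolding shifts_def zeros_def using zero_sh_iff zero_iso zero_Ob by blast
next
  fix E assume E: "E \<in> zeros"
  then have "isomorphic D (sh E) E" using zero_zero_iso zero_sh_iff zero_Ob unfolding zeros_def
    by blast
  then show "E \<in> shifts zeros" using E unfolding shifts_def by blast
qed

lemma mem_shifts: "\<lbrakk>iso_closed S; X \<in> Ob D\<rbrakk> \<Longrightarrow> sh X \<in> shifts S \<longleftrightarrow> X \<in> S"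
  unfolding shifts_def using isomorphic_unsh iso_closedD isomorphic_refl sh_Ob iso_closed_Ob
    by blast

text \<open>The definition provides closure under cones only. Extensions reduce to it by rotation,
  as \<open>sh E\<close> is the cone of \<open>Y -> sh X\<close>; closure under isomorphism is the
  case of an extension by a zero object.\<close>

lemma tsub:
  assumes "triangulated_subcategory D S"
  shows tsub_Ob: "X \<in> S \<Longrightarrow> X \<in> Ob D" and tsub_sh: "X \<in> Ob D \<Longrightarrow> sh X \<in> S \<longleftrightarrow> X \<in> S"
    and tsub_ext: "\<lbrakk>E \<in> star {X} {Y}; X \<in> S; Y \<in> S\<rbrakk> \<Longrightarrow> E \<in> S"
    and tsub_zero: "zero_object D Z \<Longrightarrow> Z \<in> S"
    and tsub_iso: "\<lbrakk>isomorphic D X Y; X \<in> S\<rbrakk> \<Longrightarrow> Y \<in> S"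
proof -
  show 1: "X \<in> S \<Longrightarrow> X \<in> Ob D" for X using assms unfolding triangulated_subcategory_def by blast
  show 2: "X \<in> Ob D \<Longrightarrow> sh X \<in> S \<longleftrightarrow> X \<in> S" for X using assms unfolding triangulated_subcategory_def
    by blast
  have 3: "\<lbrakk>E \<in> star {X} {Y}; X \<in> S; E \<in> S\<rbrakk> \<Longrightarrow> Y \<in> S" for E X Y
    using assms unfolding triangulated_subcategory_def star_def by blast
  show 4: "\<lbrakk>E \<in> star {X} {Y}; X \<in> S; Y \<in> S\<rbrakk> \<Longrightarrow> E \<in> S" for E X Y
    using 3[OF star_rot(2)[of E X Y]] 2 1 star_Ob by blast
  show 6: "zero_object D Z \<Longrightarrow> Z \<in> S" for Z
  proof -
    assume Z: "zero_object D Z"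
    obtain X where "X \<in> S" using assms unfolding triangulated_subcategory_def by blast
    then show ?thesis using 3[OF star_sing_refl(1)[OF 1 Z]] by blast
  qed
  show "\<lbrakk>isomorphic D X Y; X \<in> S\<rbrakk> \<Longrightarrow> Y \<in> S" for X Y
  proof -
    assume a: "isomorphic D X Y" "X \<in> S"
    obtain N where N: "zero_object D N" using ex_zero_object by blast
    have o: "X \<in> Ob D" "Y \<in> Ob D" using a isomorphic_Ob by blast+
    have "Y \<in> star {X} {N}"
      using star_change[OF star_sing_refl(1)[OF o(1) N]] isomorphic_refl o a N zero_Ob by blast
    then show "Y \<in> S" using 4 a 6[OF N] by blast
  qed
qed

lemma tsub_Ob_D: "triangulated_subcategory D (Ob D)"
  unfolding triangulated_subcategory_def using ex_zero_object zero_Ob T_Ob sh_Ob unsh_ex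
    isomorphic_Ob by blast

end

section \<open>Slicings indexed by an ordered group\<close>

text \<open>\<open>Y'\<close> plays the role of \<open>Y[-1]\<close>, and the triangle is rotated
  backwards. This serves to bound the phases of fibres from above.\<close>

lemma (in triangulated) star_fibre:
  assumes "E \<in> star {X} {Y}" "isomorphic D (sh Y') Y" "Y' \<in> Ob D"
  shows "X \<in> star {Y'} {E}"
proof -
  note o = star_sing_Ob[OF assms(1)] star_Ob[OF assms(1)]
  have "sh X \<in> star {sh Y'} {sh E}"
    using star_change[OF star_rot(2)[OF assms(1)] isomorphic_sym[OF assms(2)] isomorphic_refl
      isomorphic_refl]
      o sh_Ob by blast
  then show ?thesis using star_unsh o assms(3) by blast
qed

text \<open>The index group is either \<open>\<real>\<close> (slicings) or \<open>\<int>\<close> (decompositions into finitely many sectors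
  up to shift); \<open>s\<close> is the amount by which the shift functor moves the index.\<close>

lemma (in triangulated) tsub_star: assumes "triangulated_subcategory D S" "A \<subseteq> S" "B \<subseteq> S"
  shows "star A B \<subseteq> S"
proof
  fix E assume "E \<in> star A B"
  then obtain X Y where "X \<in> A" "Y \<in> B" "E \<in> star {X} {Y}" by (rule star_singE)
  then show "E \<in> S" using tsub_ext[OF assms(1)] assms(2,3) by (meson subsetD)
qed

text \<open>Existence of filtrations is left to \<open>hn_slicing\<close>: for the sectors and for
  the refined slices it is derived with the calculus set up in this weaker setting.\<close>

locale sliced_subcategory = triangulated D
  for D :: "('o, 'm) tricat" (structure) +
  fixes \<A> :: "'o set" and P :: "'i::linordered_ab_group_add \<Rightarrow> 'o set" and s :: 'i
  assumes sub: "triangulated_subcategory D \<A>"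
    and P_sub: "P p \<subseteq> \<A>"
    and P_iso_closed: "iso_closed (P p)"
    and P_zero: "zeros \<subseteq> P p"
    and s_pos: "s > 0"
    and P_shift: "P (p + s) = shifts (P p)"
    and P_orth: "q < p \<Longrightarrow> Orth (P p) (P q)"
begin

text \<open>The head of the list is the phase of the last quotient, so a Harder--Narasimhan
  filtration corresponds to an increasing list of phases.\<close>

fun filt :: "'i list \<Rightarrow> 'o set" where
  "filt [] = zeros"
| "filt (p # L) = star (filt L) (P p)"

definition HN :: "'i set \<Rightarrow> 'o set" where
  "HN J = {E. \<exists>L. sorted_wrt (<) L \<and> set L \<subseteq> J \<and> E \<in> filt L}"

lemma HNI: "\<lbrakk>sorted_wrt (<) L; set L \<subseteq> J; E \<in> filt L\<rbrakk> \<Longrightarrow> E \<in> HN J"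
  unfolding HN_def by blast

lemma HNE: assumes "E \<in> HN J" obtains L where "sorted_wrt (<) L" "set L \<subseteq> J" "E \<in> filt L"
  using assms unfolding HN_def by blast

lemma filt_iso_closed: "iso_closed (filt L)"
  by (cases L) (auto simp: iso_closed_zeros iso_closed_star)

lemma filt_sub: "filt L \<subseteq> \<A>"
proof (induction L)
  case Nil
  then show ?case using tsub_zero[OF sub] by (auto simp: zeros_def)
next
  case (Cons p L)
  then show ?case using tsub_star[OF sub _ P_sub] by simp
qed

lemma HN_sub: "HN J \<subseteq> \<A>"
  using filt_sub unfolding HN_def by blast

lemma HN_Ob: "E \<in> HN J \<Longrightarrow> E \<in> Ob D"
  using HN_sub tsub_Ob[OF sub] by blast

lemma HN_iso_closed: "iso_closed (HN J)"
  unfolding iso_closed_def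
proof (intro conjI ballI allI impI)
  show "HN J \<subseteq> Ob D" using HN_Ob by blast
  fix E E' assume E: "E \<in> HN J" "isomorphic D E E'"
  then obtain L where L: "sorted_wrt (<) L" "set L \<subseteq> J" "E \<in> filt L" unfolding HN_def by blast
  show "E' \<in> HN J" by (rule HNI[OF L(1,2) iso_closedD[OF filt_iso_closed L(3) E(2)]])
qed

lemma HN_mono: "J \<subseteq> J' \<Longrightarrow> HN J \<subseteq> HN J'"
  unfolding HN_def by blast

lemma HN_zero: "zeros \<subseteq> HN J"
  using HNI[of "[]" J] by auto

lemma P_HN: "p \<in> J \<Longrightarrow> P p \<subseteq> HN J"
  using HNI[of "[p]" J] star_zero_left[OF P_iso_closed] by auto

lemma filt_append: "filt (L1 @ L2) = star (filt L2) (filt L1)"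
proof (induction L1)
  case Nil
  then show ?case using star_zero_right[OF filt_iso_closed] by simp
next
  case (Cons p L1)
  then show ?case by (simp add: star_assoc)
qed

lemma filt_shift: "filt (map (\<lambda>x. x + s) L) = shifts (filt L)"
proof (induction L)
  case Nil
  then show ?case by (simp add: shifts_zeros)
next
  case (Cons p L)
  have "filt L \<subseteq> Ob D" "P p \<subseteq> Ob D" using filt_iso_closed P_iso_closed unfolding iso_closed_def
    by blast+
  then show ?case using Cons by (simp add: P_shift shifts_star)
qed

lemma HN_shift_iff: assumes "E \<in> Ob D" shows "sh E \<in> HN J \<longleftrightarrow> E \<in> HN ((\<lambda>x. x - s) ` J)"
proof
  assume "sh E \<in> HN J"
  then obtain L where L: "sorted_wrt (<) L" "set L \<subseteq> J" "sh E \<in> filt L" unfolding HN_def by blast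
  define M where "M = map (\<lambda>x. x - s) L"
  have "map (\<lambda>x. x + s) M = L" unfolding M_def by (simp add: o_def)
  then have "E \<in> filt M" using L filt_shift[of M] mem_shifts[OF filt_iso_closed assms] by simp
  moreover have "sorted_wrt (<) M" using L unfolding M_def by (simp add: sorted_wrt_map)
  ultimately show "E \<in> HN ((\<lambda>x. x - s) ` J)" using HNI[of M] L M_def
    by (metis image_mono list.set_map)
next
  assume "E \<in> HN ((\<lambda>x. x - s) ` J)"
  then obtain L where L: "sorted_wrt (<) L" "set L \<subseteq> (\<lambda>x. x - s) ` J" "E \<in> filt L" unfolding HN_def
    by blast
  have "sh E \<in> filt (map (\<lambda>x. x + s) L)" using L filt_shift[of L] mem_shifts[OF filt_iso_closed
    assms] by simp
  moreover have "sorted_wrt (<) (map (\<lambda>x. x + s) L)" using L by (simp add: sorted_wrt_map)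
  moreover have "set (map (\<lambda>x. x + s) L) \<subseteq> J" using L by auto
  ultimately show "sh E \<in> HN J" using HNI by blast
qed

lemma HN_induct [consumes 1, case_names zero step]:
  assumes "E \<in> HN J"
    and "\<And>E. zero_object D E \<Longrightarrow> Q E"
    and "\<And>E X Y p. \<lbrakk>E \<in> star {X} {Y}; X \<in> HN J; Y \<in> P p; p \<in> J; Q X\<rbrakk> \<Longrightarrow> Q E"
  shows "Q E"
proof -
  obtain L where L: "sorted_wrt (<) L" "set L \<subseteq> J" "E \<in> filt L" using assms(1) by (rule HNE)
  then show ?thesis
  proof (induction L arbitrary: E)
    case Nil
    then show ?case using assms(2) by (simp add: zeros_def)
  next
    case (Cons p L)
    then obtain X Y where XY: "X \<in> filt L" "Y \<in> P p" "E \<in> star {X} {Y}" by (auto elim: star_singE)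
    have "X \<in> HN J" using Cons.prems XY(1) by (intro HNI[of L]) auto
    then show ?case using assms(3)[OF XY(3)] XY Cons by simp
  qed
qed

text \<open>Upward closed sets are the cuts of the index group; open, closed and degenerate cuts are
  covered at once.\<close>

definition upset :: "'i set \<Rightarrow> bool" where "upset U \<longleftrightarrow> (\<forall>x\<in>U. \<forall>y. x \<le> y \<longrightarrow> y \<in> U)"

lemma upset_filter:
  assumes "upset U" "sorted_wrt (<) L" shows "L = filter (\<lambda>x. x \<notin> U) L @ filter (\<lambda>x. x \<in> U) L"
  using assms(2)
proof (induction L)
  case (Cons p L)
  show ?case
  proof (cases "p \<in> U")
    case True
    then have "\<forall>x\<in>set L. x \<in> U" using Cons assms(1) unfolding upset_def by (auto intro: less_imp_le)
    then show ?thesis using True by simp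
  qed (use Cons in auto)
qed simp

text \<open>The truncation triangle. An increasing list starts with its entries outside
  \<open>U\<close>, and associativity of \<open>star\<close> collects the factors on either
  side.\<close>

lemma HN_cut: assumes "upset U" "E \<in> HN J"
  obtains E1 E2 where "E1 \<in> HN (J \<inter> U)" "E2 \<in> HN (J - U)" "E \<in> star {E1} {E2}"
proof -
  obtain L where L: "sorted_wrt (<) L" "set L \<subseteq> J" "E \<in> filt L" using assms unfolding HN_def
    by blast
  let ?A = "filter (\<lambda>x. x \<in> U) L" and ?B = "filter (\<lambda>x. x \<notin> U) L"
  have "E \<in> star (filt ?A) (filt ?B)" using L upset_filter[OF assms(1) L(1)] filt_append by metis
  then obtain E1 E2 where "E1 \<in> filt ?A" "E2 \<in> filt ?B" "E \<in> star {E1} {E2}" by (rule star_singE)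
  moreover have "E1 \<in> HN (J \<inter> U)" using L calculation
    by (intro HNI[of ?A]) (auto simp: sorted_wrt_filter)
  moreover have "E2 \<in> HN (J - U)" using L calculation
    by (intro HNI[of ?B]) (auto simp: sorted_wrt_filter)
  ultimately show thesis using that by blast
qed

lemma HN_merge: assumes "E \<in> star {E1} {E2}" "E1 \<in> HN J1" "E2 \<in> HN J2" "\<And>x y. \<lbrakk>x \<in> J1; y \<in> J2\<rbrakk> \<Longrightarrow> y <
  x"
  shows "E \<in> HN (J1 \<union> J2)"
proof -
  obtain L1 where L1: "sorted_wrt (<) L1" "set L1 \<subseteq> J1" "E1 \<in> filt L1" using assms unfolding HN_def
    by blast
  obtain L2 where L2: "sorted_wrt (<) L2" "set L2 \<subseteq> J2" "E2 \<in> filt L2" using assms unfolding HN_def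
    by blast
  have "E \<in> filt (L2 @ L1)" unfolding filt_append using L1 L2 assms(1) by (blast intro: star_singI)
  then show ?thesis using L1 L2 assms(4) by (intro HNI[of "L2 @ L1"]) (auto simp: sorted_wrt_append)
qed

lemma Orth_HN_left: assumes "\<And>p. p \<in> J \<Longrightarrow> Orth (P p) S" shows "Orth (HN J) S"
  unfolding Orth_def
proof (intro ballI)
  fix E Y assume Y: "Y \<in> S" and "E \<in> HN J"
  from this(2) show "orth E Y"
  proof (induction rule: HN_induct)
    case (step E X W p)
    then show ?case using orth_star_left[OF step(1,5)] assms Y unfolding Orth_def by blast
  qed (rule orth_zero(2))
qed

lemma Orth_HN_right: assumes "\<And>p. p \<in> J \<Longrightarrow> Orth S (P p)" shows "Orth S (HN J)"
  unfolding Orth_def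
proof (intro ballI)
  fix Y E assume Y: "Y \<in> S" and "E \<in> HN J"
  from this(2) show "orth Y E"
  proof (induction rule: HN_induct)
    case (step E X W p)
    then show ?case using orth_star_right[OF step(1,5)] assms Y unfolding Orth_def by blast
  qed (rule orth_zero(1))
qed

lemma Orth_HN: "(\<And>x y. \<lbrakk>x \<in> J1; y \<in> J2\<rbrakk> \<Longrightarrow> y < x) \<Longrightarrow> Orth (HN J1) (HN J2)"
  by (intro Orth_HN_left Orth_HN_right P_orth)

lemma orth_HN: "\<lbrakk>X \<in> HN J1; Y \<in> HN J2; \<And>x y. \<lbrakk>x \<in> J1; y \<in> J2\<rbrakk> \<Longrightarrow> y < x\<rbrakk> \<Longrightarrow> orth X Y"
  using Orth_HN unfolding Orth_def by blast

lemma upset_less: "\<lbrakk>upset U; x \<in> U; y \<notin> U\<rbrakk> \<Longrightarrow> y < x"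
  unfolding upset_def by (meson not_le)

lemma orth_upset: assumes "upset U" "X \<in> HN J1" "Y \<in> HN J2" "J1 \<subseteq> U" "J2 \<subseteq> - U" shows "orth X Y"
  by (rule orth_HN[OF assms(2,3)]) (use assms upset_less in blast)

lemma HN_sh_up: assumes "upset U" "E \<in> HN U" shows "sh E \<in> HN U"
proof -
  have o: "E \<in> Ob D" using assms HN_Ob by blast
  have "E \<in> HN ((\<lambda>x. x - s) ` ((\<lambda>x. x + s) ` U))" using assms by (simp add: image_image)
  then have "sh E \<in> HN ((\<lambda>x. x + s) ` U)" by (rule iffD2[OF HN_shift_iff[OF o]])
  moreover have "x + s \<in> U" if "x \<in> U" for x
    using assms(1) s_pos that unfolding upset_def by (meson less_add_same_cancel1 less_imp_le)
  ultimately show ?thesis using HN_mono by (metis image_subsetI subsetD)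
qed

text \<open>The two halves of a cut are orthogonals of each other: if \<open>E\<close> has no arrows
  to its lower truncation \<open>E2\<close>, then \<open>E2\<close> vanishes by
  \<open>star_zero_end\<close>. As orthogonality passes to extensions, so do both halves.\<close>

lemma upset_HN: assumes "upset U" "E \<in> HN UNIV"
  shows HN_up_iff: "E \<in> HN U \<longleftrightarrow> (\<forall>X\<in>HN (- U). orth E X)"
    and HN_dn_iff: "E \<in> HN (- U) \<longleftrightarrow> (\<forall>X\<in>HN U. orth X E)"
proof -
  obtain E1 E2 where E: "E1 \<in> HN U" "E2 \<in> HN (- U)" "E \<in> star {E1} {E2}"
    using HN_cut[OF assms] by (auto simp: Compl_eq_Diff_UNIV)
  have "sh E1 \<in> HN U" by (rule HN_sh_up[OF assms(1) E(1)])
  then have sh1: "orth (sh E1) E2" by (intro orth_upset[OF assms(1) _ E(2)]) auto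
  show "E \<in> HN U \<longleftrightarrow> (\<forall>X\<in>HN (- U). orth E X)"
  proof
    assume "E \<in> HN U" then show "\<forall>X\<in>HN (- U). orth E X" using orth_upset[OF assms(1)] by blast
  next
    assume "\<forall>X\<in>HN (- U). orth E X"
    then have "zero_object D E2" using star_zero_end(2)[OF E(3) sh1] E by blast
    then show "E \<in> HN U" using star_sing_zero_right[OF E(3)] E iso_closedD[OF HN_iso_closed]
      by blast
  qed
  show "E \<in> HN (- U) \<longleftrightarrow> (\<forall>X\<in>HN U. orth X E)"
  proof
    assume "E \<in> HN (- U)" then show "\<forall>X\<in>HN U. orth X E" using orth_upset[OF assms(1)] by blast
  next
    assume "\<forall>X\<in>HN U. orth X E"
    then have "zero_object D E1" using star_zero_end(1)[OF E(3) sh1] E by blast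
    then show "E \<in> HN (- U)" using star_sing_zero_left[OF E(3)] E iso_closedD[OF HN_iso_closed]
      isomorphic_sym by blast
  qed
qed

text \<open>The two memberships may come from different filtrations. Instead of comparing these, the
  first is truncated at \<open>V\<close>; the upper part has only the zero arrow to \<open>E\<close>
  and hence vanishes.\<close>

lemma HN_inter: assumes "upset U" "upset V" "E \<in> HN U" "E \<in> HN (- V)" shows "E \<in> HN (U - V)"
proof -
  obtain E1 E2 where E: "E1 \<in> HN (U \<inter> V)" "E2 \<in> HN (U - V)" "E \<in> star {E1} {E2}"
    using HN_cut[OF assms(2,3)] .
  have "sh E1 \<in> HN V" by (rule HN_sh_up[OF assms(2)]) (use E(1) HN_mono[of "U \<inter> V" V] in blast)
  then have sh1: "orth (sh E1) E2" by (intro orth_upset[OF assms(2) _ E(2)]) auto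
  have "orth E1 E" by (intro orth_upset[OF assms(2) E(1) assms(4)]) auto
  then have "zero_object D E1" using star_zero_end(1)[OF E(3) sh1] by blast
  then show ?thesis using star_sing_zero_left[OF E(3)] E iso_closedD[OF HN_iso_closed]
    isomorphic_sym by blast
qed

end

locale hn_slicing = sliced_subcategory D \<A> P s
  for D :: "('o, 'm) tricat" (structure) and \<A> and P :: "'i::linordered_ab_group_add \<Rightarrow> 'o set"
    and s +
  assumes HN_all: "\<A> \<subseteq> HN UNIV"
begin

lemma HN_UNIV: "HN UNIV = \<A>"
  using HN_all HN_sub by blast

lemma HN_up_ext: assumes "upset U" "E \<in> star {X} {Y}" "X \<in> HN U" "Y \<in> HN U" shows "E \<in> HN U"
proof -
  have "E \<in> \<A>" using tsub_ext[OF sub assms(2)] assms HN_sub by blast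
  then show ?thesis using HN_up_iff[OF assms(1)] orth_star_left[OF assms(2)] assms HN_sub HN_UNIV
    by blast
qed

lemma HN_dn_ext: assumes "upset U" "E \<in> star {X} {Y}" "X \<in> HN (- U)" "Y \<in> HN (- U)"
  shows "E \<in> HN (- U)"
proof -
  have "E \<in> \<A>" using tsub_ext[OF sub assms(2)] assms HN_sub by blast
  then show ?thesis using HN_dn_iff[OF assms(1)] orth_star_right[OF assms(2)] assms HN_sub HN_UNIV
    by blast
qed

text \<open>A convex \<open>J\<close> is the difference of two cuts, one at its lower and one at its
  upper end; this way bounded and unbounded, open and closed ends are treated alike.\<close>

definition at_or_above :: "'i set \<Rightarrow> 'i set" where "at_or_above J = {x. \<exists>j\<in>J. j \<le> x}"
definition above :: "'i set \<Rightarrow> 'i set" where "above J = {x. \<forall>j\<in>J. j < x}"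

definition order_convex :: "'i set \<Rightarrow> bool" where
  "order_convex J \<longleftrightarrow> J \<noteq> {} \<and> (\<forall>x\<in>J. \<forall>z\<in>J. \<forall>y. x \<le> y \<and> y \<le> z \<longrightarrow> y \<in> J)"

lemma upset_above: "upset (above J)" "upset (at_or_above J)"
  unfolding upset_def above_def at_or_above_def by (auto intro: order.trans less_le_trans)

lemma order_convex_decomp: assumes "order_convex J" shows "at_or_above J - above J = J"
proof
  show "at_or_above J - above J \<subseteq> J"
    using assms unfolding order_convex_def above_def at_or_above_def by (auto simp: not_less)
  show "J \<subseteq> at_or_above J - above J"
    unfolding above_def at_or_above_def by auto
qed

lemma above_sub: assumes "order_convex J" shows "above J \<subseteq> at_or_above J"
proof
  fix x assume x: "x \<in> above J"
  obtain j where j: "j \<in> J" using assms unfolding order_convex_def by auto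
  then have "j \<le> x" using x unfolding above_def by (simp add: less_imp_le)
  then show "x \<in> at_or_above J" using j unfolding at_or_above_def by blast
qed

lemma HN_order_convex: assumes "order_convex J"
  shows "E \<in> HN J \<longleftrightarrow> E \<in> HN (at_or_above J) \<and> E \<in> HN (- above J)"
proof
  assume "E \<in> HN J"
  moreover have "J \<subseteq> at_or_above J" "J \<subseteq> - above J" using order_convex_decomp[OF assms] by blast+
  ultimately show "E \<in> HN (at_or_above J) \<and> E \<in> HN (- above J)" using HN_mono by blast
next
  assume "E \<in> HN (at_or_above J) \<and> E \<in> HN (- above J)"
  then show "E \<in> HN J" using HN_inter[OF upset_above(2,1)] order_convex_decomp[OF assms] by metis
qed

lemma HN_ext: assumes "order_convex J" "E \<in> star {X} {Y}" "X \<in> HN J" "Y \<in> HN J" shows "E \<in> HN J"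
  using HN_order_convex[OF assms(1)] HN_up_ext[OF upset_above(2) assms(2)] HN_dn_ext[OF
    upset_above(1) assms(2)] assms(3,4) by blast

lemma ext_closure_HN: assumes "order_convex J" "\<And>E. E \<in> S \<Longrightarrow> E \<in> HN J" "\<Union> (P ` J) \<subseteq> S"
  shows "extension_closure D S = HN J"
proof
  show "extension_closure D S \<subseteq> HN J"
  proof
    fix E assume "E \<in> extension_closure D S"
    then show "E \<in> HN J"
    proof induction
      case (extension X Z Y f g h)
      then show ?case using HN_ext[OF assms(1) starI[OF extension(3)]] by blast
    qed (rule assms(2))
  qed
  show "HN J \<subseteq> extension_closure D S"
  proof
    fix E assume "E \<in> HN J"
    then show "E \<in> extension_closure D S"
    proof (induction rule: HN_induct)
      case (zero E)
      obtain j where j: "j \<in> J" using assms(1) unfolding order_convex_def by auto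
      show ?case
        by (rule extension_closure.base) (use P_zero[of j] j assms(3) zero in
          \<open>auto simp: zeros_def\<close>)
    next
      case (step E X Y p)
      obtain f g h where t: "T X E Y f g h" using step(1) by (auto elim: starE)
      have "Y \<in> extension_closure D S"
        by (rule extension_closure.base) (use step(3,4) assms(3) in blast)
      then show ?case by (rule extension_closure.extension[OF step(5) _ t])
    qed
  qed
qed

lemma slice_interval_HN: "order_convex J \<Longrightarrow> extension_closure D (\<Union>p\<in>J. P p) = HN J"
  using P_HN by (intro ext_closure_HN) auto

text \<open>The kernel is found by cutting the fibre of the morphism at the lower end of \<open>J\<close>.\<close>

lemma kernel:
  assumes J: "order_convex J" and short: "\<And>x y. \<lbrakk>x \<in> J; y \<in> J\<rbrakk> \<Longrightarrow> y < x + s"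
    and E: "E \<in> HN J" and F: "F \<in> HN J" and f: "arr f E F"
  obtains V K V2 C i d p a b k k' u v v' where "T V E F i f d" "T K V V2 a b p" "T K E C (i \<cdot> a) k
    k'"
    "T V2 C F u v v'" "v \<cdot> k = f" "K \<in> HN J" "C \<in> HN J" "V2 \<in> HN (- at_or_above J)"
proof -
  obtain V i d where V: "T V E F i f d" using T_fibre f by blast
  have stV: "E \<in> star {V} {F}" using starI[OF V] by simp
  have o: "E \<in> Ob D" "F \<in> Ob D" "V \<in> Ob D" using T_Ob[OF V] by auto
  have dn: "HN (- at_or_above J) \<subseteq> HN (- above J)"
    using above_sub[OF J] by (intro HN_mono) simp
  \<comment> \<open>As \<open>J\<close> is shorter than \<open>s\<close>, whatever does not exceed
    \<open>J\<close> falls below \<open>J\<close> when it is moved down by \<open>s\<close>.\<close>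
  have ud: "(\<lambda>x. x - s) ` (- above J) \<subseteq> - at_or_above J"
  proof
    fix y assume "y \<in> (\<lambda>x. x - s) ` (- above J)"
    then obtain x where x: "y = x - s" "x \<notin> above J" by auto
    then obtain j where j: "j \<in> J" "x \<le> j" unfolding above_def by (auto simp: not_less)
    { fix j' assume "j' \<in> J" "j' \<le> y"
      then have "j' + s \<le> j" using x(1) j(2) by (meson le_diff_eq order.trans)
      then have False using short[OF \<open>j' \<in> J\<close> j(1)] by simp }
    then show "y \<in> - at_or_above J" unfolding at_or_above_def by auto
  qed
  have uns: "X \<in> HN (- at_or_above J)" if "X \<in> Ob D" "sh X \<in> HN (- above J)" for X
    using HN_shift_iff[OF that(1)] that(2) HN_mono[OF ud] by blast
  obtain F' where F': "F' \<in> Ob D" "isomorphic D (sh F') F" using unsh_ex o by blast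
  have "F' \<in> HN (- at_or_above J)" using uns[OF F'(1)] F F' iso_closedD[OF HN_iso_closed]
    isomorphic_sym HN_order_convex[OF J] by blast
  then have F'2: "F' \<in> HN (- above J)" using dn by blast
  \<comment> \<open>The fibre is an extension of \<open>E\<close> by \<open>F[-1]\<close>, so it
    does not reach above \<open>J\<close>; only its part below \<open>J\<close> has to be cut
    off.\<close>
  have "V \<in> star {F'} {E}" using star_fibre[OF stV F'(2,1)] .
  then have Vdn: "V \<in> HN (- above J)" using HN_dn_ext[OF upset_above(1)] F'2 E HN_order_convex[OF J]
    by blast
  obtain K V2 where K: "K \<in> HN (at_or_above J)" "V2 \<in> HN (- at_or_above J)" "V \<in> star {K} {V2}"
    using HN_cut[OF upset_above(2), of V UNIV J] Vdn HN_mono[of "- above J" UNIV]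
      by (auto simp: Compl_eq_Diff_UNIV)
  obtain a b p where KV: "T K V V2 a b p" using K by (auto elim: starE)
  obtain C k k' u v v' where C: "T K E C (i \<cdot> a) k k'" "T V2 C F u v v'" "v \<cdot> k = f"
    using octahedron[OF KV V] by blast
  have Ko: "K \<in> Ob D" "V2 \<in> Ob D" using T_Ob[OF KV] by auto
  obtain W where W: "W \<in> Ob D" "isomorphic D (sh W) V2" using unsh_ex Ko by blast
  have "W \<in> HN (- at_or_above J)"
    using uns[OF W(1)] K W iso_closedD[OF HN_iso_closed] isomorphic_sym dn by blast
  then have W2: "W \<in> HN (- above J)" using dn by blast
  have "K \<in> star {W} {V}" using star_fibre[OF K(3) W(2,1)] .
  then have "K \<in> HN (- above J)" using HN_dn_ext[OF upset_above(1)] W2 Vdn by blast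
  then have KJ: "K \<in> HN J" using K HN_order_convex[OF J] by blast
  \<comment> \<open>\<open>C\<close>, the coimage of \<open>f\<close>, is bounded below as an
    extension of \<open>K[1]\<close> by \<open>E\<close> and above as an extension of
    \<open>F\<close> by \<open>V2\<close>.\<close>
  have "sh K \<in> HN (at_or_above J)" by (rule HN_sh_up[OF upset_above(2) K(1)])
  moreover have "C \<in> star {E} {sh K}" using star_rot(1) starI[OF C(1)] by blast
  ultimately have 1: "C \<in> HN (at_or_above J)"
    using HN_up_ext[OF upset_above(2)] E HN_order_convex[OF J] by blast
  have "C \<in> star {V2} {F}" using starI[OF C(2)] by blast
  then have 2: "C \<in> HN (- above J)" using HN_dn_ext[OF upset_above(1)] K dn F HN_order_convex[OF J]
    by blast
  have "C \<in> HN J" using 1 2 HN_order_convex[OF J] by blast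
  then show thesis using that V KV C KJ K by blast
qed

end

context sliced_subcategory
begin

lemma shifts_HN: "shifts (HN J) = HN ((\<lambda>x. x + s) ` J)"
proof -
  have e: "(\<lambda>x. x - s) ` (\<lambda>x. x + s) ` J = J" by (simp add: image_image)
  show ?thesis
  proof (intro equalityI subsetI)
    fix E assume "E \<in> shifts (HN J)"
    then obtain F where F: "F \<in> HN J" "isomorphic D (sh F) E" unfolding shifts_def by blast
    then have "sh F \<in> HN ((\<lambda>x. x + s) ` J)"
      using HN_shift_iff[OF HN_Ob[OF F(1)], of "(\<lambda>x. x + s) ` J"] e by simp
    then show "E \<in> HN ((\<lambda>x. x + s) ` J)" using iso_closedD[OF HN_iso_closed _ F(2)] by simp
  next
    fix E assume E: "E \<in> HN ((\<lambda>x. x + s) ` J)"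
    then obtain F where F: "F \<in> Ob D" "isomorphic D (sh F) E" using unsh_ex HN_Ob by blast
    have "sh F \<in> HN ((\<lambda>x. x + s) ` J)" using iso_closedD[OF HN_iso_closed E isomorphic_sym[OF F(2)]]
      .
    then have "F \<in> HN J" using HN_shift_iff[OF F(1), of "(\<lambda>x. x + s) ` J"] e by simp
    then show "E \<in> shifts (HN J)" using F(2) unfolding shifts_def by blast
  qed
qed

lemma HN_empty: "HN {} = zeros"
  unfolding HN_def by auto

lemma HN_sing: "HN {p} = P p"
proof
  show "HN {p} \<subseteq> P p"
  proof
    fix E assume "E \<in> HN {p}"
    then obtain L where L: "sorted_wrt (<) L" "set L \<subseteq> {p}" "E \<in> filt L" by (rule HNE)
    then have "L = [] \<or> L = [p]" by (cases L rule: remdups_adj.cases) auto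
    then show "E \<in> P p" using L P_zero[of p] star_zero_left[OF P_iso_closed] by auto
  qed
qed (rule P_HN, simp)

lemma HN_finite: assumes "E \<in> HN J" obtains F where "finite F" "F \<subseteq> J" "E \<in> HN F"
proof -
  obtain L where L: "sorted_wrt (<) L" "set L \<subseteq> J" "E \<in> filt L" using assms by (rule HNE)
  then show thesis using that[of "set L"] HNI[of L "set L"] by simp
qed

lemma upset_greaterThan: "upset {c<..}"
  unfolding upset_def by (auto intro: less_le_trans)

end

section \<open>Phases\<close>

text \<open>Rays are indexed by real numbers, although they depend on \<phi> only modulo 2, to match
  the phases of a slicing.\<close>

definition ray :: "real \<Rightarrow> complex set" where
  "ray \<phi> = {of_real r * cis (pi * \<phi>) | r. r > 0}"

text \<open>An additive comparison of phases: its sign tells whether the phase of \<open>z\<close>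
  lies above or below \<phi>, as long as the two differ by less than 1.\<close>

definition im_rot :: "real \<Rightarrow> complex \<Rightarrow> real" where
  "im_rot \<phi> z = Im (z * cis (- (pi * \<phi>)))"

text \<open>The signed length of the projection to the ray of phase \<phi>, an additive substitute
  for the modulus.\<close>

definition re_rot :: "real \<Rightarrow> complex \<Rightarrow> real" where
  "re_rot \<phi> z = Re (z * cis (- (pi * \<phi>)))"

lemma im_rot_add: "im_rot \<phi> (z + w) = im_rot \<phi> z + im_rot \<phi> w"
  and re_rot_add: "re_rot \<phi> (z + w) = re_rot \<phi> z + re_rot \<phi> w"
  unfolding im_rot_def re_rot_def by (auto simp: algebra_simps)

lemma im_rot_zero [simp]: "im_rot \<phi> 0 = 0" "re_rot \<phi> 0 = 0"
  unfolding im_rot_def re_rot_def by auto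

lemma cis_shift: "cis (pi * (\<phi> + 1)) = - cis (pi * \<phi>)"
  by (simp add: distrib_left flip: cis_mult)

lemma cis_shift_neg: "cis (- (pi * (\<phi> + 1))) = - cis (- (pi * \<phi>))"
proof -
  have "cis (- (pi * \<phi>)) = cis (pi * (- \<phi> - 1 + 1))" by simp
  also have "\<dots> = - cis (pi * (- \<phi> - 1))" by (rule cis_shift)
  also have "pi * (- \<phi> - 1) = - (pi * (\<phi> + 1))" by (simp add: algebra_simps)
  finally show ?thesis by simp
qed

lemma im_rot_shift: "im_rot (\<phi> + 1) (- z) = im_rot \<phi> z"
  unfolding im_rot_def cis_shift_neg by simp

lemma ray_shift: "- z \<in> ray (\<phi> + 1) \<longleftrightarrow> z \<in> ray \<phi>"
  unfolding ray_def cis_shift by auto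

lemma ray_rot: "\<lbrakk>z = of_real r * cis (pi * \<phi>)\<rbrakk> \<Longrightarrow> z * cis (- (pi * \<psi>)) = of_real r * cis (pi * (\<phi> -
  \<psi>))"
  by (simp add: mult.assoc cis_mult algebra_simps)

lemma im_rot_ray: assumes "z \<in> ray \<phi>"
  shows im_rot_ray_pos: "\<lbrakk>\<psi> < \<phi>; \<phi> < \<psi> + 1\<rbrakk> \<Longrightarrow> 0 < im_rot \<psi> z"
    and im_rot_ray_neg: "\<lbrakk>\<phi> < \<psi>; \<psi> < \<phi> + 1\<rbrakk> \<Longrightarrow> im_rot \<psi> z < 0"
    and im_rot_ray_eq: "im_rot \<phi> z = 0"
proof -
  obtain r where r: "r > 0" "z = of_real r * cis (pi * \<phi>)" using assms unfolding ray_def by blast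
  have t: "im_rot \<psi> z = r * sin (pi * (\<phi> - \<psi>))" for \<psi> unfolding im_rot_def ray_rot[OF r(2)] by simp
  show "im_rot \<phi> z = 0" using t by simp
  show "0 < im_rot \<psi> z" if "\<psi> < \<phi>" "\<phi> < \<psi> + 1"
  proof -
    have "0 < sin (pi * (\<phi> - \<psi>))" using that by (intro sin_gt_zero) auto
    then show ?thesis using t r by simp
  qed
  show "im_rot \<psi> z < 0" if "\<phi> < \<psi>" "\<psi> < \<phi> + 1"
  proof -
    have "0 < sin (pi * (\<psi> - \<phi>))" using that by (intro sin_gt_zero) auto
    moreover have "sin (pi * (\<phi> - \<psi>)) = - sin (pi * (\<psi> - \<phi>))"
      by (metis minus_diff_eq mult_minus_right sin_minus)
    ultimately show ?thesis using t r by simp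
  qed
qed

lemma re_rot_le: "re_rot \<phi> z \<le> cmod z"
  unfolding re_rot_def using complex_Re_le_cmod[of "z * cis (- (pi * \<phi>))"] by (simp add: norm_mult)

text \<open>At an angle of at most \<open>pi * w\<close>, less than a right angle, from the axis the
  projection controls the modulus. The bounds on sectors and windows rest on this estimate.\<close>

lemma re_rot_ray: assumes "z \<in> ray \<phi>" "\<bar>\<phi> - \<psi>\<bar> \<le> w" "w < 1/2"
  shows "cos (pi * w) * cmod z \<le> re_rot \<psi> z"
proof -
  obtain r where r: "r > 0" "z = of_real r * cis (pi * \<phi>)" using assms unfolding ray_def by blast
  have "re_rot \<psi> z = r * cos (pi * (\<phi> - \<psi>))" unfolding re_rot_def ray_rot[OF r(2)] by simp
  also have "cos (pi * (\<phi> - \<psi>)) = cos (pi * \<bar>\<phi> - \<psi>\<bar>)"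
    using cos_abs_real[of "pi * (\<phi> - \<psi>)"] by (simp add: abs_mult)
  finally have e: "re_rot \<psi> z = r * cos (pi * \<bar>\<phi> - \<psi>\<bar>)" .
  have "cos (pi * w) \<le> cos (pi * \<bar>\<phi> - \<psi>\<bar>)" using assms by (intro cos_monotone_0_pi_le) auto
  moreover have "cmod z = r" using r by (simp add: norm_mult)
  ultimately show ?thesis using e r by (simp add: mult.commute)
qed

lemma cos_pos_half: "\<lbrakk>0 \<le> w; w < 1/2\<rbrakk> \<Longrightarrow> 0 < cos (pi * w)"
  by (intro cos_gt_zero_pi) (auto intro: less_le_trans[of _ 0])

lemma ray_nonzero: "z \<in> ray \<phi> \<Longrightarrow> z \<noteq> 0"
  unfolding ray_def by auto

text \<open>After rotating \<open>z\<close> to the positive real axis, the phase of the sum is read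
  off from \<open>Arg\<close>, and its upper bound follows from the sign of
  \<open>im_rot \<psi>\<close>.\<close>

lemma ray_sum:
  assumes "z \<in> ray \<phi>" "w \<in> ray \<psi>" "\<phi> \<le> \<psi>" "\<psi> < \<phi> + 1"
  shows "\<exists>\<chi>. \<phi> \<le> \<chi> \<and> \<chi> \<le> \<psi> \<and> z + w \<in> ray \<chi>"
proof (cases "\<phi> = \<psi>")
  case True
  obtain r s where rs: "r > 0" "z = of_real r * cis (pi * \<phi>)" "s > 0" "w = of_real s * cis (pi * \<psi>)"
    using assms unfolding ray_def by blast
  have "z + w = of_real (r + s) * cis (pi * \<phi>)" "r + s > 0" using rs True
    by (auto simp: algebra_simps)
  then show ?thesis using True unfolding ray_def by blast
next
  case False
  then have lt: "\<phi> < \<psi>" using assms by simp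
  define u where "u = (z + w) * cis (- (pi * \<phi>))"
  have uz: "z + w = u * cis (pi * \<phi>)" unfolding u_def by (simp add: mult.assoc cis_mult)
  have im: "Im u = im_rot \<phi> z + im_rot \<phi> w" unfolding u_def im_rot_def by (simp add: algebra_simps)
  then have im0: "Im u > 0" using im_rot_ray_eq[OF assms(1)] im_rot_ray_pos[OF assms(2) lt assms(4)]
    by simp
  define \<theta> where "\<theta> = Arg u"
  have u0: "cmod u > 0" using im0 by auto
  have up: "u = of_real (cmod u) * cis \<theta>" using rcis_cmod_Arg[of u] unfolding \<theta>_def rcis_def by simp
  have th: "- pi < \<theta>" "\<theta> \<le> pi" using Arg_bounded unfolding \<theta>_def by auto
  have "Im u = cmod u * sin \<theta>" using arg_cong[OF up, of Im] by simp
  then have "sin \<theta> > 0" using im0 u0 by (metis zero_less_mult_pos)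
  then have t0: "\<theta> > 0" using th sin_lt_zero[of "- \<theta>"] sin_ge_zero[of "- \<theta>"]
    by (metis less_eq_real_def neg_0_le_iff_le neg_le_iff_le linorder_not_less minus_less_iff
      sin_minus neg_less_0_iff_less add.inverse_neutral)
  have "im_rot \<psi> (z + w) < 0" using im_rot_add im_rot_ray_neg[OF assms(1) lt assms(4)]
    im_rot_ray_eq[OF assms(2)] by simp
  moreover have zw: "z + w = of_real (cmod u) * cis (pi * (\<phi> + \<theta> / pi))"
    unfolding uz by (subst up) (simp add: mult.assoc cis_mult algebra_simps)
  have ry: "z + w \<in> ray (\<phi> + \<theta> / pi)" unfolding ray_def using zw u0 by blast
  \<comment> \<open>Otherwise the phase of the sum lies strictly between \<psi> and \<psi> + 1,
    where \<open>im_rot \<psi>\<close> is positive.\<close>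
  have "\<phi> + \<theta> / pi \<le> \<psi>"
  proof (rule ccontr)
    assume "\<not> \<phi> + \<theta> / pi \<le> \<psi>"
    then have a: "\<psi> < \<phi> + \<theta> / pi" by simp
    have "\<theta> / pi \<le> 1" using th by simp
    then have "\<phi> + \<theta> / pi < \<psi> + 1" using lt by linarith
    then show False using im_rot_ray_pos[OF ry a] calculation by simp
  qed
  then show ?thesis using ry t0 by (intro exI[of _ "\<phi> + \<theta> / pi"]) auto
qed

section \<open>Cutting a triangulated category into sectors\<close>

text \<open>The cut points used below are \<open>x (2 m) = m\<close> and \<open>x (2 m + 1) = m + \<alpha>\<close>.\<close>

locale cuts =
  fixes x :: "int \<Rightarrow> real"
  assumes x_less: "x k < x (k + 1)" and x_per: "x (k + 2) = x k + 1"
begin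

lemma x_mono: "i < j \<Longrightarrow> x i < x j"
proof (induction j rule: int_gr_induct)
  case base
  then show ?case by (rule x_less)
next
  case (step j)
  then show ?case using x_less[of j] by simp
qed

lemma x_mono_le: "i \<le> j \<Longrightarrow> x i \<le> x j"
  using x_mono by (cases "i = j") (auto simp: less_imp_le)

text \<open>Two positive gaps make up a period of length 1.\<close>

lemma x_width: "x (k + 1) < x k + 1"
  using x_less[of "k + 1"] x_per[of k] by (simp add: add.assoc)

lemma x_int: "x (k + 2 * m) = x k + of_int m"
proof (induction m rule: int_induct[of _ 0])
  case (step1 i)
  then show ?case using x_per[of "k + 2 * i"] by (simp add: algebra_simps)
next
  case (step2 i)
  then show ?case using x_per[of "k + 2 * (i - 1)"] by (simp add: algebra_simps)
qed simp

lemma x_cover: obtains k where "x k < c" "c \<le> x (k + 1)"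
proof -
  define m where "m = \<lceil>c - x 0\<rceil> - 1"
  have a: "x (2 * m) = x 0 + of_int m" using x_int[of 0 m] by simp
  then have b: "x (2 * m + 2) = x 0 + of_int m + 1" using x_per[of "2 * m"] by simp
  have "of_int m < c - x 0" "c - x 0 \<le> of_int m + 1" unfolding m_def by linarith+
  then have "x (2 * m) < c" "c \<le> x (2 * m + 2)" using a b by linarith+
  then show thesis using that[of "2 * m"] that[of "2 * m + 1"]
    by (cases "c \<le> x (2 * m + 1)") (auto simp: add.assoc)
qed

definition cell :: "int \<Rightarrow> real set" where "cell k = {x k<..x (k + 1)}"

text \<open>The cosine of half the opening angle of a sector: the constant in the comparison of the
  modulus with the projection to the bisector.\<close>

definition cos_half :: "int \<Rightarrow> real" where "cos_half k = cos (pi * ((x (k + 1) - x k) / 2))"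

lemma cos_half_pos: "cos_half k > 0"
  unfolding cos_half_def by (rule cos_pos_half) (use x_less[of k] x_width[of k] in auto)

text \<open>By periodicity only two widths occur, so one positive constant serves all
  sectors.\<close>

lemma cos_half_lower: "\<exists>c>0. \<forall>k. c \<le> cos_half k"
proof -
  have "cos_half k = cos_half 0 \<or> cos_half k = cos_half 1" for k
  proof (cases "even k")
    case True
    then obtain m where "k = 2 * m" by auto
    then show ?thesis using x_int[of 0 m] x_int[of 1 m] unfolding cos_half_def
      by (simp add: add.commute)
  next
    case False
    then obtain m where "k = 2 * m + 1" using oddE by blast
    then show ?thesis using x_int[of 2 m] x_int[of 1 m] unfolding cos_half_def
      by (simp add: add.commute)
  qed
  then have "min (cos_half 0) (cos_half 1) \<le> cos_half k" for k
    by (metis min.cobounded1 min.cobounded2)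
  then show ?thesis using cos_half_pos by (intro exI[of _ "min (cos_half 0) (cos_half 1)"]) auto
qed

lemma cell_shift: "(\<lambda>y. y + 1) ` cell k = cell (k + 2)"
proof -
  have "x (k + 2 + 1) = x (k + 1) + 1" using x_per[of "k + 1"] by (simp add: algebra_simps)
  then have "{x (k + 2)<..x (k + 2 + 1)} = {x k + 1<..x (k + 1) + 1}" using x_per[of k] by simp
  moreover have "(\<lambda>y. y + 1) ` {x k<..x (k + 1)} = {x k + 1<..x (k + 1) + 1}"
  proof (intro equalityI subsetI)
    fix z assume "z \<in> {x k + 1<..x (k + 1) + 1}"
    then show "z \<in> (\<lambda>y. y + 1) ` {x k<..x (k + 1)}" by (intro image_eqI[of _ _ "z - 1"]) auto
  qed auto
  ultimately show ?thesis unfolding cell_def by simp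
qed

lemma x_cell_unique: assumes "x j < c" "c \<le> x (j + 1)" "x k < c" "c \<le> x (k + 1)" shows "j = k"
proof (rule ccontr)
  assume "j \<noteq> k"
  then have "j + 1 \<le> k \<or> k + 1 \<le> j" by auto
  then show False using x_mono_le[of "j + 1" k] x_mono_le[of "k + 1" j] assms by auto
qed

end

section \<open>Gluing along a semiorthogonal decomposition\<close>

locale gluing = A: hn_slicing D \<A> PA 1 + B: hn_slicing D \<B> PB 1 + cuts x
  for D :: "('o, 'm) tricat" (structure) and \<A> \<B> and PA PB :: "real \<Rightarrow> 'o set" and x +
  assumes semiorth: "A.Orth \<B> \<A>" and decomp: "Ob D \<subseteq> A.star \<B> \<A>"
    and cut: "A.Orth (A.HN {x k<..}) (B.HN {..x k + 1})"
begin

definition G :: "int \<Rightarrow> 'o set" where "G k = A.star (B.HN (cell k)) (A.HN (cell k))"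

text \<open>The obstruction is an arrow \<open>a -> b[1]\<close>; the phases of \<open>b[1]\<close>
  are at most \<open>x k + 1\<close>, so \<open>cut\<close> applies.\<close>

lemma swap:
  assumes "E \<in> A.star {b} {a}" "b \<in> B.HN {..x k}" "a \<in> A.HN {x k<..}" shows "E \<in> A.star {a} {b}"
proof -
  have "sh_ob D b \<in> B.HN ((\<lambda>y. y + 1) ` {..x k})"
    using B.shifts_HN[of "{..x k}"] assms(2) A.isomorphic_refl A.sh_Ob B.HN_Ob
      unfolding A.shifts_def by blast
  moreover have "(\<lambda>y. y + 1) ` {..x k} \<subseteq> {..x k + 1}" by auto
  ultimately have "sh_ob D b \<in> B.HN {..x k + 1}" using B.HN_mono by blast
  then have "A.orth a (sh_ob D b)" using cut assms(3) unfolding A.Orth_def by blast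
  then show ?thesis using A.star_swap[OF assms(1)] by blast
qed

text \<open>Of the four Hom groups between the constituents, two vanish by the slicings, one by
  semiorthogonality, and the one from \<open>\<A>\<close> to \<open>\<B>\<close> by the cut at
  \<open>x k\<close>.\<close>

lemma Orth_G: assumes "j < k" shows "A.Orth (G k) (G j)"
proof -
  have le: "x (j + 1) \<le> x k" "x k < x (k + 1)" "x j < x (j + 1)" using x_mono_le assms x_less
    by auto
  have "A.Orth (B.HN (cell k)) (B.HN (cell j))" "A.Orth (A.HN (cell k)) (A.HN (cell j))"
    using le unfolding cell_def by (auto intro!: B.Orth_HN A.Orth_HN)
  moreover have "A.Orth (B.HN (cell k)) (A.HN (cell j))"
    using A.Orth_mono[OF semiorth B.HN_sub A.HN_sub] .
  moreover have "A.Orth (A.HN (cell k)) (B.HN (cell j))"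
  proof -
    have "cell k \<subseteq> {x k<..}" "cell j \<subseteq> {..x k + 1}" using le unfolding cell_def by auto
    then show ?thesis using A.Orth_mono[OF cut[of k] A.HN_mono B.HN_mono] by blast
  qed
  ultimately show ?thesis unfolding G_def by (intro A.Orth_star_left A.Orth_star_right)
qed

sublocale G: sliced_subcategory D "Ob D" G 2
proof
  show "triangulated_subcategory D (Ob D)" by (rule A.tsub_Ob_D)
  show "G p \<subseteq> Ob D" for p unfolding G_def by (rule A.star_Ob_sub)
  show "A.iso_closed (G p)" for p unfolding G_def by (rule A.iso_closed_star)
  show "A.zeros \<subseteq> G p" for p
  proof
    fix E assume E: "E \<in> A.zeros"
    then have "E \<in> B.HN (cell p)" "E \<in> A.HN (cell p)" using A.HN_zero B.HN_zero by blast+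
    then show "E \<in> G p" unfolding G_def
      using A.star_sing_refl(1)[of E E] A.star_singI[of E E E] E A.zero_Ob unfolding A.zeros_def
        by blast
  qed
  show "G (p + 2) = A.shifts (G p)" for p
  proof -
    have "B.HN (cell p) \<subseteq> Ob D" "A.HN (cell p) \<subseteq> Ob D" using A.HN_Ob B.HN_Ob by blast+
    then show ?thesis unfolding G_def by (simp add: A.shifts_star A.shifts_HN B.shifts_HN
      cell_shift)
  qed
  show "A.Orth (G p) (G q)" if "q < p" for p q using Orth_G[OF that] .
qed simp

text \<open>Induction over the cells, removing the topmost one: both components are truncated at
  \<open>y\<close>, and the middle terms \<open>b2\<close> and \<open>a1\<close> are interchanged,
  so that \<open>b1\<close> and \<open>a1\<close> form the part in the top sector.\<close>

lemma glue_cells: "A.star (B.HN {x m<..x (m + int N)}) (A.HN {x m<..x (m + int N)}) \<subseteq> G.HN {m..<m +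
  int N}"
proof (induction N)
  case 0
  then show ?case using A.HN_empty B.HN_empty A.star_zero_left[OF A.iso_closed_zeros] G.HN_zero
    by simp
next
  case (Suc N)
  define y where "y = x (m + int N)"
  have xs: "x (m + int (Suc N)) = x (m + int N + 1)" by (simp add: algebra_simps)
  have c: "{x m<..x (m + int N + 1)} \<inter> {y<..} = cell (m + int N)" "{x m<..x (m + int N + 1)} -
    {y<..} = {x m<..y}"
    using x_mono_le[of m "m + int N"] x_less[of "m + int N"] unfolding cell_def y_def by auto
  show ?case
  proof
    fix E assume "E \<in> A.star (B.HN {x m<..x (m + int (Suc N))}) (A.HN {x m<..x (m + int (Suc N))})"
    then obtain b a where ba: "b \<in> B.HN {x m<..x (m + int N + 1)}" "a \<in> A.HN {x m<..x (m + int N +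
      1)}"
      "E \<in> A.star {b} {a}" unfolding xs by (rule A.star_singE)
    obtain b1 b2 where b: "b1 \<in> B.HN (cell (m + int N))" "b2 \<in> B.HN {x m<..y}" "b \<in> A.star {b1}
      {b2}"
      using B.HN_cut[OF B.upset_greaterThan[of y] ba(1)] unfolding c .
    obtain a1 a2 where a: "a1 \<in> A.HN (cell (m + int N))" "a2 \<in> A.HN {x m<..y}" "a \<in> A.star {a1}
      {a2}"
      using A.HN_cut[OF A.upset_greaterThan[of y] ba(2)] unfolding c .
    have "E \<in> A.star (A.star {b1} {b2}) (A.star {a1} {a2})" using ba(3) a(3) b(3) A.star_singI
      by blast
    also have "\<dots> = A.star {b1} (A.star (A.star {b2} {a1}) {a2})" by (simp add: A.star_assoc)
    also have "\<dots> \<subseteq> A.star {b1} (A.star (A.star {a1} {b2}) {a2})"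
    proof -
      have 1: "b2 \<in> B.HN {..x (m + int N)}" by (rule subsetD[OF B.HN_mono b(2)]) (auto simp: y_def)
      have 2: "a1 \<in> A.HN {x (m + int N)<..}"
        by (rule subsetD[OF A.HN_mono a(1)]) (auto simp: cell_def)
      have "A.star {b2} {a1} \<subseteq> A.star {a1} {b2}" using swap[OF _ 1 2] by blast
      then show ?thesis by (rule A.star_mono[OF order_refl A.star_mono[OF _ order_refl]])
    qed
    also have "\<dots> = A.star (A.star {b1} {a1}) (A.star {b2} {a2})" by (simp add: A.star_assoc)
    finally obtain E1 E2 where E: "E1 \<in> A.star {b1} {a1}" "E2 \<in> A.star {b2} {a2}" "E \<in> A.star {E1}
      {E2}"
      by (rule A.star_singE)
    have "E1 \<in> G (m + int N)" unfolding G_def using A.star_singI[OF E(1) b(1) a(1)] .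
    then have 1: "E1 \<in> G.HN {m + int N}" using G.P_HN by blast
    have 2: "E2 \<in> G.HN {m..<m + int N}" using A.star_singI[OF E(2) b(2) a(2)] Suc unfolding y_def
      by blast
    have "E \<in> G.HN ({m + int N} \<union> {m..<m + int N})" by (rule G.HN_merge[OF E(3) 1 2]) auto
    moreover have "{m + int N} \<union> {m..<m + int N} = {m..<m + int (Suc N)}" by auto
    ultimately show "E \<in> G.HN {m..<m + int (Suc N)}" by simp
  qed
qed

text \<open>Only finitely many phases occur in the two components of an object, so finitely many
  cells suffice.\<close>

sublocale G: hn_slicing D "Ob D" G 2
proof
  show "Ob D \<subseteq> G.HN UNIV"
  proof
    fix E assume "E \<in> Ob D"
    then have "E \<in> A.star \<B> \<A>" using decomp by blast
    then obtain b a where ba: "b \<in> \<B>" "a \<in> \<A>" "E \<in> A.star {b} {a}" by (rule A.star_singE)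
    obtain F1 where F1: "finite F1" "b \<in> B.HN F1" using ba(1) B.HN_UNIV B.HN_finite by metis
    obtain F2 where F2: "finite F2" "a \<in> A.HN F2" using ba(2) A.HN_UNIV A.HN_finite by metis
    \<comment> \<open>The element \<open>0\<close> makes \<open>F\<close> nonempty, so that
      \<open>Min\<close> and \<open>Max\<close> are meaningful.\<close>
    define F where "F = insert 0 (F1 \<union> F2)"
    have fF: "finite F" unfolding F_def using F1 F2 by simp
    obtain m where m: "x m < Min F" using x_cover by metis
    obtain n where n: "Max F \<le> x (n + 1)" using x_cover by metis
    have mn: "m < n + 1"
    proof (rule ccontr)
      assume "\<not> m < n + 1"
      then have "x (n + 1) \<le> x m" using x_mono_le by simp
      moreover have "Min F \<le> Max F" using fF unfolding F_def
        by (meson Max_ge Min_in insert_not_empty)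
      ultimately show False using m n by linarith
    qed
    define N where "N = nat (n + 1 - m)"
    have N: "m + int N = n + 1" unfolding N_def using mn by simp
    have "F \<subseteq> {x m<..x (m + int N)}" unfolding N
    proof
      fix p assume "p \<in> F"
      then show "p \<in> {x m<..x (n + 1)}" using m n Min_le[OF fF, of p] Max_ge[OF fF, of p] by auto
    qed
    then have "b \<in> B.HN {x m<..x (m + int N)}" "a \<in> A.HN {x m<..x (m + int N)}"
      using F1 F2 B.HN_mono[of F1] A.HN_mono[of F2] unfolding F_def by blast+
    then have "E \<in> G.HN {m..<m + int N}" using glue_cells A.star_singI[OF ba(3)] by blast
    then show "E \<in> G.HN UNIV" using G.HN_mono by blast
  qed
qed

end

section \<open>Refining a decomposition into sectors to a slicing\<close>

text \<open>Each \<open>G k\<close> plays the role of the objects with phases in \<open>(x k, x (k+1)]\<close>, an interval of length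
  less than \<open>1\<close>.  Harder--Narasimhan filtrations inside \<open>G k\<close> exist because only finitely many
  central charges of bounded size occur.\<close>

locale refinement = hn_slicing D "Ob D" G "2 :: int" + cuts x
  for D :: "('o, 'm) tricat" (structure) and G and x +
  fixes Z :: "'o \<Rightarrow> complex"
  assumes Z_add: "E \<in> star {X} {Y} \<Longrightarrow> Z E = Z X + Z Y"
    and sector: "\<lbrakk>E \<in> G k; \<not> zero_object D E\<rbrakk> \<Longrightarrow> \<exists>\<phi>\<in>cell k. Z E \<in> ray \<phi>"
    and fin: "finite {Z E | E k. E \<in> G k \<and> cmod (Z E) \<le> M}"
begin

section \<open>Charges and phases in a sector\<close>

lemma Z_zero: assumes "zero_object D N" shows "Z N = 0"
  using Z_add[OF star_sing_refl(1)[OF zero_Ob[OF assms] assms]] by simp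

lemma Z_iso: assumes "isomorphic D X Y" shows "Z X = Z Y"
proof -
  obtain N where N: "zero_object D N" using ex_zero_object by blast
  have o: "X \<in> Ob D" using assms isomorphic_Ob by blast
  have "Y \<in> star {X} {N}"
    using star_change[OF star_sing_refl(1)[OF o N] isomorphic_refl[OF o] assms isomorphic_refl[OF
      zero_Ob[OF N]]] .
  then show ?thesis using Z_add Z_zero[OF N] by simp
qed

lemma Z_sh: assumes "X \<in> Ob D" shows "Z (sh X) = - Z X"
proof -
  obtain N where N: "zero_object D N" using ex_zero_object by blast
  have "0 = Z X + Z (sh X)" using Z_add[OF star_rot(1)[OF star_sing_refl(1)[OF assms N]]] Z_zero[OF
    N] by simp
  then show ?thesis by (simp add: eq_neg_iff_add_eq_0 add.commute)
qed

lemma HNsing: "HN {k} = G k" by (rule HN_sing)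

lemma order_convex_sing: "order_convex {k}" unfolding order_convex_def by auto

lemma G_ext: "\<lbrakk>E \<in> star {X} {Y}; X \<in> G k; Y \<in> G k\<rbrakk> \<Longrightarrow> E \<in> G k"
  using HN_ext[OF order_convex_sing] unfolding HNsing by blast

lemma G_Ob: "E \<in> G k \<Longrightarrow> E \<in> Ob D"
  using P_sub by blast

lemma cl_close: "\<lbrakk>\<phi> \<in> cell k; \<psi> \<in> cell k\<rbrakk> \<Longrightarrow> \<phi> < \<psi> + 1"
  using x_width[of k] unfolding cell_def by auto

lemma im_rot_cl: assumes "z \<in> ray \<phi>" "\<phi> \<in> cell k" "\<psi> \<in> cell k"
  shows "im_rot \<psi> z \<le> 0 \<longleftrightarrow> \<phi> \<le> \<psi>" "0 \<le> im_rot \<psi> z \<longleftrightarrow> \<psi> \<le> \<phi>"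
  using im_rot_ray_pos[OF assms(1), of \<psi>] im_rot_ray_neg[OF assms(1), of \<psi>] im_rot_ray_eq[OF
    assms(1)]
    cl_close[OF assms(2,3)] cl_close[OF assms(3,2)]
  by (cases \<phi> \<psi> rule: linorder_cases; force)+

definition semistable :: "int \<Rightarrow> real \<Rightarrow> 'o \<Rightarrow> bool" where
  "semistable k \<phi> E \<longleftrightarrow> E \<in> G k \<and> (\<not> zero_object D E \<longrightarrow> Z E \<in> ray \<phi> \<and>
     (\<forall>K Q. E \<in> star {K} {Q} \<longrightarrow> K \<in> G k \<longrightarrow> Q \<in> G k \<longrightarrow> im_rot \<phi> (Z K) \<le> 0))"

text \<open>A morphism \<open>E \<rightarrow> F\<close> factors through a strict quotient \<open>C\<close> of \<open>E\<close>, and the strict subobject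
  of \<open>F\<close> it generates is an extension of an object of the next sector by \<open>C\<close>. As that sector has
  larger phases, passing from \<open>C\<close> to this subobject does not decrease the phase.\<close>

lemma semistable_orth:
  assumes "semistable k \<phi> E" "semistable k \<psi> F" "\<phi> \<in> cell k" "\<psi> \<in> cell k" "\<psi> < \<phi>"
  shows "orth E F"
proof (cases "zero_object D E \<or> zero_object D F")
  case True
  then show ?thesis using orth_zero by blast
next
  case False
  have E: "E \<in> HN {k}" "Z E \<in> ray \<phi>" and F: "F \<in> HN {k}"
    using assms(1,2) False unfolding semistable_def HNsing by blast+
  have uk: "upset {j..}" for j :: int unfolding upset_def by auto
  have eq: "at_or_above {k} = {k..}" unfolding at_or_above_def by auto
  { fix f assume f: "arr f E F"
    obtain V K V2 C i d p a b c c' u v v'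
      where t: "T V E F i f d" "T K V V2 a b p" "T K E C (i \<cdot> a) c c'"
      "T V2 C F u v v'" "v \<cdot> c = f" "K \<in> HN {k}" "C \<in> HN {k}" "V2 \<in> HN (- at_or_above {k})"
      by (rule kernel[OF order_convex_sing _ E(1) F f]) auto
    have G: "K \<in> G k" "C \<in> G k" using t HNsing by blast+
    have o: "V2 \<in> Ob D" "C \<in> Ob D" "F \<in> Ob D" using T_Ob[OF t(4)] by auto
    have "zero_object D C"
    proof (rule ccontr)
      assume nz: "\<not> zero_object D C"
      then obtain p where p: "p \<in> cell k" "Z C \<in> ray p" using sector[OF G(2)] by blast
      have EKC: "E \<in> star {K} {C}" using starI[OF t(3)] by simp
      then have "im_rot \<phi> (Z K) \<le> 0" using assms(1) False G unfolding semistable_def by blast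
      \<comment> \<open>\<open>im_rot \<phi>\<close> vanishes on \<open>Z E\<close> and is not
        positive on \<open>Z K\<close>, so it is nonnegative on the quotient: the phase of
        \<open>C\<close> is at least \<phi>.\<close>
      then have "0 \<le> im_rot \<phi> (Z C)" using Z_add[OF EKC] im_rot_ray_eq[OF E(2)] im_rot_add[of \<phi> "Z
        K" "Z C"] by simp
      then have "\<phi> \<le> p" using im_rot_cl(2)[OF p(2,1) assms(3)] by simp
      then have 1: "0 < im_rot \<psi> (Z C)" using im_rot_cl(1)[OF p(2,1) assms(4)] assms(5) by force
      have CV: "C \<in> star {V2} {F}" using starI[OF t(4)] by simp
      have FV: "F \<in> star {C} {sh V2}" "sh V2 \<in> star {F} {sh C}" using star_rot[OF CV] by auto
      \<comment> \<open>\<open>V2[1]\<close> is confined to the indices \<open>k\<close> and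
        \<open>k + 1\<close>: from below as an extension of \<open>C[1]\<close> by \<open>F\<close>,
        from above because \<open>V2\<close> lies below \<open>k\<close> and the shift adds
        2.\<close>
      have "F \<in> HN {k..}" "C \<in> HN {k..}" by (rule subsetD[OF HN_mono F] subsetD[OF HN_mono t(7)],
        simp)+
      then have up: "sh V2 \<in> HN {k..}" using HN_up_ext[OF uk FV(2)] HN_sh_up[OF uk] by blast
      have "V2 \<in> HN {..<k}" using t(8) unfolding eq by (simp add: Compl_atLeast)
      then have "sh V2 \<in> HN ((\<lambda>x. x + 2) ` {..<k})"
        using shifts_HN[of "{..<k}"] isomorphic_refl[OF sh_Ob[OF o(1)]] unfolding shifts_def
          by blast
      then have "sh V2 \<in> HN (- {k + 2..})" by (rule subsetD[OF HN_mono, rotated]) auto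
      then have "sh V2 \<in> HN ({k..} - {k + 2..})" using HN_inter[OF uk uk up] by blast
      then obtain W1 W0 where W: "W1 \<in> HN (({k..} - {k + 2..}) \<inter> {k+1..})" "W0 \<in> HN ({k..} - {k +
        2..} - {k+1..})"
        "sh V2 \<in> star {W1} {W0}" by (rule HN_cut[OF uk])
      have "({k..} - {k + 2..}) \<inter> {k+1..} = {k + 1}" "{k..} - {k + 2..} - {k+1..} = {k}" by auto
      then have W': "W1 \<in> HN {k + 1}" "W0 \<in> HN {k}" using W by simp_all
      \<comment> \<open>Reassociation yields the strict subobject generated by \<open>C\<close>:
        \<open>I\<close> is an extension of \<open>W1\<close> by \<open>C\<close>, and its quotient
        in \<open>F\<close> is \<open>W0\<close>.\<close>
      have "F \<in> star {C} (star {W1} {W0})" using star_singI[OF FV(1) _ W(3)] by simp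
      then have "F \<in> star (star {C} {W1}) {W0}" by (simp add: star_assoc)
      then obtain I where I: "I \<in> star {C} {W1}" "F \<in> star {I} {W0}" by (auto elim: star_singE)
      have "W1 \<in> HN {k..}" by (rule subsetD[OF HN_mono W'(1)]) simp
      then have I1: "I \<in> HN {k..}" using HN_up_ext[OF uk I(1) \<open>C \<in> HN {k..}\<close>] by blast
      \<comment> \<open>\<open>I\<close> is an extension of \<open>F\<close> by
        \<open>W0[-1]\<close>, which has index \<open>k - 2\<close>; hence nothing of
        \<open>I\<close> remains at index \<open>k + 1\<close>.\<close>
      obtain Y where Y: "Y \<in> Ob D" "isomorphic D (sh Y) W0" using unsh_ex star_sing_Ob[OF I(2)]
        by blast
      have "sh Y \<in> HN {k}" using iso_closedD[OF HN_iso_closed W'(2) isomorphic_sym[OF Y(2)]] .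
      then have "Y \<in> HN {k - 2}" using HN_shift_iff[OF Y(1), of "{k}"] by simp
      then have "Y \<in> HN (- {k + 1..})" "F \<in> HN (- {k + 1..})"
        using subsetD[OF HN_mono[of "{k - 2}" "- {k + 1..}"]] subsetD[OF HN_mono[of "{k}" "- {k +
          1..}"] F] by simp_all
      then have "I \<in> HN (- {k + 1..})" using HN_dn_ext[OF uk star_fibre[OF I(2) Y(2,1)]] by blast
      then have "I \<in> HN ({k..} - {k + 1..})" using HN_inter[OF uk uk I1] by blast
      moreover have "{k..} - {k + 1..} = {k}" by auto
      ultimately have "I \<in> G k" using HNsing by simp
      then have "im_rot \<psi> (Z I) \<le> 0" using assms(2) False I(2) W'(2) unfolding semistable_def HNsing
        by blast
      \<comment> \<open>The phase of \<open>W1\<close> lies above \<open>x (k + 1)\<close> and is at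
        most \<open>x (k + 2) = x k + 1 < \<psi> + 1\<close>, hence on the positive side of the ray
        of phase \<psi>.\<close>
      moreover have "0 \<le> im_rot \<psi> (Z W1)"
      proof (cases "zero_object D W1")
        case True
        then show ?thesis using Z_zero by simp
      next
        case False
        then obtain q where q: "x (k + 1) < q" "q \<le> x (k + 2)" "Z W1 \<in> ray q"
          using sector[of W1 "k + 1"] W'(1) unfolding HNsing by (auto simp: add.assoc cell_def)
        then show ?thesis using im_rot_ray_pos[OF q(3), of \<psi>] assms(4) x_per[of k]
          unfolding cell_def by auto
      qed
      ultimately show False using Z_add[OF I(1)] im_rot_add[of \<psi> "Z C" "Z W1"] 1 by simp
    qed
    then have "v = zo C F" using orth_zero(2) orthD T_arr(2)[OF t(4)] by blast
    then have "f = zo E F" using t(5) cmp_zero(2)[OF T_arr(2)[OF t(3)] o(3)] by simp }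
  then show ?thesis unfolding orth_def by blast
qed

text \<open>Among the charges of modulus at most 1 there are only finitely many, and those of
  nonzero objects are nonzero. The threshold 1 is arbitrary.\<close>

lemma Z_lower: "\<exists>m>0. \<forall>k E. E \<in> G k \<longrightarrow> \<not> zero_object D E \<longrightarrow> m \<le> cmod (Z E)"
proof -
  define S where "S = {Z E | E k. E \<in> G k \<and> cmod (Z E) \<le> 1} - {0}"
  have f: "finite (insert 1 (cmod ` S))" unfolding S_def using fin[of 1] by simp
  define m where "m = Min (insert 1 (cmod ` S))"
  have "m > 0" unfolding m_def using f by (simp add: S_def)
  moreover have "m \<le> cmod (Z E)" if E: "E \<in> G k" "\<not> zero_object D E" for k E
  proof (cases "cmod (Z E) \<le> 1")
    case True
    have "Z E \<noteq> 0" using sector[OF E] ray_nonzero by blast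
    then have "Z E \<in> S" using True E unfolding S_def by blast
    then show ?thesis unfolding m_def using Min_le[OF f] by simp
  next
    case False
    have "m \<le> 1" unfolding m_def using Min_le[OF f] by simp
    then show ?thesis using False by simp
  qed
  ultimately show ?thesis by blast
qed

text \<open>Projection to the bisector of the sector; on \<open>G k\<close> it is comparable with
  the modulus.\<close>

definition len :: "int \<Rightarrow> complex \<Rightarrow> real" where "len k z = re_rot ((x k + x (k + 1)) / 2) z"

lemma len_ge: assumes "z \<in> ray \<phi>" "\<phi> \<in> cell k" shows "cos_half k * cmod z \<le> len k z"
  unfolding len_def cos_half_def
  by (rule re_rot_ray[OF assms(1)]) (use assms(2) x_width[of k] in
    \<open>auto simp: cell_def abs_if field_simps\<close>)

lemma len_G: assumes "E \<in> G k" shows "cos_half k * cmod (Z E) \<le> len k (Z E)"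
proof (cases "zero_object D E")
  case True
  then show ?thesis using Z_zero by (simp add: len_def)
next
  case False
  then show ?thesis using sector[OF assms] len_ge by blast
qed

lemma len_G_nonneg: "E \<in> G k \<Longrightarrow> 0 \<le> len k (Z E)"
  using len_G[of E k] cos_half_pos[of k] by (meson less_imp_le norm_ge_zero order.trans
    zero_le_mult_iff)

lemma len_add: "len k (z + w) = len k z + len k w"
  unfolding len_def by (rule re_rot_add)

section \<open>The refined slices\<close>

definition cell_index :: "real \<Rightarrow> int" where "cell_index \<phi> = (THE k. \<phi> \<in> cell k)"

lemma cell_index: "\<phi> \<in> cell k \<longleftrightarrow> cell_index \<phi> = k"
proof -
  obtain j where j: "\<phi> \<in> cell j" using x_cover[of \<phi>] unfolding cell_def by auto
  have u: "i = j" if "\<phi> \<in> cell i" for i using that j x_cell_unique unfolding cell_def by auto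
  have "cell_index \<phi> = j" unfolding cell_index_def using j u by blast
  then show ?thesis using j u by blast
qed

lemma cell_index_shift: "cell_index (\<phi> + 1) = cell_index \<phi> + 2"
proof -
  have "\<phi> \<in> cell (cell_index \<phi>)" using cell_index by blast
  then have "\<phi> + 1 \<in> cell (cell_index \<phi> + 2)"
    using x_per[of "cell_index \<phi>"] x_per[of "cell_index \<phi> + 1"] unfolding cell_def
    by (auto simp: algebra_simps)
  then show ?thesis using cell_index by blast
qed

definition refined :: "real \<Rightarrow> 'o set" where "refined \<phi> = {E. semistable (cell_index \<phi>) \<phi> E}"

lemma refined_cl: "\<phi> \<in> cell k \<Longrightarrow> E \<in> refined \<phi> \<longleftrightarrow> semistable k \<phi> E"
  unfolding refined_def using cell_index by auto

lemma refined_G: "refined \<phi> \<subseteq> G (cell_index \<phi>)"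
  unfolding refined_def semistable_def by blast

lemma semistable_iso: assumes "semistable k \<phi> E" "isomorphic D E F" shows "semistable k \<phi> F"
proof -
  have G: "E \<in> G k" using assms unfolding semistable_def by blast
  have 1: "F \<in> G k" using iso_closedD[OF P_iso_closed G assms(2)] .
  have 2: "zero_object D E \<longleftrightarrow> zero_object D F"
    using zero_iso[OF assms(2)] zero_iso[OF isomorphic_sym[OF assms(2)]] by blast
  have 3: "E \<in> star {K} {Q}" if "F \<in> star {K} {Q}" for K Q
    using star_change[OF that isomorphic_refl isomorphic_sym[OF assms(2)] isomorphic_refl]
      star_sing_Ob[OF that] by blast
  show ?thesis using assms(1) 1 2 3 Z_iso[OF assms(2)] unfolding semistable_def by auto
qed

text \<open>The sign change of \<open>Z\<close> under the shift cancels against the change of phase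
  by 1. Strict subobjects of \<open>sh F\<close> are traced back to those of \<open>F\<close>
  through preimages \<open>K'\<close> and \<open>Q'\<close> up to isomorphism.\<close>

lemma semistable_sh: assumes "F \<in> Ob D" shows "semistable (k + 2) (\<phi> + 1) (sh F) \<longleftrightarrow> semistable k \<phi> F"
proof -
  have m: "sh X \<in> G (k + 2) \<longleftrightarrow> X \<in> G k" if "X \<in> Ob D" for X unfolding P_shift
    using mem_shifts[OF P_iso_closed that] .
  have "(\<forall>K Q. sh F \<in> star {K} {Q} \<longrightarrow> K \<in> G (k + 2) \<longrightarrow> Q \<in> G (k + 2) \<longrightarrow> im_rot (\<phi> + 1) (Z K) \<le> 0) \<longleftrightarrow>
        (\<forall>K Q. F \<in> star {K} {Q} \<longrightarrow> K \<in> G k \<longrightarrow> Q \<in> G k \<longrightarrow> im_rot \<phi> (Z K) \<le> 0)" (is "?L \<longleftrightarrow> ?R")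
  proof (intro iffI allI impI)
    fix K Q assume L: ?L and a: "F \<in> star {K} {Q}" "K \<in> G k" "Q \<in> G k"
    have "sh K \<in> G (k + 2)" "sh Q \<in> G (k + 2)" using m a G_Ob by blast+
    then have "im_rot (\<phi> + 1) (Z (sh K)) \<le> 0" using L star_sh[OF a(1)] by blast
    then show "im_rot \<phi> (Z K) \<le> 0" using Z_sh[of K] G_Ob[OF a(2)] im_rot_shift by simp
  next
    fix K Q assume R: ?R and a: "sh F \<in> star {K} {Q}" "K \<in> G (k + 2)" "Q \<in> G (k + 2)"
    obtain K' where K': "K' \<in> Ob D" "isomorphic D (sh K') K" using unsh_ex G_Ob[OF a(2)] by blast
    obtain Q' where Q': "Q' \<in> Ob D" "isomorphic D (sh Q') Q" using unsh_ex G_Ob[OF a(3)] by blast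
    have "sh K' \<in> G (k + 2)" "sh Q' \<in> G (k + 2)"
      using iso_closedD[OF P_iso_closed a(2) isomorphic_sym[OF K'(2)]] iso_closedD[OF P_iso_closed
        a(3) isomorphic_sym[OF Q'(2)]] .
    then have g: "K' \<in> G k" "Q' \<in> G k" using m K' Q' by blast+
    have "sh F \<in> star {sh K'} {sh Q'}"
      using star_change[OF a(1) isomorphic_sym[OF K'(2)] isomorphic_refl[OF sh_Ob[OF assms]]
        isomorphic_sym[OF Q'(2)]] .
    then have "F \<in> star {K'} {Q'}" using star_unsh K' Q' assms by blast
    then have "im_rot \<phi> (Z K') \<le> 0" using R g by blast
    then show "im_rot (\<phi> + 1) (Z K) \<le> 0" using Z_iso[OF K'(2)] Z_sh[OF K'(1)] im_rot_shift[of \<phi> "Z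
      K'"] by simp
  qed
  then show ?thesis unfolding semistable_def
    using m[OF assms] zero_sh_iff[OF assms] Z_sh[OF assms] ray_shift by auto
qed

text \<open>Orthogonality between phases of one cell is \<open>semistable_orth\<close>; between
  different cells it is inherited from \<open>G\<close>.\<close>

sublocale refined: sliced_subcategory D "Ob D" refined 1
proof
  show "triangulated_subcategory D (Ob D)" by (rule tsub_Ob_D)
  show "refined p \<subseteq> Ob D" for p using refined_G G_Ob by blast
  then show "iso_closed (refined p)" for p unfolding iso_closed_def refined_def using semistable_iso
    by blast
  show "zeros \<subseteq> refined p" for p using P_zero unfolding refined_def semistable_def zeros_def
    by blast
  show "refined (p + 1) = shifts (refined p)" for p
  proof (intro equalityI subsetI)
    fix E assume E: "E \<in> refined (p + 1)"
    then have s: "semistable (cell_index p + 2) (p + 1) E" unfolding refined_def cell_index_shift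
      by simp
    then obtain F where F: "F \<in> Ob D" "isomorphic D (sh F) E" using unsh_ex G_Ob
      unfolding semistable_def by blast
    then have "semistable (cell_index p) p F"
      using semistable_iso[OF s isomorphic_sym] semistable_sh by blast
    then show "E \<in> shifts (refined p)" using F unfolding shifts_def refined_def by blast
  next
    fix E assume "E \<in> shifts (refined p)"
    then obtain F where F: "semistable (cell_index p) p F" "isomorphic D (sh F) E"
      unfolding shifts_def refined_def by blast
    then have "semistable (cell_index p + 2) (p + 1) (sh F)" using semistable_sh[of F] G_Ob
      unfolding semistable_def by blast
    then show "E \<in> refined (p + 1)" using semistable_iso F(2) unfolding refined_def cell_index_shift
      by blast
  qed
  show "Orth (refined p) (refined q)" if "q < p" for p q
  proof (cases "cell_index p = cell_index q")
    case True
    then show ?thesis using semistable_orth[of "cell_index p" p _ q] that cell_index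
      unfolding Orth_def refined_def by auto
  next
    case False
    have "cell_index q < cell_index p"
    proof (rule ccontr)
      assume "\<not> cell_index q < cell_index p"
      then have "cell_index p + 1 \<le> cell_index q" using False by simp
      then have "x (cell_index p + 1) \<le> x (cell_index q)" by (rule x_mono_le)
      moreover have "p \<in> cell (cell_index p)" "q \<in> cell (cell_index q)" using cell_index by blast+
      ultimately show False using that unfolding cell_def by auto
    qed
    then show ?thesis using Orth_mono[OF P_orth refined_G refined_G] by blast
  qed
qed simp

lemma refined_HN_G: assumes "J \<subseteq> cell k" shows "refined.HN J \<subseteq> G k"
proof
  fix E assume "E \<in> refined.HN J"
  then show "E \<in> G k"
  proof (induction rule: refined.HN_induct)
    case (zero E)
    then show ?case using P_zero unfolding zeros_def by blast
  next
    case (step E X Y p)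
    have "cell_index p = k" using step(4) assms cell_index by blast
    then show ?case using G_ext[OF step(1,5)] refined_G[of p] step(3) by blast
  qed
qed

text \<open>The first Harder--Narasimhan factor is the strict subobject of maximal phase and, among those,
  of maximal length.\<close>

lemma max_destabilizing:
  assumes "E \<in> G k" "\<not> zero_object D E"
  obtains K Q \<phi> where "E \<in> star {K} {Q}" "K \<in> G k" "Q \<in> G k" "\<not> zero_object D K" "\<phi> \<in> cell k"
    "semistable k \<phi> K" "Z K \<in> ray \<phi>"
    "\<And>K' Q'. \<lbrakk>E \<in> star {K'} {Q'}; K' \<in> G k; Q' \<in> G k; \<not> zero_object D K'\<rbrakk> \<Longrightarrow>
       im_rot \<phi> (Z K') \<le> 0 \<and> (Z K' \<in> ray \<phi> \<longrightarrow> len k (Z K') \<le> len k (Z K))"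
proof -
  define R where "R K Q \<longleftrightarrow> E \<in> star {K} {Q} \<and> K \<in> G k \<and> Q \<in> G k \<and> \<not> zero_object D K" for K Q
  define S where "S = {Z K | K Q. R K Q}"
  \<comment> \<open>The quotient has nonnegative length, so a strict subobject is at most as long as
    \<open>E\<close>. Its modulus is then bounded, and only finitely many charges compete.\<close>
  have "S \<subseteq> {Z E' | E' j. E' \<in> G j \<and> cmod (Z E') \<le> len k (Z E) / cos_half k}"
  proof
    fix z assume "z \<in> S"
    then obtain K Q where K: "z = Z K" "R K Q" unfolding S_def by blast
    have EK: "E \<in> star {K} {Q}" using K unfolding R_def by blast
    have "len k (Z E) = len k (Z K) + len k (Z Q)" using Z_add[OF EK] len_add by simp
    then have le: "cos_half k * cmod (Z K) \<le> len k (Z E)" using len_G[of K k] len_G_nonneg[of Q k] K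
      unfolding R_def by simp
    then show "z \<in> {Z E' | E' j. E' \<in> G j \<and> cmod (Z E') \<le> len k (Z E) / cos_half k}"
    proof -
      have "cmod (Z K) \<le> len k (Z E) / cos_half k" using le cos_half_pos[of k]
        by (simp add: field_simps)
      then show ?thesis using K unfolding R_def by blast
    qed
  qed
  moreover have "finite {Z E' | E' j. E' \<in> G j \<and> cmod (Z E') \<le> len k (Z E) / cos_half k}"
    by (rule fin)
  ultimately have fS: "finite S" by (meson finite_subset subset_trans)
  obtain N where N: "zero_object D N" using ex_zero_object by blast
  have "R E N" unfolding R_def using star_sing_refl(1)[OF G_Ob[OF assms(1)] N] assms P_zero[of k] N
    unfolding zeros_def by blast
  then have neS: "S \<noteq> {}" unfolding S_def by blast
  have exph: "\<exists>\<phi>. \<phi> \<in> cell k \<and> z \<in> ray \<phi>" if "z \<in> S" for z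
    using that sector unfolding S_def R_def by blast
  define ph where "ph z = (SOME \<phi>. \<phi> \<in> cell k \<and> z \<in> ray \<phi>)" for z
  have ph: "ph z \<in> cell k" "z \<in> ray (ph z)" if "z \<in> S" for z
    using someI_ex[OF exph[OF that]] unfolding ph_def by auto
  define \<phi> where "\<phi> = Max (ph ` S)"
  define S0 where "S0 = {z \<in> S. ph z = \<phi>}"
  have "\<phi> \<in> ph ` S" unfolding \<phi>_def using fS neS by simp
  then have S0: "finite S0" "S0 \<noteq> {}" "\<phi> \<in> cell k" unfolding S0_def using fS ph by auto
  have "Max (len k ` S0) \<in> len k ` S0" using S0 by simp
  then obtain z where z: "z \<in> S0" "len k z = Max (len k ` S0)" by auto
  then obtain K Q where K: "z = Z K" "R K Q" unfolding S0_def S_def by blast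
  have zr: "Z K \<in> ray \<phi>" using z ph K unfolding S0_def by blast
  have mx: "im_rot \<phi> (Z K') \<le> 0 \<and> (Z K' \<in> ray \<phi> \<longrightarrow> len k (Z K') \<le> len k (Z K))" if "R K' Q'"
    for K' Q'
  proof -
    have s: "Z K' \<in> S" using that unfolding S_def by blast
    then have le: "ph (Z K') \<le> \<phi>" unfolding \<phi>_def using fS by simp
    then have t: "im_rot \<phi> (Z K') \<le> 0" using im_rot_cl(1)[OF ph(2,1)[OF s] S0(3)] by simp
    moreover have "len k (Z K') \<le> len k (Z K)" if "Z K' \<in> ray \<phi>"
    proof -
      have "im_rot \<phi> (Z K') = 0" using im_rot_ray_eq[OF that] .
      then have "\<phi> \<le> ph (Z K')" using im_rot_cl(2)[OF ph(2,1)[OF s] S0(3)] by simp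
      then have "Z K' \<in> S0" unfolding S0_def using s le by simp
      then show ?thesis using z(2) K(1) S0(1) by simp
    qed
    ultimately show ?thesis by blast
  qed
  \<comment> \<open>A strict subobject of \<open>K\<close> is one of \<open>E\<close> as well, its
    quotient being an extension of \<open>Q\<close> by \<open>Q'\<close> in the sector.\<close>
  have "semistable k \<phi> K"
    unfolding semistable_def
  proof (intro conjI impI allI)
    show "K \<in> G k" "Z K \<in> ray \<phi>" using K zr unfolding R_def by auto
    fix K' Q' assume a: "K \<in> star {K'} {Q'}" "K' \<in> G k" "Q' \<in> G k"
    show "im_rot \<phi> (Z K') \<le> 0"
    proof (cases "zero_object D K'")
      case True
      then show ?thesis using Z_zero by simp
    next
      case False
      have "E \<in> star (star {K'} {Q'}) {Q}" using a(1) K unfolding R_def by (blast intro: star_singI)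
      then have "E \<in> star {K'} (star {Q'} {Q})" by (simp add: star_assoc)
      then obtain Q'' where Q'': "Q'' \<in> star {Q'} {Q}" "E \<in> star {K'} {Q''}"
        by (auto elim: star_singE)
      then have "R K' Q''" unfolding R_def using G_ext[OF Q''(1) a(3)] K a False unfolding R_def
        by blast
      then show ?thesis using mx by blast
    qed
  qed
  then show thesis using that[of K Q \<phi>] K zr S0(3) mx unfolding R_def by blast
qed

text \<open>Induction on \<open>n\<close> with length below \<open>c * n\<close>: nonzero objects
  have length at least \<open>c\<close>, so dividing out the maximal \<open>K\<close> lowers
  \<open>n\<close>. The conclusion records the first factor because the induction step compares its
  phase with that of \<open>K\<close>.\<close>

lemma HN_first:
  assumes "E \<in> G k" "\<not> zero_object D E"
  shows "\<exists>\<phi>\<in>cell k. \<exists>K Q. K \<in> refined \<phi> \<and> \<not> zero_object D K \<and> Q \<in> refined.HN (cell k \<inter> {..<\<phi>}) \<and> E \<in>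
    star {K} {Q}"
proof -
  obtain m where m: "m > 0" "\<And>k E. \<lbrakk>E \<in> G k; \<not> zero_object D E\<rbrakk> \<Longrightarrow> m \<le> cmod (Z E)" using Z_lower
    by blast
  define c where "c = cos_half k * m"
  have c0: "c > 0" unfolding c_def using m cos_half_pos by simp
  have c: "c \<le> len k (Z E)" if "E \<in> G k" "\<not> zero_object D E" for E
    using len_G[OF that(1)] m(2)[OF that] cos_half_pos[of k] unfolding c_def
    by (meson less_imp_le mult_left_mono order.trans)
  have "len k (Z E) < c * real n \<Longrightarrow> ?thesis" for n using assms
  proof (induction n arbitrary: E)
    case 0
    then show ?case using len_G_nonneg[of E k] by simp
  next
    case (Suc n)
    obtain K Q \<phi> where K: "E \<in> star {K} {Q}" "K \<in> G k" "Q \<in> G k" "\<not> zero_object D K" "\<phi> \<in> cell k"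
      "semistable k \<phi> K" "Z K \<in> ray \<phi>"
      and mx: "\<And>K' Q'. \<lbrakk>E \<in> star {K'} {Q'}; K' \<in> G k; Q' \<in> G k; \<not> zero_object D K'\<rbrakk> \<Longrightarrow>
       im_rot \<phi> (Z K') \<le> 0 \<and> (Z K' \<in> ray \<phi> \<longrightarrow> len k (Z K') \<le> len k (Z K))"
      using max_destabilizing[OF Suc.prems(2,3)] by blast
    have KP: "K \<in> refined \<phi>" using refined_cl[OF K(5)] K(6) by blast
    have "Q \<in> refined.HN (cell k \<inter> {..<\<phi>})"
    proof (cases "zero_object D Q")
      case True
      then show ?thesis using refined.HN_zero unfolding zeros_def by blast
    next
      case False
      have "len k (Z Q) < c * real n" using c[OF K(2,4)] Suc.prems(1) Z_add[OF K(1)] len_add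
        by (simp add: algebra_simps)
      then obtain \<phi>1 K1 Q1 where 1: "\<phi>1 \<in> cell k" "K1 \<in> refined \<phi>1" "\<not> zero_object D K1" "Q1 \<in>
        refined.HN (cell k \<inter> {..<\<phi>1})" "Q \<in> star {K1} {Q1}"
        using Suc.IH[OF _ K(3) False] by blast
      have ss1: "semistable k \<phi>1 K1" using refined_cl[OF 1(1)] 1(2) by blast
      then have K1: "K1 \<in> G k" "Z K1 \<in> ray \<phi>1" using 1(3) unfolding semistable_def by blast+
      have Q1: "Q1 \<in> G k" using 1(4) refined_HN_G[of "cell k \<inter> {..<\<phi>1}" k] by blast
      \<comment> \<open>\<open>E'\<close> is the preimage in \<open>E\<close> of the first factor
        \<open>K1\<close> of \<open>Q\<close>, and it competes with \<open>K\<close>. Maximality of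
        \<phi> gives \<phi>1 \<le> \<phi>; equality would put \<open>E'\<close> on the ray of phase
        \<phi> with a length exceeding that of \<open>K\<close>.\<close>
      have "E \<in> star {K} (star {K1} {Q1})" using K(1) 1(5) by (blast intro: star_singI)
      then have "E \<in> star (star {K} {K1}) {Q1}" by (simp add: star_assoc)
      then obtain E' where E': "E' \<in> star {K} {K1}" "E \<in> star {E'} {Q1}" by (auto elim: star_singE)
      have Eg: "E' \<in> G k" using G_ext[OF E'(1) K(2) K1(1)] .
      have lE: "len k (Z E') = len k (Z K) + len k (Z K1)" using Z_add[OF E'(1)] len_add by simp
      have "len k (Z K1) > 0" "len k (Z K) > 0" using c[OF K1(1) 1(3)] c[OF K(2,4)] c0 by auto
      then have lE2: "len k (Z K) < len k (Z E')" "0 < len k (Z E')" using lE by auto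
      have nz: "\<not> zero_object D E'" using Z_zero lE2(2) by (auto simp: len_def)
      note m2 = mx[OF E'(2) Eg Q1 nz]
      have "im_rot \<phi> (Z E') = im_rot \<phi> (Z K1)"
        using Z_add[OF E'(1)] im_rot_add im_rot_ray_eq[OF K(7)] by simp
      then have le: "\<phi>1 \<le> \<phi>" using m2 im_rot_cl(1)[OF K1(2) 1(1) K(5)] by simp
      have "\<phi>1 \<noteq> \<phi>"
      proof
        assume "\<phi>1 = \<phi>"
        then obtain r1 r2 where "r1 > 0" "r2 > 0" "Z K = of_real r1 * cis (pi * \<phi>)" "Z K1 = of_real
          r2 * cis (pi * \<phi>)"
          using K(7) K1(2) unfolding ray_def by blast
        then have "Z E' = of_real (r1 + r2) * cis (pi * \<phi>)" "r1 + r2 > 0" using Z_add[OF E'(1)]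
          by (auto simp: algebra_simps)
        then have "Z E' \<in> ray \<phi>" unfolding ray_def by blast
        then show False using m2 lE2 by simp
      qed
      then have lt: "\<phi>1 < \<phi>" using le by simp
      have "K1 \<in> refined.HN {\<phi>1}" using 1(2) refined.P_HN by blast
      then have "Q \<in> refined.HN ({\<phi>1} \<union> (cell k \<inter> {..<\<phi>1}))"
        by (rule refined.HN_merge[OF 1(5) _ 1(4)]) auto
      moreover have "{\<phi>1} \<union> (cell k \<inter> {..<\<phi>1}) \<subseteq> cell k \<inter> {..<\<phi>}" using 1(1) lt by auto
      ultimately show ?thesis using refined.HN_mono by blast
    qed
    then show ?case using K KP by blast
  qed
  moreover obtain n where "len k (Z E) < c * real n" using reals_Archimedean3[OF c0]
    by (metis mult.commute)
  ultimately show ?thesis by blast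
qed

lemma G_HN: "G k \<subseteq> refined.HN (cell k)"
proof
  fix E assume E: "E \<in> G k"
  show "E \<in> refined.HN (cell k)"
  proof (cases "zero_object D E")
    case True
    then show ?thesis using refined.HN_zero unfolding zeros_def by blast
  next
    case False
    then obtain \<phi> K Q where 1: "\<phi> \<in> cell k" "K \<in> refined \<phi>" "Q \<in> refined.HN (cell k \<inter> {..<\<phi>})" "E \<in>
      star {K} {Q}"
      using HN_first[OF E] by blast
    have "K \<in> refined.HN {\<phi>}" using 1 refined.P_HN by blast
    then have "E \<in> refined.HN ({\<phi>} \<union> (cell k \<inter> {..<\<phi>}))"
      by (rule refined.HN_merge[OF 1(4) _ 1(3)]) auto
    moreover have "{\<phi>} \<union> (cell k \<inter> {..<\<phi>}) \<subseteq> cell k" using 1(1) by auto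
    ultimately show ?thesis using refined.HN_mono by blast
  qed
qed

text \<open>The filtrations inside the sectors are concatenated, since sectors with larger index
  have larger phases.\<close>

sublocale refined: hn_slicing D "Ob D" refined 1
proof
  show "Ob D \<subseteq> refined.HN UNIV"
  proof
    fix E assume "E \<in> Ob D"
    then have "E \<in> HN UNIV" using HN_UNIV by blast
    then obtain L where L: "sorted_wrt (<) L" "E \<in> filt L" by (rule HNE)
    from L have "E \<in> refined.HN (\<Union>k\<in>set L. cell k)"
    proof (induction L arbitrary: E)
      case Nil
      then show ?case using refined.HN_zero by auto
    next
      case (Cons p L)
      then obtain X Y where XY: "X \<in> filt L" "Y \<in> G p" "E \<in> star {X} {Y}" by (auto elim: star_singE)
      have 1: "X \<in> refined.HN (\<Union>k\<in>set L. cell k)" using Cons XY by simp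
      have 2: "Y \<in> refined.HN (cell p)" using XY G_HN by blast
      have "E \<in> refined.HN ((\<Union>k\<in>set L. cell k) \<union> cell p)"
      proof (rule refined.HN_merge[OF XY(3) 1 2])
        fix a b assume "a \<in> (\<Union>k\<in>set L. cell k)" "b \<in> cell p"
        then obtain k where k: "k \<in> set L" "a \<in> cell k" by blast
        then have "p < k" using Cons.prems(1) by simp
        then have "p + 1 \<le> k" by simp
        then show "b < a" using x_mono_le k \<open>b \<in> cell p\<close> unfolding cell_def by fastforce
      qed
      then show ?case by (simp add: Un_commute)
    qed
    then show "E \<in> refined.HN UNIV" using refined.HN_mono by blast
  qed
qed

lemma refined_ray: assumes "E \<in> refined \<phi>" "\<not> zero_object D E" shows "Z E \<in> ray \<phi>"
  using assms unfolding refined_def semistable_def by blast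

end

section \<open>Slicings of triangulated subcategories\<close>

lemma full_sub_simps [simp]:
  "Ob (full_sub D S) = S" "Hom (full_sub D S) = Hom D" "ident (full_sub D S) = ident D"
  "cmp (full_sub D S) = cmp D" "hadd (full_sub D S) = hadd D" "hzero (full_sub D S) = hzero D"
  "sh_ob (full_sub D S) = sh_ob D" "sh_ar (full_sub D S) = sh_ar D"
  "Tri (full_sub D S) = {(X, Y, Z, f, g, h) \<in> Tri D. X \<in> S \<and> Y \<in> S \<and> Z \<in> S}"
  unfolding full_sub_def by simp_all

context triangulated
begin

lemma isomorphic_full_sub:
  assumes "S \<subseteq> Ob D" shows "isomorphic (full_sub D S) X Y \<longleftrightarrow> isomorphic D X Y \<and> X \<in> S \<and> Y \<in> S"
  using assms unfolding isomorphic_def iso_arrow_def by auto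

lemma zero_full_sub: assumes "triangulated_subcategory D S"
  shows "zero_object (full_sub D S) Z \<longleftrightarrow> zero_object D Z"
proof
  assume Z: "zero_object D Z"
  then show "zero_object (full_sub D S) Z"
    using tsub_zero[OF assms Z] tsub_Ob[OF assms] unfolding zero_object_def by auto
next
  assume "zero_object (full_sub D S) Z"
  then have Z: "Z \<in> S" "\<exists>!f. f \<in> Hom D Z Z" unfolding zero_object_def by auto
  have o: "Z \<in> Ob D" using tsub_Ob[OF assms Z(1)] .
  show "zero_object D Z" using Z(2) arr_ident[OF o] arr_zero[OF o o] o
    unfolding zero_object_iff arr_def by blast
qed

text \<open>Isomorphisms, zero objects and triangles of the full subcategory are traded for those of
  \<open>D\<close>, so that both given slicings can be handled in one category.\<close>

lemma hn_slicing_of_slicing: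
  fixes P :: "real \<Rightarrow> 'o set"
  assumes S: "triangulated_subcategory D S" and sl: "slicing (full_sub D S) P"
  shows "hn_slicing D S P 1"
proof -
  have So: "S \<subseteq> Ob D" using tsub_Ob[OF S] by blast
  note isoS = isomorphic_full_sub[OF So] and zS = zero_full_sub[OF S]
  have add: "additive_subcategory (full_sub D S) (P p)" for p using sl unfolding slicing_def
    by blast
  have PS: "P p \<subseteq> S" for p using add[of p] unfolding additive_subcategory_def by simp
  have Pz: "zeros \<subseteq> P p" for p using add[of p] unfolding additive_subcategory_def zS zeros_def
    by blast
  have Pi: "iso_closed (P p)" for p
    unfolding iso_closed_def
  proof (intro conjI ballI allI impI)
    show "P p \<subseteq> Ob D" using PS So by blast
    fix X Y assume a: "X \<in> P p" "isomorphic D X Y"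
    then have "X \<in> S" "Y \<in> S" using PS tsub_iso[OF S a(2)] by blast+
    have "\<forall>X\<in>P p. \<forall>Y\<in>S. isomorphic (full_sub D S) X Y \<longrightarrow> Y \<in> P p"
      using add[of p] unfolding additive_subcategory_def full_sub_simps by blast
    then show "Y \<in> P p" using a isoS \<open>X \<in> S\<close> \<open>Y \<in> S\<close> by blast
  qed
  interpret sliced_subcategory D S P 1
  proof
    show "triangulated_subcategory D S" by (rule S)
    show "P p \<subseteq> S" "iso_closed (P p)" "zeros \<subseteq> P p" for p by (rule PS Pi Pz)+
    show "P (p + 1) = shifts (P p)" for p
    proof -
      have "P (p + 1) = {E. \<exists>F\<in>P p. isomorphic (full_sub D S) (sh F) E}"
        using sl unfolding slicing_def full_sub_simps by blast
      also have "\<dots> = shifts (P p)"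
      proof -
        have "sh F \<in> S \<and> E \<in> S" if "F \<in> P p" "isomorphic D (sh F) E" for F E
          using that PS So tsub_sh[OF S] tsub_iso[OF S that(2)] by blast
        then show ?thesis unfolding shifts_def isoS by blast
      qed
      finally show ?thesis .
    qed
    show "Orth (P p) (P q)" if "q < p" for p q
      unfolding Orth_def
    proof (intro ballI)
      fix X Y assume "X \<in> P p" "Y \<in> P q"
      moreover have "\<forall>\<phi> \<psi>. \<psi> < \<phi> \<longrightarrow> (\<forall>X\<in>P \<phi>. \<forall>Y\<in>P \<psi>. Hom D X Y = {zo X Y})"
        using sl unfolding slicing_def full_sub_simps by blast
      ultimately show "orth X Y" using orth_Hom[of X Y] that PS So by blast
    qed
  qed simp
  show ?thesis
  proof
    show "S \<subseteq> HN UNIV"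
    proof
      fix E assume E: "E \<in> S"
      show "E \<in> HN UNIV"
      proof (cases "zero_object D E")
        case True
        then show ?thesis using HN_zero unfolding zeros_def by blast
      next
        case False
        have h: "\<forall>E\<in>S. \<not> zero_object D E \<longrightarrow> (\<exists>(n::nat) F A \<phi>. zero_object D (F 0) \<and> F n = E \<and>
           (\<forall>i<n. A i \<in> P (\<phi> i) \<and> (\<exists>f g h. (F i, F (Suc i), A i, f, g, h) \<in> Tri (full_sub D S))) \<and>
           (\<forall>i j. i < j \<and> j < n \<longrightarrow> \<phi> j < \<phi> i))"
          using sl unfolding slicing_def zS full_sub_simps(1) by (elim conjE)
        define R where "R n F A \<phi> \<longleftrightarrow> zero_object D (F 0) \<and> F n = E \<and>
           (\<forall>i<n. A i \<in> P (\<phi> i) \<and> (\<exists>f g h. (F i, F (Suc i), A i, f, g, h) \<in> Tri (full_sub D S))) \<and>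
           (\<forall>i j. i < j \<and> j < n \<longrightarrow> \<phi> j < \<phi> i)" for n :: nat and F A \<phi>
        have "\<exists>n F A \<phi>. R n F A \<phi>" using mp[OF bspec[OF h E] False] unfolding R_def .
        then obtain n F A \<phi> where "R n F A \<phi>" by blast
        note c = this[unfolded R_def]
        note 1 = c[THEN conjunct1] c[THEN conjunct2, THEN conjunct1] c[THEN conjunct2, THEN
          conjunct2, THEN conjunct1]
          c[THEN conjunct2, THEN conjunct2, THEN conjunct2]
        \<comment> \<open>The triangle on \<open>F i\<close>, \<open>F (Suc i)\<close>,
          \<open>A i\<close> puts its phase at the head of the list, so the decreasing phases appear
          reversed, hence increasing.\<close>
        have "i \<le> n \<Longrightarrow> F i \<in> filt (rev (map \<phi> [0..<i]))" for i
        proof (induction i)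
          case 0
          then show ?case using 1(1) by (simp add: zeros_def)
        next
          case (Suc i)
          then have i: "i < n" by simp
          then obtain f g h where t: "T (F i) (F (Suc i)) (A i) f g h" using 1(3) by auto
          have "F i \<in> filt (rev (map \<phi> [0..<i]))" using Suc by simp
          then have "F (Suc i) \<in> star (filt (rev (map \<phi> [0..<i]))) (P (\<phi> i))"
            using starI[OF t] 1(3) i by blast
          then show ?case by simp
        qed
        then have "E \<in> filt (rev (map \<phi> [0..<n]))" using 1(2) by blast
        moreover have "sorted_wrt (<) (rev (map \<phi> [0..<n]))"
          unfolding sorted_wrt_rev sorted_wrt_map using 1(4) by (simp add: sorted_wrt_iff_nth_less)
        ultimately show ?thesis using HNI by blast
      qed
    qed
  qed
qed

text \<open>The identity of \<open>W\<close> is the sum of two idempotents factoring through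
  \<open>X\<close> and \<open>Y\<close>, so an arrow vanishes once its components do.\<close>

lemma orth_biproduct: assumes "biproduct D X Y W" "X \<in> Ob D" "Y \<in> Ob D"
  shows "\<lbrakk>orth V X; orth V Y\<rbrakk> \<Longrightarrow> orth V W" "\<lbrakk>orth X V; orth Y V\<rbrakk> \<Longrightarrow> orth W V"
proof -
  obtain i j p q where a: "arr i X W" "arr j Y W" "arr p W X" "arr q W Y"
    "hadd D (i \<cdot> p) (j \<cdot> q) = ident D W" and W: "W \<in> Ob D"
    using assms unfolding biproduct_def arr_def by blast
  note ip = arr_cmp[OF a(3,1)] and jq = arr_cmp[OF a(4,2)]
  show "orth V W" if h: "orth V X" "orth V Y"
    unfolding orth_def
  proof (intro allI impI)
    fix t assume t: "arr t V W"
    have o: "V \<in> Ob D" using arr_Ob[OF t] by simp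
    have "t = hadd D (i \<cdot> p \<cdot> t) (j \<cdot> q \<cdot> t)" using cmp_add(2)[OF t ip jq] a(5) cmp_id[OF t] by simp
    also have "i \<cdot> p \<cdot> t = zo V W" using assoc[OF t a(3,1)] orthD[OF h(1) arr_cmp[OF t a(3)]]
      cmp_zero(1)[OF a(1) o] by simp
    also have "j \<cdot> q \<cdot> t = zo V W" using assoc[OF t a(4,2)] orthD[OF h(2) arr_cmp[OF t a(4)]]
      cmp_zero(1)[OF a(2) o] by simp
    also have "hadd D (zo V W) (zo V W) = zo V W" using add_zero arr_zero o W by blast
    finally show "t = zo V W" .
  qed
  show "orth W V" if h: "orth X V" "orth Y V"
    unfolding orth_def
  proof (intro allI impI)
    fix t assume t: "arr t W V"
    have o: "V \<in> Ob D" using arr_Ob[OF t] by simp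
    have "t = hadd D (t \<cdot> (i \<cdot> p)) (t \<cdot> (j \<cdot> q))" using cmp_add(1)[OF ip jq t] a(5) cmp_id[OF t]
      by simp
    also have "t \<cdot> (i \<cdot> p) = zo W V" using assoc[OF a(3,1) t] orthD[OF h(1) arr_cmp[OF a(1) t]]
      cmp_zero(2)[OF a(3) o] by simp
    also have "t \<cdot> (j \<cdot> q) = zo W V" using assoc[OF a(4,2) t] orthD[OF h(2) arr_cmp[OF a(2) t]]
      cmp_zero(2)[OF a(4) o] by simp
    also have "hadd D (zo W V) (zo W V) = zo W V" using add_zero arr_zero o W by blast
    finally show "t = zo W V" .
  qed
qed

end

lemma (in sliced_subcategory) HN_sequence:
  assumes "E \<in> filt L"
  shows "\<exists>F A. zero_object D (F 0) \<and> F (length L) = E \<and>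
    (\<forall>i<length L. A i \<in> P (rev L ! i) \<and> (\<exists>f g h. T (F i) (F (Suc i)) (A i) f g h))"
  using assms
proof (induction L arbitrary: E)
  case Nil
  then show ?case by (auto simp: zeros_def intro!: exI[of _ "\<lambda>_. E"])
next
  case (Cons p L)
  then obtain X Y f g h where t: "X \<in> filt L" "Y \<in> P p" "T X E Y f g h" by (auto elim: starE)
  obtain F A where F: "zero_object D (F 0)" "F (length L) = X"
    "\<forall>i<length L. A i \<in> P (rev L ! i) \<and> (\<exists>f g h. T (F i) (F (Suc i)) (A i) f g h)"
      using Cons.IH[OF t(1)] by blast
  define F' where "F' = F(Suc (length L) := E)"
  define A' where "A' = A(length L := Y)"
  have "A' i \<in> P (rev (p # L) ! i) \<and> (\<exists>f g h. T (F' i) (F' (Suc i)) (A' i) f g h)"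
    if "i < Suc (length L)" for i
  proof (cases "i = length L")
    case True
    then show ?thesis using t F unfolding F'_def A'_def by (auto simp: nth_append)
  next
    case False
    then have "i < length L" using that by simp
    then show ?thesis using F(3) unfolding F'_def A'_def by (auto simp: nth_append)
  qed
  moreover have "zero_object D (F' 0)" "F' (length (p # L)) = E" using F unfolding F'_def by auto
  ultimately show ?case by (intro exI[of _ F'] exI[of _ A']) simp
qed

text \<open>The axiom with content is closure under biproducts. A slice is cut out by orthogonality
  conditions, and these pass to biproducts by \<open>orth_biproduct\<close>.\<close>

lemma slicing_of_hn_slicing:
  fixes P :: "real \<Rightarrow> 'o set"
  assumes "hn_slicing D (Ob D) P 1"
  shows "slicing D P"
proof -
  interpret hn_slicing D "Ob D" P 1 by (rule assms)
  show ?thesis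
    unfolding slicing_def
  proof (intro conjI allI impI ballI)
    fix p
    show "additive_subcategory D (P p)"
      unfolding additive_subcategory_def
    proof (intro conjI allI impI ballI)
      show "P p \<subseteq> Ob D" by (rule P_sub)
      show "Y \<in> P p" if "X \<in> P p" "isomorphic D X Y" for X Y
        using iso_closedD[OF P_iso_closed that] .
      show "Z \<in> P p" if "zero_object D Z" for Z using that P_zero unfolding zeros_def by blast
      fix X Y W assume a: "X \<in> P p" "Y \<in> P p" "biproduct D X Y W"
      have W: "W \<in> HN UNIV" using a HN_UNIV unfolding biproduct_def by blast
      have o: "X \<in> Ob D" "Y \<in> Ob D" using a P_sub by blast+
      have eq: "at_or_above {p} = {p..}" "above {p} = {p<..}" unfolding above_def at_or_above_def
        by auto
      have c: "order_convex {p}" unfolding order_convex_def by auto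
      have u: "upset {p..}" "upset {p<..}" using upset_above[of "{p}"] unfolding eq by auto
      have XY: "X \<in> HN {p}" "Y \<in> HN {p}" using a HN_sing by blast+
      have "W \<in> HN {p..}" unfolding HN_up_iff[OF u(1) W]
      proof
        fix V assume V: "V \<in> HN (- {p..})"
        have "orth X V" "orth Y V" using orth_upset[OF u(1) XY(1) V] orth_upset[OF u(1) XY(2) V]
          by auto
        then show "orth W V" using orth_biproduct(2)[OF a(3) o] by blast
      qed
      moreover have "W \<in> HN (- {p<..})" unfolding HN_dn_iff[OF u(2) W]
      proof
        fix V assume V: "V \<in> HN {p<..}"
        have "orth V X" "orth V Y" using orth_upset[OF u(2) V XY(1)] orth_upset[OF u(2) V XY(2)]
          by auto
        then show "orth V W" using orth_biproduct(1)[OF a(3) o] by blast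
      qed
      ultimately have "W \<in> HN {p}" using HN_order_convex[OF c] unfolding eq by blast
      then show "W \<in> P p" unfolding HN_sing .
    qed
    show "P (p + 1) = {E. \<exists>F\<in>P p. isomorphic D (sh F) E}" using P_shift[of p] unfolding shifts_def .
  next
    fix p q X Y assume "q < p" "X \<in> P p" "Y \<in> P q"
    then have "orth X Y" "X \<in> Ob D" "Y \<in> Ob D" using P_orth[of q p] P_sub unfolding Orth_def
      by blast+
    then show "Hom D X Y = {zo X Y}" using orth_Hom by blast
  next
    fix E assume "E \<in> Ob D"
    then obtain L where L: "sorted_wrt (<) L" "E \<in> filt L" using HN_UNIV HNE by blast
    obtain F A where F: "zero_object D (F 0)" "F (length L) = E"
      "\<forall>i<length L. A i \<in> P (rev L ! i) \<and> (\<exists>f g h. T (F i) (F (Suc i)) (A i) f g h)"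
        using HN_sequence[OF L(2)] by blast
    have d: "\<forall>i j. i < j \<and> j < length L \<longrightarrow> rev L ! j < rev L ! i"
    proof (intro allI impI)
      fix i j assume ij: "i < j \<and> j < length L"
      then have "L ! (length L - Suc j) < L ! (length L - Suc i)"
        by (intro sorted_wrt_nth_less[OF L(1)]) auto
      then show "rev L ! j < rev L ! i" using ij by (simp add: rev_nth)
    qed
    then show "\<exists>(n::nat) F A \<phi>. zero_object D (F 0) \<and> F n = E \<and>
        (\<forall>i<n. A i \<in> P (\<phi> i) \<and> (\<exists>f g h. T (F i) (F (Suc i)) (A i) f g h)) \<and>
        (\<forall>i j. i < j \<and> j < n \<longrightarrow> \<phi> j < \<phi> i)"
      by (intro exI[of _ "length L"] exI[of _ F] exI[of _ A] exI[of _ "\<lambda>i. rev L ! i"] conjI F d)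
  qed
qed

section \<open>Local finiteness\<close>

text \<open>A bounded increasing sequence converges, so its increments eventually fall below
  \<open>c\<close> and must vanish.\<close>

lemma bounded_jumps_stop:
  fixes a :: "nat \<Rightarrow> real"
  assumes "c > 0" "\<And>n. a n \<le> M" "\<And>n. a (Suc n) = a n \<or> a n + c \<le> a (Suc n)"
  shows "\<exists>N. \<forall>n\<ge>N. a (Suc n) = a n"
proof -
  have "incseq a" using assms(1,3) by (intro incseq_SucI) (metis less_eq_real_def
    less_add_same_cancel1 order.trans)
  then obtain l where "a \<longlonglongrightarrow> l" using incseq_convergent[of a M] assms(2)
    by blast
  then have "(\<lambda>n. a (Suc n) - a n) \<longlonglongrightarrow> l - l"
    by (intro tendsto_diff LIMSEQ_Suc)
  then have "\<forall>\<^sub>F n in sequentially. a (Suc n) - a n < c" using assms(1)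
    by (intro order_tendstoD(2)[of _ "l - l"]) auto
  then obtain N where "\<forall>n\<ge>N. a (Suc n) - a n < c" unfolding eventually_sequentially by blast
  then show ?thesis using assms(3) by (metis add.commute less_diff_eq not_le diff_less_eq)
qed

text \<open>\<open>\<mu>\<close> keeps the charges of nonzero semistable objects away from zero;
  this discreteness makes chains of strict subobjects stop.\<close>

locale charged_slicing = hn_slicing D "Ob D" P "1 :: real"
  for D :: "('o, 'm) tricat" (structure) and P +
  fixes Z :: "'o \<Rightarrow> complex" and \<mu> :: real
  assumes Z_add: "E \<in> star {X} {Y} \<Longrightarrow> Z E = Z X + Z Y"
    and P_ray: "\<lbrakk>E \<in> P \<phi>; \<not> zero_object D E\<rbrakk> \<Longrightarrow> Z E \<in> ray \<phi>"
    and P_lower: "\<lbrakk>E \<in> P \<phi>; \<not> zero_object D E\<rbrakk> \<Longrightarrow> \<mu> \<le> cmod (Z E)"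
    and \<mu>_pos: "\<mu> > 0"
begin

lemma Z_zero: assumes "zero_object D N" shows "Z N = 0"
  using Z_add[OF star_sing_refl(1)[OF zero_Ob[OF assms] assms]] by simp

text \<open>The radius \<open>1/4\<close> will be the \<eta> of local finiteness: phases stay within
  \<open>pi/4\<close> of the axis, where the projection controls the modulus, and the window is
  short enough for \<open>kernel\<close>.\<close>

definition "I t = {t - 1/4<..<t + 1/4 :: real}"

lemma order_convex_I: "order_convex (I t)"
proof -
  have "t \<in> I t" unfolding I_def by simp
  then show ?thesis unfolding order_convex_def I_def by auto
qed

lemma len_lower: assumes "E \<in> HN (I t)" "\<not> zero_object D E"
  shows "cos (pi * (1/4)) * \<mu> \<le> re_rot t (Z E)"
proof -
  have c: "0 < cos (pi * (1/4)) * \<mu>" using cos_pos_half[of "1/4"] \<mu>_pos by simp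
  have "zero_object D E \<or> cos (pi * (1/4)) * \<mu> \<le> re_rot t (Z E)"
    using assms(1)
  proof (induction rule: HN_induct)
    case (step E X Y p)
    have Y: "zero_object D Y \<or> cos (pi * (1/4)) * \<mu> \<le> re_rot t (Z Y)"
    proof (cases "zero_object D Y")
      case False
      have "cos (pi * (1/4)) * cmod (Z Y) \<le> re_rot t (Z Y)"
        by (rule re_rot_ray[OF P_ray[OF step(3) False]]) (use step(4) in \<open>auto simp: I_def abs_if\<close>)
      moreover have "cos (pi * (1/4)) * \<mu> \<le> cos (pi * (1/4)) * cmod (Z Y)"
        using P_lower[OF step(3) False] cos_pos_half[of "1/4"] by (intro mult_left_mono) auto
      ultimately show ?thesis by simp
    qed simp
    have s: "re_rot t (Z E) = re_rot t (Z X) + re_rot t (Z Y)" using Z_add[OF step(1)] re_rot_add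
      by simp
    show ?case
    proof (cases "zero_object D X \<and> zero_object D Y")
      case True
      then show ?thesis using zero_iso[OF isomorphic_sym[OF star_sing_zero_left[OF step(1)]]]
        by blast
    next
      case False
      then show ?thesis using step(5) Y s c Z_zero by auto
    qed
  qed simp
  then show ?thesis using assms(2) by blast
qed

lemma len_nonneg: assumes "E \<in> HN (I t)" shows "0 \<le> re_rot t (Z E)"
proof (cases "zero_object D E")
  case False
  have "0 < cos (pi * (1/4)) * \<mu>" using cos_pos_half[of "1/4"] \<mu>_pos by simp
  then show ?thesis using len_lower[OF assms False] by simp
qed (simp add: Z_zero)

lemma I_shift_orth: assumes "X \<in> HN (I t)" "Y \<in> HN (I t)" shows "orth (sh X) Y"
proof -
  have "sh X \<in> HN ((\<lambda>x. x + 1) ` I t)"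
    using shifts_HN[of "I t"] assms(1) isomorphic_refl[OF sh_Ob[OF HN_Ob[OF assms(1)]]]
      unfolding shifts_def by blast
  then show ?thesis by (rule orth_HN[OF _ assms(2)]) (auto simp: I_def)
qed

text \<open>Kernels are unique up to isomorphism, so \<open>K\<close> is compared with the kernel
  \<open>L\<close> obtained by truncating the fibre of \<open>g\<close>. The latter comes with a
  triangle, which is transported to \<open>K\<close>.\<close>

lemma strict_sub_triangle:
  assumes "strict_subobject (full_sub D (HN (I t))) K m E"
  shows "\<exists>C\<in>HN (I t). \<exists>k k'. T K E C m k k'"
proof -
  let ?J = "I t"
  obtain F g where K: "K \<in> HN ?J" "E \<in> HN ?J" and m: "m \<in> Hom D K E" and F: "F \<in> HN ?J"
    and g: "g \<in> Hom D E F"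
    and gm: "g \<cdot> m = zo K F"
    and uni: "\<forall>W\<in>HN ?J. \<forall>t\<in>Hom D W E. g \<cdot> t = zo W F \<longrightarrow> (\<exists>!s. s \<in> Hom D W K \<and> m \<cdot> s = t)"
    using assms unfolding strict_subobject_def full_sub_simps by blast
  have o: "K \<in> Ob D" "E \<in> Ob D" "F \<in> Ob D" using K F HN_Ob by blast+
  have am: "arr m K E" and ag: "arr g E F" using m g o by (auto simp: arr_def)
  have uni': "\<exists>s. arr s W K \<and> m \<cdot> s = t'" "\<lbrakk>arr s W K; arr s' W K; m \<cdot> s = t'; m \<cdot> s' = t'\<rbrakk> \<Longrightarrow> s =
    s'"
    if "W \<in> HN ?J" "arr t' W E" "g \<cdot> t' = zo W F" for W t' s s'
    using uni that HN_Ob o unfolding arr_def by metis+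
  obtain V L V2 C i d p a b c c' u v v' where t: "T V E F i g d" "T L V V2 a b p" "T L E C (i \<cdot> a) c
    c'"
      "T V2 C F u v v'" "v \<cdot> c = g" "L \<in> HN ?J" "C \<in> HN ?J" "V2 \<in> HN (- at_or_above ?J)"
    by (rule kernel[OF order_convex_I _ K(2) F ag]) (auto simp: I_def)
  note ai = T_arr(1)[OF t(1)] and aa = T_arr(1)[OF t(2)] and ak = T_arr(1)[OF t(3)]
  have "g \<cdot> (i \<cdot> a) = zo L F"
    using assoc[OF aa ai ag] T_comp_zero[OF t(1)] cmp_zero(2)[OF aa o(3)] by simp
  then obtain s where s: "arr s L K" "m \<cdot> s = i \<cdot> a" using uni'(1)[OF t(6) ak] by blast
  obtain m' where m': "arr m' K V" "i \<cdot> m' = m" using T_lift[OF t(1) am gm] by blast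
  have ab: "arr b V V2" using T_arr(2)[OF t(2)] .
  \<comment> \<open>Hence the map from \<open>K\<close> to the fibre \<open>V\<close> already lands
    in \<open>L\<close>.\<close>
  have "orth K V2" by (rule orth_upset[OF upset_above(2) K(1) t(8)]) (auto simp: at_or_above_def)
  then have "b \<cdot> m' = zo K V2" using orthD arr_cmp[OF m'(1) ab] by blast
  then obtain r where r: "arr r K L" "a \<cdot> r = m'" using T_lift[OF t(2) m'(1)] by blast
  have kr: "i \<cdot> a \<cdot> r = m" using assoc[OF r(1) aa ai] r m' by simp
  have filt: "s \<cdot> r = ident D K"
  proof (rule uni'(2)[OF K(1) am gm])
    show "m \<cdot> (s \<cdot> r) = m" using assoc[OF r(1) s(1) am] s(2) kr by simp
    show "m \<cdot> ident D K = m" using cmp_id[OF am] by simp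
  qed (use arr_cmp[OF r(1) s(1)] arr_ident o in auto)
  have rs: "r \<cdot> s = ident D L"
  proof (rule mono_eq[OF t(3)])
    show "orth (sh L) C" using I_shift_orth t by blast
    show "i \<cdot> a \<cdot> (r \<cdot> s) = i \<cdot> a \<cdot> ident D L" using assoc[OF s(1) r(1) ak] kr s(2) cmp_id[OF ak]
      by simp
  qed (use arr_cmp[OF s(1) r(1)] arr_ident arr_Ob[OF s(1)] in auto)
  have si: "iso s L K" using isoI[OF s(1) r(1) rs filt] .
  have oC: "C \<in> Ob D" using HN_Ob t by blast
  note ac = T_arr(2,3)[OF t(3)]
  have "T K E C m c (sa s \<cdot> c')"
    apply (rule T_iso[OF t(3) si iso_ident[OF o(2)] iso_ident[OF oC] am ac(1) arr_cmp[OF ac(2)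
      arr_sh[OF s(1)]]])
    using s(2) cmp_id[OF ak] cmp_id[OF ac(1)] cmp_id[OF arr_cmp[OF ac(2) arr_sh[OF s(1)]]] by auto
  then show ?thesis using t by blast
qed

text \<open>\<open>W\<close> is the quotient of \<open>L\<close> by \<open>K\<close>. It lies in the
  window, being an extension of \<open>K[1]\<close> by \<open>L\<close> and, by the octahedron for
  \<open>K -> L -> E\<close>, of \<open>C\<close> by \<open>C'[-1]\<close>. So either
  \<open>W = 0\<close> and \<open>K -> L\<close> is an isomorphism, or the length grows by at least
  the constant of \<open>len_lower\<close>.\<close>

lemma strict_sub_le:
  assumes "strict_subobject (full_sub D (HN (I t))) K m E" "strict_subobject (full_sub D (HN (I t)))
    L l E"
    and le: "subobject_le (full_sub D (HN (I t))) K m L l"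
  shows "re_rot t (Z L) = re_rot t (Z K) \<or> re_rot t (Z K) + cos (pi * (1/4)) * \<mu> \<le> re_rot t (Z L)"
    and "re_rot t (Z L) = re_rot t (Z K) \<Longrightarrow> subobject_le (full_sub D (HN (I t))) L l K m"
    and "0 \<le> re_rot t (Z K)" "re_rot t (Z K) \<le> re_rot t (Z E)"
proof -
  let ?J = "I t"
  obtain C k k' where C: "C \<in> HN ?J" "T K E C m k k'" using strict_sub_triangle[OF assms(1)]
    by blast
  obtain C' q q' where C': "C' \<in> HN ?J" "T L E C' l q q'" using strict_sub_triangle[OF assms(2)]
    by blast
  have KL: "K \<in> HN ?J" "L \<in> HN ?J" using assms(1,2) unfolding strict_subobject_def by auto
  have o: "K \<in> Ob D" "L \<in> Ob D" using KL HN_Ob by blast+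
  obtain s where s: "arr s K L" "l \<cdot> s = m" using le o unfolding subobject_le_def arr_def by auto
  obtain W w w' where W: "T K L W s w w'" using TR1_cone[of K L s] s unfolding arr_def by blast
  obtain u u' where "T W C C' u u' (sa w \<cdot> q')" using TR4_octahedron[OF W C'(2)] C(2) s(2) by blast
  then have WC: "C \<in> star {W} {C'}" using starI by blast
  have LW: "L \<in> star {K} {W}" using starI[OF W] by blast
  have J: "HN ?J \<subseteq> HN (at_or_above ?J)" "HN ?J \<subseteq> HN (- above ?J)"
    using HN_order_convex[OF order_convex_I] by blast+
  have 1: "W \<in> HN (at_or_above ?J)"
    using HN_up_ext[OF upset_above(2) star_rot(1)[OF LW]] KL HN_sh_up[OF upset_above(2)] J by blast
  obtain Y where Y: "Y \<in> Ob D" "isomorphic D (sh Y) C'" using unsh_ex HN_Ob[OF C'(1)] by blast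
  have "sh Y \<in> HN ?J" using iso_closedD[OF HN_iso_closed C'(1) isomorphic_sym[OF Y(2)]] .
  then have "Y \<in> HN ((\<lambda>x. x - 1) ` ?J)" using HN_shift_iff[OF Y(1)] by blast
  moreover have "(\<lambda>x. x - 1) ` ?J \<subseteq> - above ?J"
  proof
    fix y assume "y \<in> (\<lambda>x. x - 1) ` ?J"
    then have "y < t" "t \<in> ?J" unfolding I_def by auto
    then show "y \<in> - above ?J" unfolding above_def by (auto intro!: bexI[of _ t])
  qed
  ultimately have "Y \<in> HN (- above ?J)" using HN_mono by blast
  then have 2: "W \<in> HN (- above ?J)" using HN_dn_ext[OF upset_above(1) star_fibre[OF WC Y(2,1)]]
    C(1) J by blast
  have WJ: "W \<in> HN ?J" using 1 2 HN_order_convex[OF order_convex_I] by blast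
  have e: "re_rot t (Z L) = re_rot t (Z K) + re_rot t (Z W)" using Z_add[OF LW] re_rot_add by simp
  show "re_rot t (Z L) = re_rot t (Z K) \<or> re_rot t (Z K) + cos (pi * (1/4)) * \<mu> \<le> re_rot t (Z L)"
    using e len_lower[OF WJ] Z_zero by (cases "zero_object D W") auto
  show "0 \<le> re_rot t (Z K)" using len_nonneg KL by blast
  have "re_rot t (Z E) = re_rot t (Z K) + re_rot t (Z C)"
    using Z_add[of E K C] starI[OF C(2)] re_rot_add by simp
  then show "re_rot t (Z K) \<le> re_rot t (Z E)" using len_nonneg[OF C(1)] by simp
  assume eq: "re_rot t (Z L) = re_rot t (Z K)"
  have "0 < cos (pi * (1/4)) * \<mu>" using cos_pos_half[of "1/4"] \<mu>_pos by simp
  then have "zero_object D W" using len_lower[OF WJ] e eq by auto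
  then obtain r where r: "arr r L K" "s \<cdot> r = ident D L" using T_zero3_iso[OF W] iso_def by blast
  have al: "arr l L E" using T_arr[OF C'(2)] by blast
  have "m \<cdot> r = l" using s assoc[OF r(1) s(1) al] r cmp_id[OF al] by simp
  then show "subobject_le (full_sub D (HN ?J)) L l K m" using r unfolding subobject_le_def arr_def
    by auto
qed

lemma finite_length_I: "finite_length (full_sub D (HN (I t)))"
  unfolding finite_length_def
proof (intro allI impI conjI)
  let ?Q = "full_sub D (HN (I t))"
  fix E and K :: "nat \<Rightarrow> 'o" and m
  assume st: "\<forall>n. strict_subobject ?Q (K n) (m n) E"
  have c: "0 < cos (pi * (1/4)) * \<mu>" using cos_pos_half[of "1/4"] \<mu>_pos by simp
  have bd: "0 \<le> re_rot t (Z (K n))" "re_rot t (Z (K n)) \<le> re_rot t (Z E)" for n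
  proof -
    have "K n \<in> HN (I t)" "E \<in> HN (I t)" "m n \<in> Hom D (K n) E"
      using st[rule_format, of n] unfolding strict_subobject_def by simp_all
    then have "arr (m n) (K n) E" using HN_Ob unfolding arr_def by blast
    \<comment> \<open>Comparing a subobject with itself gives access to the estimates of
      \<open>strict_sub_le\<close> that concern a single subobject.\<close>
    then have "subobject_le ?Q (K n) (m n) (K n) (m n)"
      using cmp_id(1) arr_ident[OF arr_Ob(1)] unfolding subobject_le_def full_sub_simps arr_def
        by blast
    then show "0 \<le> re_rot t (Z (K n))" "re_rot t (Z (K n)) \<le> re_rot t (Z E)"
      using strict_sub_le(3,4)[of t "K n" "m n" E "K n" "m n"] st by blast+
  qed
  show "\<exists>N. \<forall>n\<ge>N. subobject_le ?Q (K (Suc n)) (m (Suc n)) (K n) (m n)"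
    if le: "\<forall>n. subobject_le ?Q (K n) (m n) (K (Suc n)) (m (Suc n))"
  proof -
    have "\<exists>N. \<forall>n\<ge>N. re_rot t (Z (K (Suc n))) = re_rot t (Z (K n))"
      by (rule bounded_jumps_stop[OF c bd(2)]) (use strict_sub_le(1) st le in blast)
    then show ?thesis using strict_sub_le(2) st le by blast
  qed
  show "\<exists>N. \<forall>n\<ge>N. subobject_le ?Q (K n) (m n) (K (Suc n)) (m (Suc n))"
    if le: "\<forall>n. subobject_le ?Q (K (Suc n)) (m (Suc n)) (K n) (m n)"
  proof -
    \<comment> \<open>For a decreasing chain the negated lengths increase and are bounded by
      0.\<close>
    have "\<exists>N. \<forall>n\<ge>N. - re_rot t (Z (K (Suc n))) = - re_rot t (Z (K n))"
    proof (rule bounded_jumps_stop[OF c])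
      show "- re_rot t (Z (K n)) \<le> 0" for n using bd by simp
      show "- re_rot t (Z (K (Suc n))) = - re_rot t (Z (K n)) \<or>
         - re_rot t (Z (K n)) + cos (pi * (1 / 4)) * \<mu> \<le> - re_rot t (Z (K (Suc n)))" for n
        using strict_sub_le(1)[of t "K (Suc n)" "m (Suc n)" E "K n" "m n"] st le by fastforce
    qed
    then show ?thesis using strict_sub_le(2) st le by (metis minus_equation_iff)
  qed
qed

lemma locally_finite: "locally_finite D P"
proof -
  have "slice_interval D P {t - 1/4<..<t + 1/4} = HN (I t)" for t
    using slice_interval_HN[OF order_convex_I[of t]] unfolding slice_interval_def I_def by simp
  then show ?thesis unfolding locally_finite_def using finite_length_I
    by (intro exI[of _ "1/4"]) simp
qed

end

section \<open>Adjoints of the inclusions\<close>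

context triangulated
begin

text \<open>Universal arrows \<open>eta E\<close> from each object to \<open>S\<close> determine the
  left adjoint; the adjunction bijection is composition with \<open>eta\<close>.\<close>

lemma adjunctionI_left:
  assumes S: "S \<subseteq> Ob D" and a: "\<And>E. E \<in> Ob D \<Longrightarrow> a E \<in> S"
    and eta: "\<And>E. E \<in> Ob D \<Longrightarrow> arr (eta E) E (a E)"
    and ex: "\<And>E Y t. \<lbrakk>E \<in> Ob D; Y \<in> S; arr t E Y\<rbrakk> \<Longrightarrow> \<exists>s. arr s (a E) Y \<and> s \<cdot> eta E = t"
    and uni: "\<And>E Y s s'. \<lbrakk>E \<in> Ob D; Y \<in> S; arr s (a E) Y; arr s' (a E) Y; s \<cdot> eta E = s' \<cdot> eta E\<rbrakk> \<Longrightarrow>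
      s = s'"
  shows "\<exists>F. adjunction D (full_sub D S) F (id, id)"
proof -
  \<comment> \<open>A functor acts on arrows without mention of their ends;
    \<open>Hom_disjoint\<close> recovers these from the arrow.\<close>
  define Fa where "Fa f = (SOME c. \<exists>X Y. arr f X Y \<and> arr c (a X) (a Y) \<and> c \<cdot> eta X = eta Y \<cdot> f)"
    for f
  have Fa: "arr (Fa f) (a X) (a Y)" "Fa f \<cdot> eta X = eta Y \<cdot> f" if f: "arr f X Y" for f X Y
  proof -
    have o: "X \<in> Ob D" "Y \<in> Ob D" using f arr_Ob by auto
    have "\<exists>c. arr c (a X) (a Y) \<and> c \<cdot> eta X = eta Y \<cdot> f"
      using ex[OF o(1) a[OF o(2)] arr_cmp[OF f eta[OF o(2)]]] .
    then have "\<exists>c X Y. arr f X Y \<and> arr c (a X) (a Y) \<and> c \<cdot> eta X = eta Y \<cdot> f" using f by blast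
    from someI_ex[OF this] obtain X' Y' where *: "arr f X' Y'" "arr (Fa f) (a X') (a Y')" "Fa f \<cdot>
      eta X' = eta Y' \<cdot> f"
      unfolding Fa_def by blast
    have "X' = X \<and> Y' = Y" using Hom_disjoint f *(1) unfolding arr_def by blast
    then show "arr (Fa f) (a X) (a Y)" "Fa f \<cdot> eta X = eta Y \<cdot> f" using * by auto
  qed
  have fun1: "functor_between D (full_sub D S) (a, Fa)"
    unfolding functor_between_def full_sub_simps fst_conv snd_conv
  proof (intro conjI ballI)
    fix X assume X: "X \<in> Ob D"
    show "a X \<in> S" using a[OF X] .
    note i = arr_ident[OF X] and ia = arr_ident[OF subsetD[OF S a[OF X]]]
    have "Fa (ident D X) \<cdot> eta X = ident D (a X) \<cdot> eta X"
      using Fa(2)[OF i] cmp_id[OF eta[OF X]] by simp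
    then show "Fa (ident D X) = ident D (a X)" using uni[OF X a[OF X] Fa(1)[OF i] ia] by blast
  next
    fix X Y f assume "X \<in> Ob D" "Y \<in> Ob D" "f \<in> Hom D X Y"
    then show "Fa f \<in> Hom D (a X) (a Y)" using Fa(1)[of f X Y] unfolding arr_def by blast
  next
    fix X Y W f g assume o: "X \<in> Ob D" "Y \<in> Ob D" "W \<in> Ob D" and h: "f \<in> Hom D X Y" "g \<in> Hom D Y W"
    have f: "arr f X Y" and g: "arr g Y W" using o h unfolding arr_def by auto
    note gf = arr_cmp[OF f g]
    have "Fa g \<cdot> Fa f \<cdot> eta X = Fa g \<cdot> eta Y \<cdot> f"
      using assoc[OF eta[OF o(1)] Fa(1)[OF f] Fa(1)[OF g]] Fa(2)[OF f] assoc[OF f eta[OF o(2)]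
        Fa(1)[OF g]] by simp
    also have "\<dots> = eta W \<cdot> (g \<cdot> f)" using Fa(2)[OF g] assoc[OF f g eta[OF o(3)]] by simp
    also have "\<dots> = Fa (g \<cdot> f) \<cdot> eta X" using Fa(2)[OF gf] by simp
    finally show "Fa (g \<cdot> f) = Fa g \<cdot> Fa f"
      using uni[OF o(1) a[OF o(3)] Fa(1)[OF gf] arr_cmp[OF Fa(1)[OF f] Fa(1)[OF g]]] by simp
  qed
  have fun2: "functor_between (full_sub D S) D (id, id)"
    using S unfolding functor_between_def by auto
  have "adjunction D (full_sub D S) (a, Fa) (id, id)"
    unfolding adjunction_def
  proof (intro conjI fun1 fun2 exI[of _ "\<lambda>X Y h. h \<cdot> eta X"] ballI)
    fix X Y assume o: "X \<in> Ob D" "Y \<in> Ob (full_sub D S)"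
    then have Y: "Y \<in> S" "Y \<in> Ob D" using S by auto
    note aX = subsetD[OF S a[OF o(1)]]
    have "bij_betw (\<lambda>h. h \<cdot> eta X) (Hom D (a X) Y) (Hom D X Y)"
    proof (rule bij_betw_imageI)
      show "inj_on (\<lambda>h. h \<cdot> eta X) (Hom D (a X) Y)"
        using uni[OF o(1) Y(1)] aX Y(2) unfolding inj_on_def arr_def by blast
      show "(\<lambda>h. h \<cdot> eta X) ` Hom D (a X) Y = Hom D X Y"
      proof (intro equalityI subsetI)
        fix t assume "t \<in> (\<lambda>h. h \<cdot> eta X) ` Hom D (a X) Y"
        then show "t \<in> Hom D X Y" using arr_cmp[OF eta[OF o(1)], of _ Y] aX Y(2) unfolding arr_def
          by blast
      next
        fix t assume "t \<in> Hom D X Y"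
        then obtain s where "arr s (a X) Y" "s \<cdot> eta X = t" using ex[OF o(1) Y(1)] o Y
          unfolding arr_def by blast
        then show "t \<in> (\<lambda>h. h \<cdot> eta X) ` Hom D (a X) Y" unfolding arr_def by blast
      qed
    qed
    then show "bij_betw (\<lambda>h. h \<cdot> eta X) (Hom (full_sub D S) (fst (a, Fa) X) Y) (Hom D X (fst (id,
      id) Y))" by simp
  next
    fix X X' Y Y' f b h
    assume "X \<in> Ob D" "X' \<in> Ob D" "Y \<in> Ob (full_sub D S)" "Y' \<in> Ob (full_sub D S)" "f \<in> Hom D X' X"
      "b \<in> Hom (full_sub D S) Y Y'" "h \<in> Hom (full_sub D S) (fst (a, Fa) X) Y"
    then have f: "arr f X' X" and b: "arr b Y Y'" and h: "arr h (a X) Y" using S a unfolding arr_def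
      by auto
    have o: "X \<in> Ob D" "X' \<in> Ob D" using f arr_Ob by auto
    note bh = arr_cmp[OF h b]
    have "b \<cdot> h \<cdot> Fa f \<cdot> eta X' = b \<cdot> h \<cdot> (eta X \<cdot> f)"
      using assoc[OF eta[OF o(2)] Fa(1)[OF f] bh] Fa(2)[OF f] by simp
    also have "\<dots> = b \<cdot> h \<cdot> eta X \<cdot> f" using assoc[OF f eta[OF o(1)] bh] by simp
    also have "b \<cdot> h \<cdot> eta X = b \<cdot> (h \<cdot> eta X)" using assoc[OF eta[OF o(1)] h b] .
    finally show "b \<cdot>\<^bsub>full_sub D S\<^esub> h \<cdot>\<^bsub>full_sub D S\<^esub> snd (a, Fa) f \<cdot> eta X' = snd (id, id) b \<cdot> (h \<cdot>
      eta X) \<cdot> f" by simp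
  qed
  then show ?thesis by blast
qed

text \<open>Dual to \<open>adjunctionI_left\<close>, except that composition with \<open>eps\<close>
  runs against the direction in which the bijection is required, so its inverse \<open>Phi\<close>
  is used.\<close>

lemma adjunctionI_right:
  assumes S: "S \<subseteq> Ob D" and a: "\<And>E. E \<in> Ob D \<Longrightarrow> a E \<in> S"
    and eps: "\<And>E. E \<in> Ob D \<Longrightarrow> arr (eps E) (a E) E"
    and ex: "\<And>E Y t. \<lbrakk>E \<in> Ob D; Y \<in> S; arr t Y E\<rbrakk> \<Longrightarrow> \<exists>s. arr s Y (a E) \<and> eps E \<cdot> s = t"
    and uni: "\<And>E Y s s'. \<lbrakk>E \<in> Ob D; Y \<in> S; arr s Y (a E); arr s' Y (a E); eps E \<cdot> s = eps E \<cdot> s'\<rbrakk> \<Longrightarrow>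
      s = s'"
  shows "\<exists>F. adjunction (full_sub D S) D (id, id) F"
proof -
  define Fa where "Fa f = (SOME c. \<exists>X Y. arr f X Y \<and> arr c (a X) (a Y) \<and> eps Y \<cdot> c = f \<cdot> eps X)"
    for f
  have Fa: "arr (Fa f) (a X) (a Y)" "eps Y \<cdot> Fa f = f \<cdot> eps X" if f: "arr f X Y" for f X Y
  proof -
    have o: "X \<in> Ob D" "Y \<in> Ob D" using f arr_Ob by auto
    have "\<exists>c. arr c (a X) (a Y) \<and> eps Y \<cdot> c = f \<cdot> eps X"
      using ex[OF o(2) a[OF o(1)] arr_cmp[OF eps[OF o(1)] f]] .
    then have "\<exists>c X Y. arr f X Y \<and> arr c (a X) (a Y) \<and> eps Y \<cdot> c = f \<cdot> eps X" using f by blast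
    from someI_ex[OF this] obtain X' Y' where *: "arr f X' Y'" "arr (Fa f) (a X') (a Y')" "eps Y' \<cdot>
      Fa f = f \<cdot> eps X'"
      unfolding Fa_def by blast
    have "X' = X \<and> Y' = Y" using Hom_disjoint f *(1) unfolding arr_def by blast
    then show "arr (Fa f) (a X) (a Y)" "eps Y \<cdot> Fa f = f \<cdot> eps X" using * by auto
  qed
  have fun1: "functor_between D (full_sub D S) (a, Fa)"
    unfolding functor_between_def full_sub_simps fst_conv snd_conv
  proof (intro conjI ballI)
    fix X assume X: "X \<in> Ob D"
    show "a X \<in> S" using a[OF X] .
    note i = arr_ident[OF X] and ia = arr_ident[OF subsetD[OF S a[OF X]]]
    have "eps X \<cdot> Fa (ident D X) = eps X \<cdot> ident D (a X)"
      using Fa(2)[OF i] cmp_id[OF eps[OF X]] by simp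
    then show "Fa (ident D X) = ident D (a X)" using uni[OF X a[OF X] Fa(1)[OF i] ia] by blast
  next
    fix X Y f assume "X \<in> Ob D" "Y \<in> Ob D" "f \<in> Hom D X Y"
    then show "Fa f \<in> Hom D (a X) (a Y)" using Fa(1)[of f X Y] unfolding arr_def by blast
  next
    fix X Y W f g assume o: "X \<in> Ob D" "Y \<in> Ob D" "W \<in> Ob D" and h: "f \<in> Hom D X Y" "g \<in> Hom D Y W"
    have f: "arr f X Y" and g: "arr g Y W" using o h unfolding arr_def by auto
    note gf = arr_cmp[OF f g]
    have "eps W \<cdot> (Fa g \<cdot> Fa f) = g \<cdot> (eps Y \<cdot> Fa f)"
      using assoc[OF Fa(1)[OF f] Fa(1)[OF g] eps[OF o(3)]] Fa(2)[OF g] assoc[OF Fa(1)[OF f] eps[OF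
        o(2)] g] by simp
    also have "\<dots> = g \<cdot> f \<cdot> eps X" using Fa(2)[OF f] assoc[OF eps[OF o(1)] f g] by simp
    also have "\<dots> = eps W \<cdot> Fa (g \<cdot> f)" using Fa(2)[OF gf] by simp
    finally show "Fa (g \<cdot> f) = Fa g \<cdot> Fa f"
      using uni[OF o(3) a[OF o(1)] Fa(1)[OF gf] arr_cmp[OF Fa(1)[OF f] Fa(1)[OF g]]] by simp
  qed
  have fun2: "functor_between (full_sub D S) D (id, id)"
    using S unfolding functor_between_def by auto
  define Phi where "Phi X Y h = (THE s. arr s X (a Y) \<and> eps Y \<cdot> s = h)" for X Y h
  have Phi: "arr (Phi X Y h) X (a Y)" "eps Y \<cdot> Phi X Y h = h" if "X \<in> S" "Y \<in> Ob D" "arr h X Y"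
    for X Y h
  proof -
    have "\<exists>!s. arr s X (a Y) \<and> eps Y \<cdot> s = h" using ex[OF that(2,1,3)] uni[OF that(2,1)] by blast
    from theI'[OF this] show "arr (Phi X Y h) X (a Y)" "eps Y \<cdot> Phi X Y h = h" unfolding Phi_def
      by auto
  qed
  have "adjunction (full_sub D S) D (id, id) (a, Fa)"
    unfolding adjunction_def
  proof (intro conjI fun1 fun2 exI[of _ Phi] ballI)
    fix X Y assume o: "X \<in> Ob (full_sub D S)" "Y \<in> Ob D"
    then have X: "X \<in> S" "X \<in> Ob D" using S by auto
    have "bij_betw (Phi X Y) (Hom D X Y) (Hom D X (a Y))"
    proof (rule bij_betw_imageI)
      show "inj_on (Phi X Y) (Hom D X Y)"
      proof (rule inj_onI)
        fix h h' assume "h \<in> Hom D X Y" "h' \<in> Hom D X Y" "Phi X Y h = Phi X Y h'"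
        then show "h = h'" using Phi(2)[OF X(1) o(2)] X o(2) unfolding arr_def by metis
      qed
      show "Phi X Y ` Hom D X Y = Hom D X (a Y)"
      proof (intro equalityI subsetI)
        fix t assume "t \<in> Phi X Y ` Hom D X Y"
        then show "t \<in> Hom D X (a Y)" using Phi(1)[OF X(1) o(2)] X o(2) unfolding arr_def by blast
      next
        fix t assume "t \<in> Hom D X (a Y)"
        then have t: "arr t X (a Y)" using X a[OF o(2)] S unfolding arr_def by blast
        note et = arr_cmp[OF t eps[OF o(2)]]
        have "Phi X Y (eps Y \<cdot> t) = t" using uni[OF o(2) X(1) Phi(1)[OF X(1) o(2) et] t] Phi(2)[OF
          X(1) o(2) et] by blast
        then show "t \<in> Phi X Y ` Hom D X Y" using et unfolding arr_def by (metis imageI)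
      qed
    qed
    then show "bij_betw (Phi X Y) (Hom D (fst (id, id) X) Y) (Hom (full_sub D S) X (fst (a, Fa) Y))"
      by simp
  next
    fix X X' Y Y' f b h
    assume as: "X \<in> Ob (full_sub D S)" "X' \<in> Ob (full_sub D S)" "Y \<in> Ob D" "Y' \<in> Ob D" "f \<in> Hom
      (full_sub D S) X' X"
      "b \<in> Hom D Y Y'" "h \<in> Hom D (fst (id, id) X) Y"
    then have f: "arr f X' X" and b: "arr b Y Y'" and h: "arr h X Y" and X: "X \<in> S" "X' \<in> S"
      using S unfolding arr_def by auto
    note o = as(3,4)
    note P = Phi[OF X(1) o(1) h]
    note bhf = arr_cmp[OF f arr_cmp[OF h b]]
    note l = arr_cmp[OF f arr_cmp[OF P(1) Fa(1)[OF b]]]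
    have "eps Y' \<cdot> (Fa b \<cdot> Phi X Y h \<cdot> f) = eps Y' \<cdot> (Fa b \<cdot> Phi X Y h) \<cdot> f"
      using assoc[OF f arr_cmp[OF P(1) Fa(1)[OF b]] eps[OF o(2)]] by simp
    also have "eps Y' \<cdot> (Fa b \<cdot> Phi X Y h) = b \<cdot> (eps Y \<cdot> Phi X Y h)"
      using assoc[OF P(1) Fa(1)[OF b] eps[OF o(2)]] Fa(2)[OF b] assoc[OF P(1) eps[OF o(1)] b]
        by simp
    also have "\<dots> = b \<cdot> h" using P by simp
    finally have "Phi X' Y' (b \<cdot> h \<cdot> f) = Fa b \<cdot> Phi X Y h \<cdot> f"
      using uni[OF o(2) X(2) Phi(1)[OF X(2) o(2) bhf] l] Phi(2)[OF X(2) o(2) bhf] by simp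
    then show "Phi X' Y' (b \<cdot> h \<cdot> snd (id, id) f) = snd (a, Fa) b \<cdot>\<^bsub>full_sub D S\<^esub> Phi X Y h
      \<cdot>\<^bsub>full_sub D S\<^esub> f" by simp
  qed
  then show ?thesis by blast
qed

text \<open>The adjoint is an arbitrary choice. By naturality its unit \<open>\<theta>\<close> has
  the same universal property as \<open>eta E\<close>, which makes the two targets
  isomorphic.\<close>

lemma incl_left_adj_iso:
  assumes S: "S \<subseteq> Ob D" and a: "\<And>E. E \<in> Ob D \<Longrightarrow> a E \<in> S"
    and eta: "\<And>E. E \<in> Ob D \<Longrightarrow> arr (eta E) E (a E)"
    and ex: "\<And>E Y t. \<lbrakk>E \<in> Ob D; Y \<in> S; arr t E Y\<rbrakk> \<Longrightarrow> \<exists>s. arr s (a E) Y \<and> s \<cdot> eta E = t"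
    and uni: "\<And>E Y s s'. \<lbrakk>E \<in> Ob D; Y \<in> S; arr s (a E) Y; arr s' (a E) Y; s \<cdot> eta E = s' \<cdot> eta E\<rbrakk> \<Longrightarrow>
      s = s'"
    and E: "E \<in> Ob D"
  shows "isomorphic D (a E) (incl_left_adj D S E)" "incl_left_adj D S E \<in> S"
proof -
  define F where "F = (SOME F. adjunction D (full_sub D S) F (id, id))"
  have "adjunction D (full_sub D S) F (id, id)"
    unfolding F_def
    by (rule someI_ex, rule adjunctionI_left[where a = a
      and eta = eta, OF S]; (rule a eta ex uni; assumption))
  then obtain \<Phi> where f: "functor_between D (full_sub D S) F"
    and bij: "\<forall>X\<in>Ob D. \<forall>Y\<in>S. bij_betw (\<Phi> X Y) (Hom D (fst F X) Y) (Hom D X Y)"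
    and nat: "\<forall>X \<in> Ob D. \<forall>X' \<in> Ob D. \<forall>Y \<in> S. \<forall>Y' \<in> S. \<forall>a \<in> Hom D X' X. \<forall>b \<in> Hom D Y Y'. \<forall>h \<in> Hom D
      (fst F X) Y.
             \<Phi> X' Y' (b \<cdot> h \<cdot> snd F a) = b \<cdot> \<Phi> X Y h \<cdot> a"
    unfolding adjunction_def full_sub_simps fst_conv snd_conv id_apply by blast
  let ?F = "fst F E"
  have FE: "?F \<in> S" using f E unfolding functor_between_def by auto
  then show "incl_left_adj D S E \<in> S" unfolding incl_left_adj_def F_def .
  have o: "?F \<in> Ob D" "a E \<in> Ob D" using FE a[OF E] S by blast+
  have aF: "arr (snd F (ident D E)) ?F ?F" "snd F (ident D E) = ident D ?F"
    using f E arr_ident[OF o(1)] unfolding functor_between_def by auto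
  define \<theta> where "\<theta> = \<Phi> E ?F (ident D ?F)"
  have \<theta>: "arr \<theta> E ?F" using bij E FE arr_ident[OF o(1)] unfolding \<theta>_def bij_betw_def arr_def
    by blast
  have Phi: "\<Phi> E Y h = h \<cdot> \<theta>" if "Y \<in> S" "arr h ?F Y" for Y h
  proof -
    have "\<Phi> E Y (h \<cdot> ident D ?F \<cdot> snd F (ident D E)) = h \<cdot> \<Phi> E ?F (ident D ?F) \<cdot> ident D E"
      using nat[rule_format, OF E E FE that(1), of "ident D E" h "ident D ?F"] that arr_ident[OF
        o(1)] arr_ident[OF E]
      unfolding arr_def by blast
    then show ?thesis using aF(2) cmp_id[OF that(2)] cmp_id[OF arr_cmp[OF \<theta> that(2)]]
      unfolding \<theta>_def by simp
  qed
  have exF: "\<exists>s. arr s ?F Y \<and> s \<cdot> \<theta> = t" if "Y \<in> S" "arr t E Y" for Y t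
  proof -
    have "\<Phi> E Y ` Hom D ?F Y = Hom D E Y" using bij E that(1) unfolding bij_betw_def by blast
    then have "t \<in> \<Phi> E Y ` Hom D ?F Y" using that(2) unfolding arr_def by simp
    then obtain s where s: "t = \<Phi> E Y s" "s \<in> Hom D ?F Y" by (rule imageE)
    have as: "arr s ?F Y" using s(2) o(1) subsetD[OF S that(1)] unfolding arr_def by simp
    then show ?thesis using Phi[OF that(1) as] s(1) by (intro exI[of _ s]) simp
  qed
  have uniF: "s = s'" if "Y \<in> S" "arr s ?F Y" "arr s' ?F Y" "s \<cdot> \<theta> = s' \<cdot> \<theta>" for Y s s'
  proof -
    have "\<Phi> E Y s = \<Phi> E Y s'" using Phi[OF that(1,2)] Phi[OF that(1,3)] that(4) by simp
    moreover have "inj_on (\<Phi> E Y) (Hom D ?F Y)" using bij E that(1) unfolding bij_betw_def by blast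
    ultimately show ?thesis using that(2,3) inj_onD unfolding arr_def by metis
  qed
  obtain s where s: "arr s (a E) ?F" "s \<cdot> eta E = \<theta>" using ex[OF E FE \<theta>] by blast
  obtain r where r: "arr r ?F (a E)" "r \<cdot> \<theta> = eta E" using exF[OF a[OF E] eta[OF E]] by blast
  have "r \<cdot> s \<cdot> eta E = ident D (a E) \<cdot> eta E"
    using assoc[OF eta[OF E] s(1) r(1)] s r cmp_id[OF eta[OF E]] by simp
  then have 1: "r \<cdot> s = ident D (a E)" using uni[OF E a[OF E] arr_cmp[OF s(1) r(1)] arr_ident[OF
    o(2)]] by blast
  have "s \<cdot> r \<cdot> \<theta> = ident D ?F \<cdot> \<theta>" using assoc[OF \<theta> r(1) s(1)] s r cmp_id[OF \<theta>] by simp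
  then have 2: "s \<cdot> r = ident D ?F" using uniF[OF FE arr_cmp[OF r(1) s(1)] arr_ident[OF o(1)]]
    by blast
  show "isomorphic D (a E) (incl_left_adj D S E)"
    using isoI[OF s(1) r(1) 1 2] unfolding isomorphic_iso incl_left_adj_def F_def by blast
qed

lemma incl_right_adj_iso:
  assumes S: "S \<subseteq> Ob D" and a: "\<And>E. E \<in> Ob D \<Longrightarrow> a E \<in> S"
    and eps: "\<And>E. E \<in> Ob D \<Longrightarrow> arr (eps E) (a E) E"
    and ex: "\<And>E Y t. \<lbrakk>E \<in> Ob D; Y \<in> S; arr t Y E\<rbrakk> \<Longrightarrow> \<exists>s. arr s Y (a E) \<and> eps E \<cdot> s = t"
    and uni: "\<And>E Y s s'. \<lbrakk>E \<in> Ob D; Y \<in> S; arr s Y (a E); arr s' Y (a E); eps E \<cdot> s = eps E \<cdot> s'\<rbrakk> \<Longrightarrow>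
      s = s'"
    and E: "E \<in> Ob D"
  shows "isomorphic D (a E) (incl_right_adj D S E)" "incl_right_adj D S E \<in> S"
proof -
  define F where "F = (SOME F. adjunction (full_sub D S) D (id, id) F)"
  have "adjunction (full_sub D S) D (id, id) F"
    unfolding F_def
    by (rule someI_ex, rule adjunctionI_right[where a = a
      and eps = eps, OF S]; (rule a eps ex uni; assumption))
  then obtain \<Phi> where f: "functor_between D (full_sub D S) F"
    and bij: "\<forall>X\<in>S. \<forall>Y\<in>Ob D. bij_betw (\<Phi> X Y) (Hom D X Y) (Hom D X (fst F Y))"
    and nat: "\<forall>X \<in> S. \<forall>X' \<in> S. \<forall>Y \<in> Ob D. \<forall>Y' \<in> Ob D. \<forall>a \<in> Hom D X' X. \<forall>b \<in> Hom D Y Y'. \<forall>h \<in> Hom D X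
      Y.
             \<Phi> X' Y' (b \<cdot> h \<cdot> a) = snd F b \<cdot> \<Phi> X Y h \<cdot> a"
    unfolding adjunction_def full_sub_simps fst_conv snd_conv id_apply by blast
  let ?F = "fst F E"
  have FE: "?F \<in> S" using f E unfolding functor_between_def by auto
  then show "incl_right_adj D S E \<in> S" unfolding incl_right_adj_def F_def .
  have o: "?F \<in> Ob D" "a E \<in> Ob D" using FE a[OF E] S by blast+
  have aF: "snd F (ident D E) = ident D ?F"
    using f E unfolding functor_between_def by auto
  \<comment> \<open>The counit appears as a preimage of the identity, since \<open>\<Phi>\<close>
    leads from arrows to \<open>E\<close> to arrows into the subcategory.\<close>
  have "ident D ?F \<in> \<Phi> ?F E ` Hom D ?F E"
    using bij E FE arr_ident[OF o(1)] unfolding bij_betw_def arr_def by blast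
  then obtain \<theta> where t: "ident D ?F = \<Phi> ?F E \<theta>" "\<theta> \<in> Hom D ?F E" by (rule imageE)
  then have \<theta>: "arr \<theta> ?F E" "\<Phi> ?F E \<theta> = ident D ?F" using o E unfolding arr_def by simp_all
  have Phi: "\<Phi> Y E (\<theta> \<cdot> s) = s" if "Y \<in> S" "arr s Y ?F" for Y s
  proof -
    have "\<Phi> Y E (ident D E \<cdot> \<theta> \<cdot> s) = snd F (ident D E) \<cdot> \<Phi> ?F E \<theta> \<cdot> s"
      using nat[rule_format, OF FE that(1) E E, of s "ident D E" \<theta>] that \<theta> arr_ident[OF E]
        unfolding arr_def by blast
    then show ?thesis using aF \<theta> cmp_id[OF \<theta>(1)] cmp_id[OF that(2)] cmp_id[OF arr_ident[OF o(1)]]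
      by simp
  qed
  have exF: "\<exists>s. arr s Y ?F \<and> \<theta> \<cdot> s = t" if Y: "Y \<in> S" "arr t Y E" for Y t
  proof -
    define s where "s = \<Phi> Y E t"
    have b: "bij_betw (\<Phi> Y E) (Hom D Y E) (Hom D Y ?F)" using bij E Y by blast
    have s: "arr s Y ?F" using bij_betwE[OF b] Y(2) o(1) unfolding s_def arr_def by blast
    have "\<Phi> Y E (\<theta> \<cdot> s) = \<Phi> Y E t" using Phi[OF Y(1) s] s_def by simp
    then have "\<theta> \<cdot> s = t" using inj_onD[OF bij_betw_imp_inj_on[OF b]] Y(2) arr_cmp[OF s \<theta>(1)]
      unfolding arr_def by blast
    then show ?thesis using s by blast
  qed
  have uniF: "s = s'" if "Y \<in> S" "arr s Y ?F" "arr s' Y ?F" "\<theta> \<cdot> s = \<theta> \<cdot> s'" for Y s s'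
  proof -
    have "s = \<Phi> Y E (\<theta> \<cdot> s')" using Phi[OF that(1,2)] unfolding that(4) by (rule sym)
    also have "\<dots> = s'" by (rule Phi[OF that(1,3)])
    finally show ?thesis .
  qed
  obtain s where s: "arr s ?F (a E)" "eps E \<cdot> s = \<theta>" using ex[OF E FE \<theta>(1)] by blast
  obtain r where r: "arr r (a E) ?F" "\<theta> \<cdot> r = eps E" using exF[OF a[OF E] eps[OF E]] by blast
  have "eps E \<cdot> (s \<cdot> r) = eps E \<cdot> ident D (a E)"
    using assoc[OF r(1) s(1) eps[OF E]] s r cmp_id[OF eps[OF E]] by simp
  then have 1: "s \<cdot> r = ident D (a E)" using uni[OF E a[OF E] arr_cmp[OF r(1) s(1)] arr_ident[OF
    o(2)]] by blast
  have "\<theta> \<cdot> (r \<cdot> s) = \<theta> \<cdot> ident D ?F" using assoc[OF s(1) r(1) \<theta>(1)] s r cmp_id[OF \<theta>(1)] by simp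
  then have 2: "r \<cdot> s = ident D ?F" using uniF[OF FE arr_cmp[OF s(1) r(1)] arr_ident[OF o(1)]]
    by blast
  show "isomorphic D (a E) (incl_right_adj D S E)"
    using isoI[OF r(1) s(1) 1 2] unfolding isomorphic_iso incl_right_adj_def F_def by blast
qed

end

section \<open>Adjoints of a semiorthogonal decomposition\<close>

locale semiorthogonal = triangulated D for D :: "('o, 'm) tricat" (structure) +
  fixes \<A> \<B> :: "'o set"
  assumes sod: "semiorthogonal_decomposition D \<A> \<B>"
begin

lemma tsA: "triangulated_subcategory D \<A>" and tsB: "triangulated_subcategory D \<B>"
  using sod unfolding semiorthogonal_decomposition_def by auto

lemma Orth_BA: "Orth \<B> \<A>"
  using sod orth_Hom tsub_Ob[OF tsA] tsub_Ob[OF tsB]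
    unfolding semiorthogonal_decomposition_def Orth_def by blast

lemma orth_BA: "\<lbrakk>b \<in> \<B>; a \<in> \<A>\<rbrakk> \<Longrightarrow> orth b a"
  using Orth_BA unfolding Orth_def by blast

lemma Ob_star: "Ob D \<subseteq> star \<B> \<A>"
  using sod unfolding semiorthogonal_decomposition_def star_def by blast

lemma B_sh: "b \<in> \<B> \<Longrightarrow> sh b \<in> \<B>" and A_sh: "a \<in> \<A> \<Longrightarrow> sh a \<in> \<A>"
  using tsub_sh[OF tsB] tsub_Ob[OF tsB] tsub_sh[OF tsA] tsub_Ob[OF tsA] by blast+

text \<open>There are no nonzero arrows to \<open>Y\<close> from \<open>b\<close> or from
  \<open>b[1]\<close>: the former gives the factorisation, the latter its uniqueness.\<close>

lemma triangle_left_universal: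
  assumes "T b E a f g h" "b \<in> \<B>" "a \<in> \<A>" "Y \<in> \<A>"
  shows "arr t E Y \<Longrightarrow> \<exists>s. arr s a Y \<and> s \<cdot> g = t"
    and "\<lbrakk>arr s a Y; arr s' a Y; s \<cdot> g = s' \<cdot> g\<rbrakk> \<Longrightarrow> s = s'"
proof -
  show "\<exists>s. arr s a Y \<and> s \<cdot> g = t" if "arr t E Y"
    using T_factor[OF assms(1) that] orthD[OF orth_BA[OF assms(2,4)] arr_cmp[OF T_arr(1)[OF
      assms(1)] that]] by blast
  show "\<lbrakk>arr s a Y; arr s' a Y; s \<cdot> g = s' \<cdot> g\<rbrakk> \<Longrightarrow> s = s'"
    using epi_eq[OF assms(1) orth_BA[OF B_sh[OF assms(2)] assms(4)]] by blast
qed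

lemma triangle_right_universal:
  assumes "T b E a f g h" "b \<in> \<B>" "a \<in> \<A>" "Y \<in> \<B>"
  shows "arr t Y E \<Longrightarrow> \<exists>s. arr s Y b \<and> f \<cdot> s = t"
    and "\<lbrakk>arr s Y b; arr s' Y b; f \<cdot> s = f \<cdot> s'\<rbrakk> \<Longrightarrow> s = s'"
proof -
  show "\<exists>s. arr s Y b \<and> f \<cdot> s = t" if "arr t Y E"
    using T_lift[OF assms(1) that] orthD[OF orth_BA[OF assms(4,3)] arr_cmp[OF that T_arr(2)[OF
      assms(1)]]] by blast
  show "\<lbrakk>arr s Y b; arr s' Y b; f \<cdot> s = f \<cdot> s'\<rbrakk> \<Longrightarrow> s = s'"
    using mono_eq[OF assms(1) orth_BA[OF B_sh[OF assms(4)] assms(3)]] by blast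
qed

abbreviation "iA \<equiv> incl_left_adj D \<A>"
abbreviation "iB \<equiv> incl_right_adj D \<B>"

lemma adjoints_of_triangle:
  assumes "E \<in> star {b} {a}" "b \<in> \<B>" "a \<in> \<A>"
  shows "isomorphic D a (iA E)" "isomorphic D b (iB E)" "iA E \<in> \<A>" "iB E \<in> \<B>"
proof -
  have EO: "E \<in> Ob D" using star_Ob[OF assms(1)] .
  obtain f g h where t: "T b E a f g h" using assms(1) by (auto elim: starE)
  \<comment> \<open>An adjoint is determined by a whole family of universal arrows, so a
    decomposition triangle is chosen for every object, with the given one prescribed at
    \<open>E\<close>.\<close>
  have "\<forall>X\<in>Ob D. \<exists>q. fst q \<in> \<B> \<and> fst (snd q) \<in> \<A> \<and>
     (\<exists>h. T (fst q) X (fst (snd q)) (fst (snd (snd q))) (snd (snd (snd q))) h) \<and> (X = E \<longrightarrow> q = (b, a,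
       f, g))"
  proof
    fix X assume X: "X \<in> Ob D"
    show "\<exists>q. fst q \<in> \<B> \<and> fst (snd q) \<in> \<A> \<and>
     (\<exists>h. T (fst q) X (fst (snd q)) (fst (snd (snd q))) (snd (snd (snd q))) h) \<and> (X = E \<longrightarrow> q = (b, a,
       f, g))"
    proof (cases "X = E")
      case True
      then show ?thesis using t assms by (intro exI[of _ "(b, a, f, g)"]) auto
    next
      case False
      obtain b' a' f' g' h' where "b' \<in> \<B>" "a' \<in> \<A>" "T b' X a' f' g' h'" using subsetD[OF Ob_star X]
        by (rule starE)
      then show ?thesis using False by (intro exI[of _ "(b', a', f', g')"]) auto
    qed
  qed
  then obtain q where q: "\<forall>X\<in>Ob D. fst (q X) \<in> \<B> \<and> fst (snd (q X)) \<in> \<A> \<and>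
     (\<exists>h. T (fst (q X)) X (fst (snd (q X))) (fst (snd (snd (q X)))) (snd (snd (snd (q X)))) h) \<and> (X
       = E \<longrightarrow> q X = (b, a, f, g))"
    unfolding bchoice_iff by blast
  define bb aa ff gg where "bb X = fst (q X)" and "aa X = fst (snd (q X))"
    and "ff X = fst (snd (snd (q X)))"
    and "gg X = snd (snd (snd (q X)))" for X
  have c: "bb X \<in> \<B>" "aa X \<in> \<A>" "\<exists>h. T (bb X) X (aa X) (ff X) (gg X) h" if "X \<in> Ob D" for X
    using q that unfolding bb_def aa_def ff_def gg_def by blast+
  have eE: "bb E = b" "aa E = a" using q EO unfolding bb_def aa_def by auto
  have L: "isomorphic D (aa E) (iA E)" "iA E \<in> \<A>"
  proof -
    have 1: "arr (gg X) X (aa X)" if "X \<in> Ob D" for X using c(3)[OF that] T_arr(2) by blast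
    have 2: "\<exists>s. arr s (aa X) Y \<and> s \<cdot> gg X = t" if "X \<in> Ob D" "Y \<in> \<A>" "arr t X Y" for X Y t
      using c[OF that(1)] triangle_left_universal(1)[OF _ _ _ that(2,3)] by blast
    have 3: "s = s'" if "X \<in> Ob D" "Y \<in> \<A>" "arr s (aa X) Y" "arr s' (aa X) Y" "s \<cdot> gg X = s' \<cdot> gg X"
      for X Y s s'
      using c[OF that(1)] triangle_left_universal(2)[OF _ _ _ that(2-5)] by blast
    have 0: "\<A> \<subseteq> Ob D" using tsub_Ob[OF tsA] by blast
    show "isomorphic D (aa E) (iA E)" "iA E \<in> \<A>"
      by (rule incl_left_adj_iso[where a = aa and eta = gg
        and E = E, OF 0 _ _ _ _ EO]; (rule c 1 2 3; assumption))+
  qed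
  have R: "isomorphic D (bb E) (iB E)" "iB E \<in> \<B>"
  proof -
    have 1: "arr (ff X) (bb X) X" if "X \<in> Ob D" for X using c(3)[OF that] T_arr(1) by blast
    have 2: "\<exists>s. arr s Y (bb X) \<and> ff X \<cdot> s = t" if "X \<in> Ob D" "Y \<in> \<B>" "arr t Y X" for X Y t
      using c[OF that(1)] triangle_right_universal(1)[OF _ _ _ that(2,3)] by blast
    have 3: "s = s'" if "X \<in> Ob D" "Y \<in> \<B>" "arr s Y (bb X)" "arr s' Y (bb X)" "ff X \<cdot> s = ff X \<cdot> s'"
      for X Y s s'
      using c[OF that(1)] triangle_right_universal(2)[OF _ _ _ that(2-5)] by blast
    have 0: "\<B> \<subseteq> Ob D" using tsub_Ob[OF tsB] by blast
    show "isomorphic D (bb E) (iB E)" "iB E \<in> \<B>"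
      by (rule incl_right_adj_iso[where a = bb and eps = ff
        and E = E, OF 0 _ _ _ _ EO]; (rule c 1 2 3; assumption))+
  qed
  show "isomorphic D a (iA E)" "isomorphic D b (iB E)" "iA E \<in> \<A>" "iB E \<in> \<B>"
    using L R unfolding eE by auto
qed

lemma decomposition: assumes "E \<in> Ob D" shows "iA E \<in> \<A>" "iB E \<in> \<B>" "E \<in> star {iB E} {iA E}"
proof -
  obtain b a where ba: "b \<in> \<B>" "a \<in> \<A>" "E \<in> star {b} {a}" using subsetD[OF Ob_star assms]
    by (rule star_singE)
  note i = adjoints_of_triangle[OF ba(3,1,2)]
  show "iA E \<in> \<A>" "iB E \<in> \<B>" using i by auto
  show "E \<in> star {iB E} {iA E}" using star_change[OF ba(3) i(2) isomorphic_refl[OF assms] i(1)] .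
qed

text \<open>Exactness of the adjoints on the level of vertices: \<open>E\<close> is built from the
  four components of \<open>X\<close> and \<open>Y\<close>, and \<open>iA X\<close> can be
  interchanged with \<open>iB Y\<close> because arrows from \<open>\<B>\<close> to
  \<open>\<A>\<close> vanish.\<close>

lemma adjoints_additive:
  assumes "E \<in> star {X} {Y}"
  shows "iA E \<in> star {iA X} {iA Y}" "iB E \<in> star {iB X} {iB Y}"
proof -
  note o = star_sing_Ob[OF assms]
  note dX = decomposition[OF o(1)] and dY = decomposition[OF o(2)]
  have "E \<in> star (star {iB X} {iA X}) (star {iB Y} {iA Y})" using assms dX(3) dY(3)
    by (rule star_singI)
  also have "\<dots> = star {iB X} (star (star {iA X} {iB Y}) {iA Y})" by (simp add: star_assoc)
  also have "\<dots> \<subseteq> star {iB X} (star (star {iB Y} {iA X}) {iA Y})"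
  proof -
    have "star {iA X} {iB Y} \<subseteq> star {iB Y} {iA X}" using orth_BA[OF dY(2) A_sh[OF dX(1)]] star_swap
      by blast
    then show ?thesis by (rule star_mono[OF order_refl star_mono[OF _ order_refl]])
  qed
  also have "\<dots> = star (star {iB X} {iB Y}) (star {iA X} {iA Y})" by (simp add: star_assoc)
  finally obtain b a where ba: "b \<in> star {iB X} {iB Y}" "a \<in> star {iA X} {iA Y}" "E \<in> star {b} {a}"
    by (rule star_singE)
  have "b \<in> \<B>" "a \<in> \<A>" using tsub_ext[OF tsB ba(1) dX(2) dY(2)] tsub_ext[OF tsA ba(2) dX(1) dY(1)] .
  note i = adjoints_of_triangle[OF ba(3) this]
  show "iA E \<in> star {iA X} {iA Y}" "iB E \<in> star {iB X} {iB Y}"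
    using iso_closedD[OF iso_closed_star ba(2) i(1)] iso_closedD[OF iso_closed_star ba(1) i(2)] .
qed

end

section \<open>The Grothendieck group\<close>

text \<open>Only the typing of triangles is assumed, so the facts serve \<open>D\<close> and its
  full subcategories alike. The last is the universal property: a map additive on triangles kills
  the relations and descends to the quotient.\<close>

lemma K0_props:
  fixes D :: "('o, 'm) tricat"
  assumes typed: "\<And>X Y Z f g h. (X, Y, Z, f, g, h) \<in> Tri D \<Longrightarrow> X \<in> Ob D \<and> Y \<in> Ob D \<and> Z \<in> Ob D"
  shows K0_class_carrier: "E \<in> Ob D \<Longrightarrow> K0_class D E \<in> carrier (K0 D)"
    and K0_class_triangle: "(X, Y, Z, f, g, h) \<in> Tri D \<Longrightarrow>
       K0_class D Y = K0_class D X \<otimes>\<^bsub>K0 D\<^esub> K0_class D Z"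
    and K0_hom_ex: "\<lbrakk>comm_group H; \<phi> ` Ob D \<subseteq> carrier H;
       \<And>X Y Z f g h. (X, Y, Z, f, g, h) \<in> Tri D \<Longrightarrow> \<phi> Y = \<phi> X \<otimes>\<^bsub>H\<^esub> \<phi> Z\<rbrakk> \<Longrightarrow>
       \<exists>k \<in> hom (K0 D) H. \<forall>E\<in>Ob D. k (K0_class D E) = \<phi> E"
proof -
  define F where "F = free_Abelian_group (Ob D)"
  define R where "R = {frag_of Y - frag_of X - frag_of Z | X Y Z f g h. (X, Y, Z, f, g, h) \<in> Tri D}"
  define N where "N = generate F R"
  interpret F: comm_group F unfolding F_def by (rule abelian_free_Abelian_group)
  have K: "K0 D = F Mod N" "K0_class D E = N #>\<^bsub>F\<^esub> frag_of E" for E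
    unfolding K0_def K0_class_def F_def N_def R_def by auto
  have cF: "frag_of E \<in> carrier F" if "E \<in> Ob D" for E using that unfolding F_def by simp
  have RF: "R \<subseteq> carrier F"
  proof
    fix r assume "r \<in> R"
    then obtain X Y Z f g h where r: "r = frag_of Y - frag_of X - frag_of Z" "(X, Y, Z, f, g, h) \<in>
      Tri D"
      unfolding R_def by blast
    then have "X \<in> Ob D" "Y \<in> Ob D" "Z \<in> Ob D" using typed by blast+
    then have "Poly_Mapping.keys (frag_of Y - frag_of X - frag_of Z) \<subseteq> Ob D"
      using keys_diff[of "frag_of Y - frag_of X" "frag_of Z"] keys_diff[of "frag_of Y" "frag_of X"]
        by auto
    then show "r \<in> carrier F" unfolding F_def r by simp
  qed
  have N: "subgroup N F" unfolding N_def by (rule F.generate_is_subgroup[OF RF])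
  then interpret N: normal N F by (rule F.subgroup_imp_normal)
  show "K0_class D E \<in> carrier (K0 D)" if "E \<in> Ob D" for E
    unfolding K using cF[OF that] unfolding FactGroup_def RCOSETS_def by auto
  show "K0_class D Y = K0_class D X \<otimes>\<^bsub>K0 D\<^esub> K0_class D Z" if t: "(X, Y, Z, f, g, h) \<in> Tri D"
    for X Y Z f g h
  proof -
    have o: "X \<in> Ob D" "Y \<in> Ob D" "Z \<in> Ob D" using typed[OF t] by auto
    let ?r = "frag_of Y - frag_of X - frag_of Z" and ?w = "frag_of X + frag_of Z"
    have rN: "?r \<in> N" unfolding N_def by (rule generate.incl) (unfold R_def, use t in blast)
    have w: "?w \<in> carrier F" using F.m_closed[OF cF[OF o(1)] cF[OF o(3)]] unfolding F_def by simp
    have "?w \<in> N #>\<^bsub>F\<^esub> ?w" using F.rcos_self[OF w N] .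
    have "K0_class D X \<otimes>\<^bsub>K0 D\<^esub> K0_class D Z = N #>\<^bsub>F\<^esub> ?w"
      unfolding K using N.rcos_sum[OF cF[OF o(1)] cF[OF o(3)]] by (simp add: F_def)
    also have "\<dots> = N #>\<^bsub>F\<^esub> frag_of Y"
    proof (rule F.repr_independence[OF _ w N])
      have "?r \<otimes>\<^bsub>F\<^esub> ?w = frag_of Y" unfolding F_def by simp
      then show "frag_of Y \<in> N #>\<^bsub>F\<^esub> ?w" using rN unfolding r_coset_def
        by (metis (mono_tags, lifting) UN_iff singletonI)
    qed
    finally show ?thesis unfolding K by simp
  qed
  show "\<exists>k \<in> hom (K0 D) H. \<forall>E\<in>Ob D. k (K0_class D E) = \<phi> E"
    if H: "comm_group H" and \<phi>: "\<phi> ` Ob D \<subseteq> carrier H"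
      and add: "\<And>X Y Z f g h. (X, Y, Z, f, g, h) \<in> Tri D \<Longrightarrow> \<phi> Y = \<phi> X \<otimes>\<^bsub>H\<^esub> \<phi> Z"
  proof -
    interpret H: comm_group H by (rule H)
    obtain k where k: "k \<in> hom F H" "\<And>E. E \<in> Ob D \<Longrightarrow> k (frag_of E) = \<phi> E"
      unfolding F_def using H.free_Abelian_group_universal[OF \<phi>] by blast
    interpret k: group_hom F H k by unfold_locales (rule k(1))
    have kR: "R \<subseteq> kernel F H k"
    proof
      fix r assume r: "r \<in> R"
      then obtain X Y Z f g h where r': "r = frag_of Y - frag_of X - frag_of Z" "(X, Y, Z, f, g, h)
        \<in> Tri D"
        unfolding R_def by blast
      have o: "X \<in> Ob D" "Y \<in> Ob D" "Z \<in> Ob D" using typed[OF r'(2)] by auto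
      have rc: "r \<in> carrier F" using RF r by blast
      have w: "frag_of X + frag_of Z = frag_of X \<otimes>\<^bsub>F\<^esub> frag_of Z" unfolding F_def by simp
      have wc: "frag_of X + frag_of Z \<in> carrier F" using F.m_closed[OF cF[OF o(1)] cF[OF o(3)]] w
        by simp
      have "r \<otimes>\<^bsub>F\<^esub> (frag_of X + frag_of Z) = frag_of Y" unfolding F_def r' by simp
      then have "k r \<otimes>\<^bsub>H\<^esub> k (frag_of X + frag_of Z) = \<phi> Y" using k.hom_mult[OF rc wc] k(2)[OF o(2)]
        by simp
      moreover have "k (frag_of X + frag_of Z) = \<phi> Y"
        unfolding w using k.hom_mult[OF cF[OF o(1)] cF[OF o(3)]] k(2)[OF o(1)] k(2)[OF o(3)] add[OF
          r'(2)] by simp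
      ultimately have "k r \<otimes>\<^bsub>H\<^esub> \<phi> Y = \<phi> Y" by simp
      moreover have "\<phi> Y \<in> carrier H" using \<phi> o by blast
      ultimately have "k r = \<one>\<^bsub>H\<^esub>" using H.l_cancel_one'[of "\<phi> Y" "k r"] k.hom_closed[OF rc]
        H.r_cancel_one[of "\<phi> Y" "k r"] by auto
      then show "r \<in> kernel F H k" using rc unfolding kernel_def by simp
    qed
    have kN: "k x = \<one>\<^bsub>H\<^esub>" if "x \<in> N" for x
      using F.generate_subgroup_incl[OF kR k.subgroup_kernel] that unfolding N_def kernel_def
        by blast
    have same: "k x = k y" if xy: "x \<in> carrier F" "y \<in> carrier F" "N #>\<^bsub>F\<^esub> x = N #>\<^bsub>F\<^esub> y" for x y
    proof -
      have "x \<in> N #>\<^bsub>F\<^esub> y" using F.rcos_self[OF xy(1) N] xy(3) by simp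
      then obtain n where n: "n \<in> N" "x = n \<otimes>\<^bsub>F\<^esub> y" unfolding r_coset_def by blast
      then have "k x = k n \<otimes>\<^bsub>H\<^esub> k y" using k.hom_mult[OF _ xy(2)] N.subset by blast
      then show ?thesis using kN[OF n(1)] k.hom_closed[OF xy(2)] by simp
    qed
    obtain g where "g \<in> hom (F Mod N) H" "\<And>x. x \<in> carrier F \<Longrightarrow> g (N #>\<^bsub>F\<^esub> x) = k x"
      using FactGroup_universal[OF k(1) N.normal_axioms same] by blast
    then show ?thesis unfolding K using cF k(2) by (intro bexI[of _ g]) auto
  qed
qed

section \<open>Lattice points of bounded norm\<close>

abbreviation coeffs :: "(nat \<Rightarrow>\<^sub>0 int) \<Rightarrow> nat \<Rightarrow> real" where
  "coeffs c \<equiv> (\<lambda>i. real_of_int (Poly_Mapping.lookup c i))"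

text \<open>A norm is specified only on sequences supported on \<open>{..<n}\<close>; composing with
  truncation gives a map on all sequences whose continuity can be stated.\<close>

definition trunc :: "nat \<Rightarrow> (nat \<Rightarrow> real) \<Rightarrow> nat \<Rightarrow> real" where
  "trunc n v = (\<lambda>i. if i < n then v i else 0)"

lemma norm_on_Rn_props:
  assumes "norm_on_Rn n N" "\<forall>i\<ge>n. v i = 0"
  shows norm_Rn_nonneg: "0 \<le> N v" and norm_Rn_eq_0: "N v = 0 \<longleftrightarrow> v = (\<lambda>i. 0)"
    and norm_Rn_scale: "N (\<lambda>i. c * v i) = \<bar>c\<bar> * N v"
    and norm_Rn_add: "\<forall>i\<ge>n. w i = 0 \<Longrightarrow> N (\<lambda>i. v i + w i) \<le> N v + N w"
proof -
  note h = mp[OF spec[OF assms(1)[unfolded norm_on_Rn_def], of v] assms(2)]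
  show "0 \<le> N v" "N v = 0 \<longleftrightarrow> v = (\<lambda>i. 0)" "N (\<lambda>i. c * v i) = \<bar>c\<bar> * N v"
    using h by simp_all
  show "\<forall>i\<ge>n. w i = 0 \<Longrightarrow> N (\<lambda>i. v i + w i) \<le> N v + N w" using h by blast
qed

lemma norm_Rn_le_sum:
  assumes N: "norm_on_Rn n N" and v: "\<forall>i\<ge>n. v i = 0"
  shows "N v \<le> (\<Sum>i<n. \<bar>v i\<bar> * N (\<lambda>j. if j = i then 1 else 0))"
proof -
  have h: "N (trunc m v) \<le> (\<Sum>i<m. \<bar>v i\<bar> * N (\<lambda>j. if j = i then 1 else 0))" if "m \<le> n" for m
    using that
  proof (induction m)
    case 0
    have "trunc 0 v = (\<lambda>i. 0)" unfolding trunc_def by simp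
    then show ?case using norm_Rn_eq_0[OF N, of "\<lambda>i. 0"] by simp
  next
    case (Suc m)
    let ?e = "\<lambda>j. if j = m then 1 else 0 :: real"
    have 1: "trunc (Suc m) v = (\<lambda>j. trunc m v j + v m * ?e j)"
      unfolding trunc_def by (rule ext) (auto simp: less_Suc_eq)
    have s: "\<forall>i\<ge>n. trunc m v i = 0" "\<forall>i\<ge>n. ?e i = 0" "\<forall>i\<ge>n. v m * ?e i = 0" using Suc.prems
      unfolding trunc_def by auto
    have "N (trunc (Suc m) v) \<le> N (trunc m v) + N (\<lambda>j. v m * ?e j)"
      unfolding 1 by (rule norm_Rn_add[OF N s(1,3)])
    also have "N (\<lambda>j. v m * ?e j) = \<bar>v m\<bar> * N ?e" by (rule norm_Rn_scale[OF N s(2)])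
    finally show ?case using Suc by simp
  qed
  have "trunc n v = v" using v unfolding trunc_def by (auto simp: not_less)
  then show ?thesis using h[of n] by simp
qed

lemma norm_Rn_continuous:
  assumes N: "norm_on_Rn n N" shows "continuous_on UNIV (\<lambda>v. N (trunc n v))"
  unfolding continuous_on_def
proof
  fix w :: "nat \<Rightarrow> real"
  define g where "g v = (\<Sum>i<n. \<bar>v i - w i\<bar> * N (\<lambda>j. if j = i then 1 else 0))" for v
  have s: "\<forall>i\<ge>n. trunc n v i = 0" "\<forall>i\<ge>n. c * trunc n v i = 0" for v c unfolding trunc_def by auto
  have le: "N (trunc n v) - N (trunc n w) \<le> (\<Sum>i<n. \<bar>v i - w i\<bar> * N (\<lambda>j. if j = i then 1 else 0))"
    for v w
  proof -
    let ?d = "trunc n (\<lambda>i. v i - w i)"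
    have e: "trunc n v = (\<lambda>i. ?d i + trunc n w i)" unfolding trunc_def by auto
    have "N (trunc n v) \<le> N ?d + N (trunc n w)" unfolding e by (rule norm_Rn_add[OF N s(1) s(1)])
    moreover have "N ?d \<le> (\<Sum>i<n. \<bar>?d i\<bar> * N (\<lambda>j. if j = i then 1 else 0))"
      by (rule norm_Rn_le_sum[OF N s(1)])
    moreover have "(\<Sum>i<n. \<bar>?d i\<bar> * N (\<lambda>j. if j = i then 1 else 0)) = (\<Sum>i<n. \<bar>v i - w i\<bar> * N (\<lambda>j. if
      j = i then 1 else 0))"
      by (rule sum.cong) (auto simp: trunc_def)
    ultimately show ?thesis by simp
  qed
  have bd: "norm (N (trunc n v) - N (trunc n w)) \<le> norm (g v) * 1" for v
    using le[of v w] le[of w v] abs_ge_self[of "g v"] unfolding g_def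
      by (simp add: abs_minus_commute)
  have "continuous_on UNIV g" unfolding g_def by (intro continuous_intros) auto
  then have "(g \<longlongrightarrow> g w) (at w within UNIV)" unfolding continuous_on_def by blast
  moreover have "g w = 0" unfolding g_def by simp
  ultimately have "(g \<longlongrightarrow> 0) (at w)" by simp
  then have "((\<lambda>v. N (trunc n v) - N (trunc n w)) \<longlongrightarrow> 0) (at w)"
    by (rule tendsto_0_le) (rule always_eventually, rule allI, rule bd)
  then show "((\<lambda>v. N (trunc n v)) \<longlongrightarrow> N (trunc n w)) (at w within UNIV)" by (simp add: LIM_zero_iff)
qed

text \<open>One half of the equivalence of norms: \<open>N\<close> attains a positive minimum on the
  boundary of the unit cube, which is compact in the product topology.\<close>

lemma norm_Rn_lower:
  assumes N: "norm_on_Rn n N"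
  obtains c where "c > 0" "\<And>v i. \<lbrakk>\<forall>i\<ge>n. v i = 0; i < n\<rbrakk> \<Longrightarrow> c * \<bar>v i\<bar> \<le> N v"
proof -
  define B where "B = PiE UNIV (\<lambda>i. if i < n then {-1..1::real} else {0})"
  define K where "K = B \<inter> (\<Union>i<n. {v. \<bar>v i\<bar> = 1})"
  have "compactin (product_topology (\<lambda>_. euclidean) UNIV) B"
    unfolding B_def compactin_PiE by auto
  then have cB: "compact B" unfolding euclidean_product_topology by simp
  have "closed (\<Union>i<n. {v::nat\<Rightarrow>real. \<bar>v i\<bar> = 1})"
    by (intro closed_UN ballI closed_Collect_eq continuous_intros) auto
  then have cK: "compact K" unfolding K_def by (rule compact_Int_closed[OF cB])
  have supp: "\<forall>i\<ge>n. v i = 0" if "v \<in> K" for v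
  proof (intro allI impI)
    fix i assume "n \<le> i"
    moreover have "v i \<in> (if i < n then {-1..1::real} else {0})" using that unfolding K_def B_def
      by (auto simp: PiE_iff)
    ultimately show "v i = 0" by simp
  qed
  have tr: "trunc n v = v" if "\<forall>i\<ge>n. v i = 0" for v using that unfolding trunc_def
    by (auto simp: not_less)
  have "\<exists>c>0. \<forall>v\<in>K. c \<le> N v"
  proof (cases "K = {}")
    case False
    have "continuous_on K (\<lambda>v. N (trunc n v))" using norm_Rn_continuous[OF N] continuous_on_subset
      by blast
    then obtain v where v: "v \<in> K" "\<forall>w\<in>K. N (trunc n v) \<le> N (trunc n w)"
      using continuous_attains_inf[OF cK False] by blast
    have "v \<noteq> (\<lambda>i. 0)" using v(1) unfolding K_def by auto
    then have "N v > 0" using norm_Rn_nonneg[OF N supp[OF v(1)]] norm_Rn_eq_0[OF N supp[OF v(1)]]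
      by linarith
    moreover have "N v \<le> N w" if "w \<in> K" for w using v that tr supp by metis
    ultimately show ?thesis by blast
  qed (auto intro: exI[of _ 1])
  then obtain c where c: "c > 0" "\<And>v. v \<in> K \<Longrightarrow> c \<le> N v" by blast
  have "c * \<bar>v i\<bar> \<le> N v" if v: "\<forall>i\<ge>n. v i = 0" and i: "i < n" for v i
  proof (cases "\<exists>j<n. v j \<noteq> 0")
    case False
    then show ?thesis using i norm_Rn_nonneg[OF N v] by simp
  next
    case True
    define M where "M = Max ((\<lambda>j. \<bar>v j\<bar>) ` {..<n})"
    have le: "\<bar>v j\<bar> \<le> M" if "j < n" for j unfolding M_def using that by simp
    obtain j where "j < n" "v j \<noteq> 0" using True by blast
    then have M0: "M > 0" using le[of j] by simp
    have "M \<in> (\<lambda>j. \<bar>v j\<bar>) ` {..<n}" unfolding M_def using i by (intro Max_in) auto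
    then obtain m where m: "m < n" "M = \<bar>v m\<bar>" by auto
    \<comment> \<open>Division by the largest absolute value of a coordinate moves \<open>v\<close>
      to the boundary of the cube.\<close>
    define w where "w = (\<lambda>i. (1/M) * v i)"
    have "w \<in> B" unfolding B_def PiE_UNIV_domain
    proof
      fix j
      show "w j \<in> (if j < n then {-1..1} else {0})"
      proof (cases "j < n")
        case True
        then show ?thesis using le[OF True] M0 unfolding w_def
          by (auto simp: field_simps abs_le_iff)
      qed (use v in \<open>auto simp: w_def\<close>)
    qed
    moreover have "\<bar>w m\<bar> = 1" using m M0 unfolding w_def by (simp add: abs_mult)
    ultimately have "w \<in> K" unfolding K_def using m by blast
    then have "c \<le> N w" by (rule c(2))
    also have "N w = \<bar>1/M\<bar> * N v" unfolding w_def by (rule norm_Rn_scale[OF N v])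
    finally have "c * M \<le> N v" using M0 by (simp add: field_simps)
    moreover have "c * \<bar>v i\<bar> \<le> c * M" using le[OF i] c(1) by (intro mult_left_mono) auto
    ultimately show ?thesis by simp
  qed
  then show thesis using that c(1) by blast
qed

lemma finite_lattice_points:
  assumes N: "norm_on_Rn n N"
  shows "finite {c :: nat \<Rightarrow>\<^sub>0 int. Poly_Mapping.keys c \<subseteq> {..<n} \<and> N (coeffs c) \<le> M}"
proof -
  obtain d where d: "d > 0" "\<And>v i. \<lbrakk>\<forall>i\<ge>n. v i = 0; i < n\<rbrakk> \<Longrightarrow> d * \<bar>v i\<bar> \<le> N v"
    using norm_Rn_lower[OF N] by blast
  define S where "S = {c :: nat \<Rightarrow>\<^sub>0 int. Poly_Mapping.keys c \<subseteq> {..<n} \<and> N (coeffs c) \<le> M}"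
  define f where "f c = restrict (Poly_Mapping.lookup c) {..<n}" for c :: "nat \<Rightarrow>\<^sub>0 int"
  have k0: "Poly_Mapping.lookup c i = 0" if "c \<in> S" "n \<le> i" for c i
    using that unfolding S_def by (metis (mono_tags, lifting) in_keys_iff lessThan_iff
      mem_Collect_eq not_le subsetD)
  have "f ` S \<subseteq> PiE {..<n} (\<lambda>_. {- \<lceil>M / d\<rceil>..\<lceil>M / d\<rceil>})"
  proof (intro image_subsetI PiE_I)
    fix c i assume c: "c \<in> S" and i: "i \<in> {..<n}"
    let ?v = "\<lambda>i. real_of_int (Poly_Mapping.lookup c i)"
    have "d * \<bar>?v i\<bar> \<le> N ?v" using k0[OF c] i by (intro d(2)) auto
    also have "\<dots> \<le> M" using c unfolding S_def by simp
    finally have "\<bar>?v i\<bar> \<le> M / d" using d(1) by (simp add: field_simps)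
    then have "\<bar>?v i\<bar> \<le> of_int \<lceil>M / d\<rceil>" by (meson le_of_int_ceiling order.trans)
    then have "\<bar>Poly_Mapping.lookup c i\<bar> \<le> \<lceil>M / d\<rceil>" by linarith
    then show "f c i \<in> {- \<lceil>M / d\<rceil>..\<lceil>M / d\<rceil>}" using i unfolding f_def by auto
  qed (auto simp: f_def)
  then have "finite (f ` S)" by (rule finite_subset) (simp add: finite_PiE)
  moreover have "inj_on f S"
  proof (rule inj_onI, rule poly_mapping_eqI)
    fix c c' i assume "c \<in> S" "c' \<in> S" "f c = f c'"
    then show "Poly_Mapping.lookup c i = Poly_Mapping.lookup c' i"
      using k0 unfolding f_def by (cases "i < n") (metis lessThan_iff restrict_apply', auto)
  qed
  ultimately have "finite S" by (rule finite_imageD)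
  then show ?thesis unfolding S_def .
qed

section \<open>Charges of direct sums of lattices\<close>

lemma hom_complex_sum:
  fixes n :: nat
  assumes h: "h \<in> hom (free_Abelian_group {..<n}) complex_group"
    and c: "Poly_Mapping.keys c \<subseteq> {..<n}"
  shows "h c = (\<Sum>i<n. of_int (Poly_Mapping.lookup c i) * h (frag_of i))"
  using c
proof (induction c rule: free_Abelian_group_induct[consumes 1, case_names zero diff frag])
  case zero
  show ?case using hom_mult[OF h, of 0 0] by (simp add: complex_group_def)
next
  case (diff x y)
  have k: "Poly_Mapping.keys (x - y) \<subseteq> {..<n}" using diff keys_diff[of x y] by blast
  have "h ((x - y) + y) = h (x - y) + h y"
    using hom_mult[OF h, of "x - y" y] k diff(2) by (simp add: complex_group_def)
  then have "h (x - y) = h x - h y" by simp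
  then show ?case using diff by (simp add: lookup_minus sum_subtractf algebra_simps)
next
  case (frag a)
  have "(\<Sum>i<n. of_int (Poly_Mapping.lookup (frag_of a) i) * h (frag_of i)) = (\<Sum>i<n. if i = a then h
    (frag_of i) else 0)"
    by (rule sum.cong) (auto)
  also have "\<dots> = h (frag_of a)" using frag by (subst sum.delta) auto
  finally show ?case by (rule sym)
qed

text \<open>The inclusion of the second summand into a direct sum of lattices whose first summand
  occupies the indices below \<open>n\<close>.\<close>

definition shift_frag :: "nat \<Rightarrow> (nat \<Rightarrow>\<^sub>0 int) \<Rightarrow> nat \<Rightarrow>\<^sub>0 int" where
  "shift_frag n = frag_extend (\<lambda>i. frag_of (n + i))"

lemma lookup_shift_frag:
  "Poly_Mapping.lookup (shift_frag n c) j = (if n \<le> j then Poly_Mapping.lookup c (j - n) else 0)"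
proof -
  have "Poly_Mapping.keys c \<subseteq> UNIV" by simp
  then show ?thesis
    by (induction c rule: frag_induction) (auto simp: shift_frag_def frag_extend_diff lookup_minus)
qed

lemma shift_frag_add: "shift_frag n (x + y) = shift_frag n x + shift_frag n y"
  unfolding shift_frag_def by (rule frag_extend_add)

section \<open>Charges on extension closures\<close>

text \<open>\<open>\<nu>\<close> abstracts the norm of the lattice class: it retains subadditivity,
  the value on zero objects and the support inequality on semistable objects, with support constant
  \<open>c\<close>.\<close>

locale charged_subcategory = sliced_subcategory D \<A> P 1
  for D :: "('o, 'm) tricat" (structure) and \<A> and P :: "real \<Rightarrow> 'o set" +
  fixes Z :: "'o \<Rightarrow> complex" and \<nu> :: "'o \<Rightarrow> real" and c :: real
  assumes Z_add: "\<lbrakk>E \<in> star {X} {Y}; X \<in> \<A>; Y \<in> \<A>\<rbrakk> \<Longrightarrow> Z E = Z X + Z Y"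
    and \<nu>_add: "\<lbrakk>E \<in> star {X} {Y}; X \<in> \<A>; Y \<in> \<A>\<rbrakk> \<Longrightarrow> \<nu> E \<le> \<nu> X + \<nu> Y"
    and \<nu>_zero: "zero_object D E \<Longrightarrow> \<nu> E = 0"
    and P_ray: "\<lbrakk>E \<in> P \<phi>; \<not> zero_object D E\<rbrakk> \<Longrightarrow> Z E \<in> ray \<phi>"
    and \<nu>_le: "\<lbrakk>E \<in> P \<phi>; \<not> zero_object D E\<rbrakk> \<Longrightarrow> \<nu> E \<le> c * cmod (Z E)"
    and c_pos: "c > 0"
begin

lemma Z_zero: assumes "zero_object D N" shows "Z N = 0"
  using Z_add[OF star_sing_refl(1)[OF zero_Ob[OF assms] assms]] tsub_zero[OF sub assms] by simp

text \<open>The charges of the factors span less than a half turn, so they cannot cancel, and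
  \<open>ray_sum\<close> keeps partial sums in the interval.\<close>

lemma HN_ray:
  assumes "E \<in> HN {a<..b}" "b < a + 1" "\<not> zero_object D E"
  shows "\<exists>\<phi>\<in>{a<..b}. Z E \<in> ray \<phi>"
proof -
  have "zero_object D E \<or> (\<exists>\<phi>\<in>{a<..b}. Z E \<in> ray \<phi>)"
    using assms(1)
  proof (induction rule: HN_induct)
    case (step E X Y p)
    have m: "X \<in> \<A>" "Y \<in> \<A>" using step HN_sub P_sub by blast+
    note ZE = Z_add[OF step(1) m]
    show ?case
    proof (cases "zero_object D Y")
      case True
      then show ?thesis using step(5) ZE Z_zero[OF True] zero_iso[OF star_sing_zero_right[OF step(1)
        True]] by auto
    next
      case Y: False
      then have rY: "Z Y \<in> ray p" using P_ray step(3) by blast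
      show ?thesis
      proof (cases "zero_object D X")
        case True
        then show ?thesis using ZE Z_zero[OF True] rY step(4) by auto
      next
        case False
        then obtain \<phi> where \<phi>: "\<phi> \<in> {a<..b}" "Z X \<in> ray \<phi>" using step(5) by blast
        have "\<exists>\<chi>. min \<phi> p \<le> \<chi> \<and> \<chi> \<le> max \<phi> p \<and> Z E \<in> ray \<chi>"
        proof (cases "\<phi> \<le> p")
          case True
          then show ?thesis using ray_sum[OF \<phi>(2) rY True] \<phi>(1) step(4) assms(2) ZE by auto
        next
          case False
          then show ?thesis using ray_sum[OF rY \<phi>(2)] \<phi>(1) step(4) assms(2) ZE
            by (auto simp: add.commute)
        qed
        then show ?thesis using \<phi>(1) step(4) by (auto intro!: bexI)
      qed
    qed
  qed simp
  then show ?thesis using assms(3) by blast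
qed

text \<open>The support inequality extends from semistable objects to all objects with phases near
  \<open>t\<close> once the modulus is replaced by the projection to the ray of phase
  \<open>t\<close>, which is additive.\<close>

lemma HN_bound:
  assumes "E \<in> HN J" "J \<subseteq> {t - w..t + w}" "0 \<le> w" "w < 1/2"
  shows "cos (pi * w) * \<nu> E \<le> c * re_rot t (Z E)"
  using assms(1)
proof (induction rule: HN_induct)
  case (zero E)
  then show ?case by (simp add: Z_zero \<nu>_zero)
next
  case (step E X Y p)
  have m: "X \<in> \<A>" "Y \<in> \<A>" using step HN_sub P_sub by blast+
  note cp = cos_pos_half[OF assms(3,4)]
  have "cos (pi * w) * \<nu> Y \<le> c * re_rot t (Z Y)"
  proof (cases "zero_object D Y")
    case True
    then show ?thesis by (simp add: Z_zero \<nu>_zero)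
  next
    case False
    have "cos (pi * w) * \<nu> Y \<le> c * (cos (pi * w) * cmod (Z Y))"
      using mult_left_mono[OF \<nu>_le[OF step(3) False], of "cos (pi * w)"] cp
        by (simp add: algebra_simps)
    also have "cos (pi * w) * cmod (Z Y) \<le> re_rot t (Z Y)"
      by (rule re_rot_ray[OF P_ray[OF step(3) False]]) (use step(4) assms in
        \<open>auto simp: abs_le_iff\<close>)
    finally show ?thesis using c_pos by simp
  qed
  moreover have "cos (pi * w) * \<nu> E \<le> cos (pi * w) * (\<nu> X + \<nu> Y)"
    using \<nu>_add[OF step(1) m] cp by simp
  ultimately show ?case using step(5) Z_add[OF step(1) m] re_rot_add by (simp add: algebra_simps)
qed

end

section \<open>The cut conditions\<close>

context triangulated
begin

lemma unshift_props: assumes "X \<in> Ob D" shows "unshift D X \<in> Ob D" "isomorphic D (sh (unshift D X))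
  X"
  using someI_ex[of "\<lambda>W. W \<in> Ob D \<and> isomorphic D (sh W) X"] unsh_ex[OF assms] unfolding unshift_def
    by blast+

lemma sh_pow_Ob: "X \<in> Ob D \<Longrightarrow> (sh ^^ n) X \<in> Ob D"
  by (induction n) (auto simp: sh_Ob)

lemma sh_pow_iso: "isomorphic D X Y \<Longrightarrow> isomorphic D ((sh ^^ n) X) ((sh ^^ n) Y)"
  by (induction n) (auto simp: isomorphic_sh)

lemma unshift_pow: assumes "X \<in> Ob D"
  shows "(unshift D ^^ n) X \<in> Ob D \<and> isomorphic D ((sh ^^ n) ((unshift D ^^ n) X)) X"
proof (induction n)
  case 0
  then show ?case using assms isomorphic_refl by simp
next
  case (Suc n)
  let ?W = "(unshift D ^^ n) X"
  have u: "unshift D ?W \<in> Ob D" "isomorphic D (sh (unshift D ?W)) ?W" using unshift_props Suc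
    by blast+
  have "isomorphic D ((sh ^^ n) (sh (unshift D ?W))) ((sh ^^ n) ?W)" using sh_pow_iso[OF u(2)] .
  then have "isomorphic D ((sh ^^ n) (sh (unshift D ?W))) X" using Suc isomorphic_trans by blast
  then show ?case using u(1) by (simp add: funpow_swap1)
qed

lemma orth_pow: "\<lbrakk>X \<in> Ob D; Y \<in> Ob D\<rbrakk> \<Longrightarrow> orth ((sh ^^ n) X) ((sh ^^ n) Y) \<longleftrightarrow> orth X Y"
  by (induction n) (auto simp: orth_sh_iff sh_pow_Ob)

text \<open>Hom from \<open>X\<close> to \<open>Y[-n]\<close> is Hom from \<open>X[n]\<close> to
  \<open>Y\<close>. In the second form no chosen preimages under the shift occur.\<close>

lemma orth_of_Hom_le0:
  assumes "Hom_le0_vanishes D S R" "X \<in> S" "Y \<in> R" "X \<in> Ob D" "Y \<in> Ob D"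
  shows "orth ((sh ^^ n) X) Y"
proof -
  let ?W = "(unshift D ^^ n) Y"
  have W: "?W \<in> Ob D" "isomorphic D ((sh ^^ n) ?W) Y" using unshift_pow[OF assms(5)] by blast+
  have "shift D (- int n) Y = ?W" unfolding shift_def by (cases "n = 0") auto
  moreover have "Hom D X (shift D (- int n) Y) = {zo X (shift D (- int n) Y)}"
    using assms(1-3) unfolding Hom_le0_vanishes_def by simp
  ultimately have "orth X ?W" using orth_Hom[OF assms(4) W(1)] by simp
  then have "orth ((sh ^^ n) X) ((sh ^^ n) ?W)" using orth_pow[OF assms(4) W(1)] by blast
  then show ?thesis using orth_iso isomorphic_refl sh_pow_Ob W(2) assms(4) by blast
qed

end

lemma P_pow:
  assumes "sliced_subcategory D \<A> P (1 :: real)" "X \<in> Ob D"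
  shows "(sh_ob D ^^ n) X \<in> P (p + real n) \<longleftrightarrow> X \<in> P p"
proof -
  interpret sliced_subcategory D \<A> P 1 by (rule assms(1))
  show ?thesis
  proof (induction n)
    case (Suc n)
    have "P (p + real (Suc n)) = shifts (P (p + real n))" using P_shift[of "p + real n"]
      by (simp add: algebra_simps)
    then show ?case using Suc mem_shifts[OF P_iso_closed sh_pow_Ob[OF assms(2)]] by simp
  qed simp
qed

locale two_slicings = A: hn_slicing D \<A> PA "1 :: real" + B: hn_slicing D \<B> PB "1 :: real"
  for D :: "('o, 'm) tricat" (structure) and \<A> \<B> and PA PB :: "real \<Rightarrow> 'o set"
begin

definition cut_condition :: "real \<Rightarrow> bool"
  where "cut_condition c \<longleftrightarrow> A.Orth (A.HN {c<..}) (B.HN {..c + 1})"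

text \<open>\<open>X\<close> is moved down by \<open>m\<close> shifts and \<open>Y\<close> up by
  \<open>n\<close> shifts into the unit interval above \<open>c\<close>. An arrow from
  \<open>X\<close> to \<open>Y\<close> then becomes one of degree \<open>-(m + n)\<close>, and these
  vanish by assumption.\<close>

lemma cut_condition_of_vanishing:
  assumes van: "Hom_le0_vanishes D (A.HN {c<..c + 1}) (B.HN {c<..c + 1})"
  shows "cut_condition c"
proof -
  have "A.orth X Y" if X: "X \<in> PA p" "c < p" and Y: "Y \<in> PB q" "q \<le> c + 1" for X Y p q
  proof -
    have o: "X \<in> Ob D" "Y \<in> Ob D" using A.iso_closed_Ob[OF A.P_iso_closed X(1)] A.iso_closed_Ob[OF
      B.P_iso_closed Y(1)] .
    \<comment> \<open>Ceilings match the half-open interval \<open>(c, c + 1]\<close>; both numbers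
      are nonnegative because \<open>p > c\<close> and \<open>q \<le> c + 1\<close>, so
      \<open>nat\<close> loses nothing.\<close>
    define m where "m = nat (\<lceil>p - c\<rceil> - 1)"
    define n where "n = nat (1 - \<lceil>q - c\<rceil>)"
    have "1 \<le> \<lceil>p - c\<rceil>" "\<lceil>q - c\<rceil> \<le> 1" using X(2) Y(2)
      by (simp_all add: le_ceiling_iff ceiling_le_iff)
    then have mn: "real m = of_int \<lceil>p - c\<rceil> - 1" "real n = 1 - of_int \<lceil>q - c\<rceil>" unfolding m_def n_def
      by simp_all
    have ce: "r \<le> of_int \<lceil>r\<rceil>" "of_int \<lceil>r\<rceil> - 1 < r" for r :: real by linarith+
    have "c < p - real m" "p - real m \<le> c + 1" "c < q + real n" "q + real n \<le> c + 1"
      using mn ce[of "p - c"] ce[of "q - c"] by linarith+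
    then have pq: "p - real m \<in> {c<..c + 1}" "q + real n \<in> {c<..c + 1}" by auto
    let ?W = "(unshift D ^^ m) X"
    have W: "?W \<in> Ob D" "isomorphic D ((sh_ob D ^^ m) ?W) X" using A.unshift_pow[OF o(1)] by blast+
    have "(sh_ob D ^^ m) ?W \<in> PA (p - real m + real m)"
      using A.iso_closedD[OF A.P_iso_closed X(1) A.isomorphic_sym[OF W(2)]] by simp
    then have "?W \<in> PA (p - real m)" using P_pow[OF A.sliced_subcategory_axioms W(1)] by blast
    then have 1: "?W \<in> A.HN {c<..c + 1}" using A.P_HN[OF pq(1)] by blast
    have "(sh_ob D ^^ n) Y \<in> PB (q + real n)" using P_pow[OF B.sliced_subcategory_axioms o(2)] Y(1)
      by blast
    then have 2: "(sh_ob D ^^ n) Y \<in> B.HN {c<..c + 1}" using B.P_HN[OF pq(2)] by blast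
    note oY = A.sh_pow_Ob[OF o(2), of n]
    have "A.orth ((sh_ob D ^^ (n + m)) ?W) ((sh_ob D ^^ n) Y)"
      by (rule A.orth_of_Hom_le0[OF van 1 2 W(1) oY])
    then have "A.orth ((sh_ob D ^^ n) ((sh_ob D ^^ m) ?W)) ((sh_ob D ^^ n) Y)"
      by (simp add: funpow_add)
    then have "A.orth ((sh_ob D ^^ n) X) ((sh_ob D ^^ n) Y)"
      using A.orth_iso[OF _ A.sh_pow_iso[OF W(2)] A.isomorphic_refl[OF oY]] by blast
    then show ?thesis using A.orth_pow[OF o] by blast
  qed
  then have "A.Orth (PA p) (PB q)" if "c < p" "q \<le> c + 1" for p q using that unfolding A.Orth_def
    by blast
  then show ?thesis unfolding cut_condition_def by (intro A.Orth_HN_left B.Orth_HN_right) auto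
qed

lemma Orth_shifts: assumes "S \<subseteq> Ob D" "R \<subseteq> Ob D"
  shows "A.Orth (A.shifts S) (A.shifts R) \<longleftrightarrow> A.Orth S R"
proof
  assume h: "A.Orth (A.shifts S) (A.shifts R)"
  show "A.Orth S R" unfolding A.Orth_def
  proof (intro ballI)
    fix X Y assume a: "X \<in> S" "Y \<in> R"
    have o: "X \<in> Ob D" "Y \<in> Ob D" using a assms by auto
    have "sh_ob D X \<in> A.shifts S" "sh_ob D Y \<in> A.shifts R"
      unfolding A.shifts_def using a A.isomorphic_refl[OF A.sh_Ob] o by blast+
    then show "A.orth X Y" using h A.orth_sh_iff[OF o] unfolding A.Orth_def by blast
  qed
next
  assume h: "A.Orth S R"
  show "A.Orth (A.shifts S) (A.shifts R)" unfolding A.Orth_def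
  proof (intro ballI)
    fix X' Y' assume "X' \<in> A.shifts S" "Y' \<in> A.shifts R"
    then obtain X Y where a: "X \<in> S" "isomorphic D (sh_ob D X) X'" "Y \<in> R" "isomorphic D (sh_ob D Y)
      Y'"
      unfolding A.shifts_def by blast
    have "A.orth (sh_ob D X) (sh_ob D Y)" using h A.orth_sh_iff[of X Y] a assms unfolding A.Orth_def
      by blast
    then show "A.orth X' Y'" using A.orth_iso a by blast
  qed
qed

lemma cut_condition_shift: "cut_condition (c + 1) \<longleftrightarrow> cut_condition c"
proof -
  have "(\<lambda>x. x + 1) ` {c<..} = {c + 1<..}" "(\<lambda>x. x + 1) ` {..c + 1} = {..c + 1 + 1}"
    by (auto intro: image_eqI[of _ _ "y - 1" for y])
  then have "A.HN {c + 1<..} = A.shifts (A.HN {c<..})" "B.HN {..c + 1 + 1} = A.shifts (B.HN {..c +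
    1})"
    by (simp_all add: A.shifts_HN B.shifts_HN)
  moreover have "A.HN {c<..} \<subseteq> Ob D" "B.HN {..c + 1} \<subseteq> Ob D" using A.HN_Ob B.HN_Ob by blast+
  ultimately show ?thesis unfolding cut_condition_def using Orth_shifts by metis
qed

lemma cut_condition_int: assumes "cut_condition c" shows "cut_condition (c + of_int m)"
proof (induction m rule: int_induct[of _ 0])
  case base
  then show ?case using assms by simp
next
  case (step1 i)
  then show ?case using cut_condition_shift[of "c + of_int i"] by (simp add: add.assoc)
next
  case (step2 i)
  then show ?case using cut_condition_shift[of "c + of_int (i - 1)"] by (simp add: add.assoc)
qed

end

section \<open>The glued slicing\<close>

text \<open>The lattices are represented by \<open>\<nu>\<close>, the norm of a class, and by
  \<open>fin_\<nu>\<close>, the finiteness of lattice points of bounded norm.\<close>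

locale glued = semiorthogonal D \<A> \<B> + gluing D \<A> \<B> PA PB x +
  CA: charged_subcategory D \<A> PA ZA \<nu>A cA + CB: charged_subcategory D \<B> PB ZB \<nu>B cB
  for D :: "('o, 'm) tricat" (structure) and \<A> \<B> and PA PB :: "real \<Rightarrow> 'o set" and x
    and ZA \<nu>A cA ZB \<nu>B cB +
  fixes Z :: "'o \<Rightarrow> complex" and \<nu> :: "'o \<Rightarrow> real"
  assumes Z_def: "E \<in> Ob D \<Longrightarrow> Z E = ZA (iA E) + ZB (iB E)"
    and \<nu>_def: "E \<in> Ob D \<Longrightarrow> \<nu> E = \<nu>A (iA E) + \<nu>B (iB E)"
    and \<nu>A_nonneg: "E \<in> \<A> \<Longrightarrow> 0 \<le> \<nu>A E" and \<nu>B_nonneg: "E \<in> \<B> \<Longrightarrow> 0 \<le> \<nu>B E"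
    and fin_\<nu>: "finite {Z E | E. E \<in> Ob D \<and> \<nu> E \<le> M}"
begin

lemma G_parts: assumes "E \<in> G k" shows "iA E \<in> A.HN (cell k)" "iB E \<in> B.HN (cell k)" "E \<in> Ob D"
proof -
  obtain b a where ba: "b \<in> B.HN (cell k)" "a \<in> A.HN (cell k)" "E \<in> star {b} {a}"
    using assms unfolding G_def by (rule star_singE)
  have "b \<in> \<B>" "a \<in> \<A>" using ba A.HN_sub B.HN_sub by blast+
  note i = adjoints_of_triangle[OF ba(3) this]
  show "iA E \<in> A.HN (cell k)" "iB E \<in> B.HN (cell k)"
    using iso_closedD[OF A.HN_iso_closed ba(2) i(1)] iso_closedD[OF B.HN_iso_closed ba(1) i(2)] .
  show "E \<in> Ob D" using star_Ob[OF ba(3)] .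
qed

text \<open>Both components satisfy \<open>HN_bound\<close> with the same centre \<open>t\<close>,
  so their projections add up without cancellation, and the modulus enters only for the sum. On an
  interval of length 1 the factor \<open>cos (pi * w)\<close> would be zero.\<close>

lemma \<nu>_bound: "\<exists>C>0. \<forall>k E. E \<in> G k \<longrightarrow> \<nu> E \<le> C * cmod (Z E)"
proof -
  obtain c where c: "c > 0" "\<And>k. c \<le> cos_half k" using cos_half_lower by blast
  have cc: "cA + cB > 0" using CA.c_pos CB.c_pos by simp
  have "\<nu> E \<le> (cA + cB) / c * cmod (Z E)" if E: "E \<in> G k" for E k
  proof -
    note P = G_parts[OF E]
    define t w where "t = (x k + x (k + 1)) / 2" and "w = (x (k + 1) - x k) / 2"
    have w: "0 \<le> w" "w < 1/2" unfolding w_def using x_less[of k] x_width[of k] by auto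
    have sub: "cell k \<subseteq> {t - w..t + w}" unfolding cell_def t_def w_def by (auto simp: field_simps)
    have cwk: "cos_half k = cos (pi * w)" unfolding cos_half_def w_def ..
    have a: "cos_half k * \<nu>A (iA E) \<le> cA * re_rot t (ZA (iA E))" unfolding cwk
      by (rule CA.HN_bound[OF P(1) sub w])
    have b: "cos_half k * \<nu>B (iB E) \<le> cB * re_rot t (ZB (iB E))" unfolding cwk
      by (rule CB.HN_bound[OF P(2) sub w])
    have nn: "0 \<le> \<nu>A (iA E)" "0 \<le> \<nu>B (iB E)" using \<nu>A_nonneg \<nu>B_nonneg decomposition[OF P(3)]
      by blast+
    have cp: "0 < cos_half k" using c(1) c(2)[of k] by linarith
    \<comment> \<open>Nonnegative norms force both projections to be nonnegative, which allows
      \<open>cA\<close> and \<open>cB\<close> to be enlarged to their sum.\<close>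
    have "0 \<le> cA * re_rot t (ZA (iA E))" "0 \<le> cB * re_rot t (ZB (iB E))"
      using a b nn cp by (meson less_imp_le mult_nonneg_nonneg order.trans)+
    then have r: "0 \<le> re_rot t (ZA (iA E))" "0 \<le> re_rot t (ZB (iB E))"
      using CA.c_pos CB.c_pos by (simp_all add: zero_le_mult_iff)
    have "c * \<nu> E \<le> cos_half k * \<nu> E" using c(2)[of k] nn \<nu>_def[OF P(3)]
      by (intro mult_right_mono) auto
    also have "\<dots> \<le> cA * re_rot t (ZA (iA E)) + cB * re_rot t (ZB (iB E))"
      using a b \<nu>_def[OF P(3)] by (simp add: distrib_left)
    also have "\<dots> \<le> (cA + cB) * re_rot t (ZA (iA E)) + (cA + cB) * re_rot t (ZB (iB E))"
      using r CA.c_pos CB.c_pos by (intro add_mono mult_right_mono) auto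
    also have "\<dots> = (cA + cB) * re_rot t (Z E)" using Z_def[OF P(3)] re_rot_add
      by (simp add: distrib_left)
    also have "\<dots> \<le> (cA + cB) * cmod (Z E)" using re_rot_le cc by (intro mult_left_mono) auto
    finally show ?thesis using c(1) by (simp add: field_simps)
  qed
  then show ?thesis using cc c(1) by (intro exI[of _ "(cA + cB) / c"]) auto
qed

text \<open>Additivity is exactness of the adjoints. The charges of both components lie in one cell,
  so \<open>ray_sum\<close> locates their sum. By \<open>\<nu>_bound\<close> a bound on the modulus
  is one on the norm, which leaves finitely many charges.\<close>

sublocale R: refinement D G x Z
proof
  show "Z E = Z X + Z Y" if "E \<in> star {X} {Y}" for E X Y
    using CA.Z_add[OF adjoints_additive(1)[OF that]] CB.Z_add[OF adjoints_additive(2)[OF that]]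
      decomposition star_Ob[OF that] star_sing_Ob[OF that] Z_def by simp
  show "\<exists>\<phi>\<in>cell k. Z E \<in> ray \<phi>" if "E \<in> G k" "\<not> zero_object D E" for E k
  proof -
    note P = G_parts[OF that(1)]
    note w = x_width[of k]
    have zE: "Z E = ZA (iA E) + ZB (iB E)" by (rule Z_def[OF P(3)])
    have a: "zero_object D (iA E) \<or> (\<exists>\<phi>\<in>{x k<..x (k + 1)}. ZA (iA E) \<in> ray \<phi>)"
      using CA.HN_ray[OF P(1)[unfolded cell_def] w] by blast
    have b: "zero_object D (iB E) \<or> (\<exists>\<phi>\<in>{x k<..x (k + 1)}. ZB (iB E) \<in> ray \<phi>)"
      using CB.HN_ray[OF P(2)[unfolded cell_def] w] by blast
    note st = decomposition(3)[OF P(3)]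
    have "\<exists>\<phi>\<in>{x k<..x (k + 1)}. Z E \<in> ray \<phi>"
    proof (cases "zero_object D (iA E)")
      case True
      have "\<not> zero_object D (iB E)" using zero_iso[OF star_sing_zero_right[OF st True]] that(2)
        by blast
      then show ?thesis using b zE CA.Z_zero[OF True] by auto
    next
      case False
      then obtain \<phi> where \<phi>: "\<phi> \<in> {x k<..x (k + 1)}" "ZA (iA E) \<in> ray \<phi>" using a by blast
      show ?thesis
      proof (cases "zero_object D (iB E)")
        case True
        then show ?thesis using \<phi> zE CB.Z_zero[OF True] by auto
      next
        case False
        then obtain \<psi> where \<psi>: "\<psi> \<in> {x k<..x (k + 1)}" "ZB (iB E) \<in> ray \<psi>" using b by blast
        have "\<exists>\<chi>. min \<phi> \<psi> \<le> \<chi> \<and> \<chi> \<le> max \<phi> \<psi> \<and> Z E \<in> ray \<chi>"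
        proof (cases "\<phi> \<le> \<psi>")
          case True
          then show ?thesis using ray_sum[OF \<phi>(2) \<psi>(2) True] \<phi>(1) \<psi>(1) w zE by auto
        next
          case False
          then show ?thesis using ray_sum[OF \<psi>(2) \<phi>(2)] \<phi>(1) \<psi>(1) w zE by (auto simp: add.commute)
        qed
        then show ?thesis using \<phi>(1) \<psi>(1) by (auto intro!: bexI)
      qed
    qed
    then show ?thesis unfolding cell_def .
  qed
  show "finite {Z E | E k. E \<in> G k \<and> cmod (Z E) \<le> M}" for M
  proof -
    obtain C where C: "C > 0" "\<And>k E. E \<in> G k \<Longrightarrow> \<nu> E \<le> C * cmod (Z E)" using \<nu>_bound by blast
    have "{Z E | E k. E \<in> G k \<and> cmod (Z E) \<le> M} \<subseteq> {Z E | E. E \<in> Ob D \<and> \<nu> E \<le> C * M}"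
    proof
      fix z assume "z \<in> {Z E | E k. E \<in> G k \<and> cmod (Z E) \<le> M}"
      then obtain E k where E: "z = Z E" "E \<in> G k" "cmod (Z E) \<le> M" by blast
      have "\<nu> E \<le> C * cmod (Z E)" using C(2) E(2) .
      also have "\<dots> \<le> C * M" using E(3) C(1) by simp
      finally show "z \<in> {Z E | E. E \<in> Ob D \<and> \<nu> E \<le> C * M}" using E G_parts(3) by blast
    qed
    then show ?thesis by (rule finite_subset[OF _ fin_\<nu>])
  qed
qed

text \<open>The cells 0 and 1 fill \<open>(x 0, x 2]\<close>. Every given slice with phase in this
  interval lies in one of these two sectors, and every refined slice there consists of extensions of
  an \<open>\<A>\<close>-part by a \<open>\<B>\<close>-part with phases in the same cell.\<close>

lemma heart: "extension_closure D (A.HN {x 0<..x 2} \<union> B.HN {x 0<..x 2}) = R.refined.HN {x 0<..x 2}"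
proof
  let ?J = "{x 0<..x 2}"
  have x02: "x 0 < x 1" "x 1 < x 2" using x_less[of 0] x_less[of 1] by auto
  have J: "R.refined.order_convex ?J" unfolding R.refined.order_convex_def using x02
    by (auto intro: less_le_trans exI[of _ "x 2"])
  have cellJ: "\<exists>k. p \<in> cell k \<and> cell k \<subseteq> ?J" if "p \<in> ?J" for p
  proof (cases "p \<le> x 1")
    case True
    then show ?thesis using that x02 by (intro exI[of _ 0]) (auto simp: cell_def)
  next
    case False
    then show ?thesis using that x02 by (intro exI[of _ 1]) (auto simp: cell_def)
  qed
  have GJ: "G k \<subseteq> R.refined.HN ?J" if "cell k \<subseteq> ?J" for k
    using R.G_HN[of k] R.refined.HN_mono[OF that] by blast
  obtain N where N: "zero_object D N" using ex_zero_object by blast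
  have NB: "N \<in> B.HN K" "N \<in> A.HN K" for K using A.HN_zero B.HN_zero N unfolding zeros_def by blast+
  have AG: "A.HN (cell k) \<subseteq> G k" for k
  proof
    fix E assume E: "E \<in> A.HN (cell k)"
    show "E \<in> G k" unfolding G_def using star_singI[OF star_sing_refl(2)[OF A.HN_Ob[OF E] N] NB(1)
      E] .
  qed
  have BG: "B.HN (cell k) \<subseteq> G k" for k
  proof
    fix E assume E: "E \<in> B.HN (cell k)"
    show "E \<in> G k" unfolding G_def using star_singI[OF star_sing_refl(1)[OF B.HN_Ob[OF E] N] E
      NB(2)] .
  qed
  have AP: "PA p \<subseteq> R.refined.HN ?J" if p: "p \<in> ?J" for p
  proof -
    obtain k where "p \<in> cell k" "cell k \<subseteq> ?J" using cellJ[OF p] by blast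
    then show ?thesis using A.P_HN AG GJ by blast
  qed
  have BP: "PB p \<subseteq> R.refined.HN ?J" if p: "p \<in> ?J" for p
  proof -
    obtain k where "p \<in> cell k" "cell k \<subseteq> ?J" using cellJ[OF p] by blast
    then show ?thesis using B.P_HN BG GJ by blast
  qed
  have zJ: "E \<in> R.refined.HN ?J" if "zero_object D E" for E using that R.refined.HN_zero
    unfolding zeros_def by blast
  have AJ: "E \<in> R.refined.HN ?J" if "E \<in> A.HN ?J" for E
    using that
  proof (induction rule: A.HN_induct)
    case (step E X Y p)
    then show ?case using R.refined.HN_ext[OF J step(1)] AP by blast
  qed (rule zJ)
  have BJ: "E \<in> R.refined.HN ?J" if "E \<in> B.HN ?J" for E
    using that
  proof (induction rule: B.HN_induct)
    case (step E X Y p)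
    then show ?case using R.refined.HN_ext[OF J step(1)] BP by blast
  qed (rule zJ)
  show "extension_closure D (A.HN ?J \<union> B.HN ?J) \<subseteq> R.refined.HN ?J"
  proof
    fix E assume "E \<in> extension_closure D (A.HN ?J \<union> B.HN ?J)"
    then show "E \<in> R.refined.HN ?J"
    proof induction
      case (base X)
      then show ?case using AJ BJ by blast
    next
      case (extension X Z Y f g h)
      then show ?case using R.refined.HN_ext[OF J starI[OF extension(3)]] by blast
    qed
  qed
  show "R.refined.HN ?J \<subseteq> extension_closure D (A.HN ?J \<union> B.HN ?J)"
  proof
    fix E assume "E \<in> R.refined.HN ?J"
    then have "E \<in> extension_closure D (\<Union>p\<in>?J. R.refined p)" using R.refined.slice_interval_HN[OF J]
      by simp
    then show "E \<in> extension_closure D (A.HN ?J \<union> B.HN ?J)"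
    proof induction
      case (base X)
      then obtain p where p: "p \<in> ?J" "X \<in> R.refined p" by blast
      then obtain k where k: "p \<in> cell k" "cell k \<subseteq> ?J" using cellJ by blast
      have "X \<in> G k" using R.refined_G[of p] p(2) R.cell_index[of p k] k(1) by blast
      then obtain b a f g h where t: "b \<in> B.HN (cell k)" "a \<in> A.HN (cell k)" "T b X a f g h"
        unfolding G_def by (rule starE)
      have "b \<in> B.HN ?J" "a \<in> A.HN ?J" using t A.HN_mono[OF k(2)] B.HN_mono[OF k(2)] by blast+
      then show ?case by (intro extension_closure.extension[OF _ _ t(3)] extension_closure.base)
        simp_all
    next
      case (extension X Z Y f g h)
      show ?case by (rule extension_closure.extension[OF extension.IH(1) extension.IH(2)
        extension.hyps(3)])
    qed
  qed
qed

end

section \<open>Support data of a triangulated subcategory\<close>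

context triangulated
begin

text \<open>Membership in \<open>S\<close> is carried through the induction, so that all triangles
  involved belong to the full subcategory.\<close>

lemma extension_closure_full_sub:
  assumes S: "triangulated_subcategory D S" and U: "U \<subseteq> S"
  shows "extension_closure (full_sub D S) U = extension_closure D U"
proof (intro equalityI subsetI)
  fix E assume "E \<in> extension_closure (full_sub D S) U"
  then show "E \<in> extension_closure D U"
  proof induction
    case (base X)
    then show ?case by (rule extension_closure.base)
  next
    case (extension X Z Y f g h)
    have "T X Y Z f g h" using extension.hyps(3) by simp
    then show ?case by (rule extension_closure.extension[OF extension.IH])
  qed
next
  fix E assume "E \<in> extension_closure D U"
  then have "E \<in> S \<and> E \<in> extension_closure (full_sub D S) U"
  proof induction
    case (base X)
    then show ?case using subsetD[OF U] extension_closure.base[of X U "full_sub D S"] by simp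
  next
    case (extension X Z Y f g h)
    have "Y \<in> S" using tsub_ext[OF S starI[OF extension.hyps(3)]] extension.IH by simp
    then have t: "(X, Y, Z, f, g, h) \<in> Tri (full_sub D S)" using extension by simp
    show ?case
      using extension_closure.extension[OF conjunct2[OF extension.IH(1)] conjunct2[OF
        extension.IH(2)] t] \<open>Y \<in> S\<close> by simp
  qed
  then show "E \<in> extension_closure (full_sub D S) U" by blast
qed

lemma slice_interval_full_sub:
  assumes "hn_slicing D S P (1 :: real)" "a < b"
  shows "slice_interval (full_sub D S) P {a<..b} = sliced_subcategory.HN D P {a<..b}"
proof -
  interpret hn_slicing D S P 1 by (rule assms(1))
  have "order_convex {a<..b}" unfolding order_convex_def using assms(2)
    by (auto intro: less_le_trans exI[of _ b])
  moreover have "(\<Union>p\<in>{a<..b}. P p) \<subseteq> S" using P_sub by blast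
  ultimately show ?thesis
    unfolding slice_interval_def by (simp add: extension_closure_full_sub[OF sub] slice_interval_HN)
qed

text \<open>The support property as seen on objects: the homomorphism \<open>u\<close> is replaced
  by its values on classes and their additivity on triangles of \<open>D\<close>.\<close>

definition lattice_data ::
  "'o set \<Rightarrow> (('o \<Rightarrow>\<^sub>0 int) set \<Rightarrow> complex) \<Rightarrow> (real \<Rightarrow> 'o set) \<Rightarrow> nat \<Rightarrow> (('o \<Rightarrow>\<^sub>0 int) set \<Rightarrow>
    nat \<Rightarrow>\<^sub>0 int) \<Rightarrow>
   ((nat \<Rightarrow>\<^sub>0 int) \<Rightarrow> complex) \<Rightarrow> ((nat \<Rightarrow> real) \<Rightarrow> real) \<Rightarrow> real \<Rightarrow> bool" where
  "lattice_data S Z P n u z N C \<longleftrightarrow> (let K = K0_class (full_sub D S) in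
     z \<in> hom (free_Abelian_group {..<n}) complex_group \<and> norm_on_Rn n N \<and>
     (\<forall>E\<in>S. Z (K E) = z (u (K E))) \<and> (\<forall>E\<in>S. Poly_Mapping.keys (u (K E)) \<subseteq> {..<n}) \<and>
     (\<forall>X\<in>S. \<forall>Y\<in>S. \<forall>E\<in>star {X} {Y}. u (K E) = u (K X) + u (K Y)) \<and>
     charged_subcategory D S P (\<lambda>E. Z (K E)) (\<lambda>E. N (coeffs (u (K E)))) C)"

lemma lattice_data_exists:
  assumes S: "triangulated_subcategory D S" and st: "stability_condition (full_sub D S) Z P"
  shows "\<exists>n u z N C. lattice_data S Z P n u z N C"
proof -
  let ?Q = "full_sub D S"
  let ?K = "K0_class ?Q"
  have pre: "pre_stability_condition ?Q Z P" and sup: "support_property ?Q Z P"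
    using st unfolding stability_condition_def by auto
  have Zh: "Z \<in> hom (K0 ?Q) complex_group" and sl: "slicing ?Q P"
    and ry: "\<forall>\<phi>. \<forall>E\<in>P \<phi>. \<not> zero_object ?Q E \<longrightarrow> (\<exists>r>0. Z (?K E) = complex_of_real r * cis (pi * \<phi>))"
    using pre unfolding pre_stability_condition_def by auto
  obtain n :: nat and u z N C where
    u: "u \<in> hom (K0 ?Q) (free_Abelian_group {..<n})"
      and z: "z \<in> hom (free_Abelian_group {..<n}) complex_group"
    and Zu: "\<forall>x\<in>carrier (K0 ?Q). Z x = z (u x)" and N: "norm_on_Rn n N" and C: "C > 0"
    and bd: "\<forall>\<phi>. \<forall>E\<in>P \<phi>. \<not> zero_object ?Q E \<longrightarrow>
       N (coeffs (u (?K E))) \<le> C * cmod (Z (?K E))"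
    using sup unfolding support_property_def by blast
  have typed: "\<And>X Y Z f g h. (X, Y, Z, f, g, h) \<in> Tri ?Q \<Longrightarrow> X \<in> Ob ?Q \<and> Y \<in> Ob ?Q \<and> Z \<in> Ob ?Q"
    by simp
  have Kc: "?K E \<in> carrier (K0 ?Q)" if "E \<in> S" for E using K0_class_carrier[of ?Q E] typed that
    by simp
  have Kt: "?K E = ?K X \<otimes>\<^bsub>K0 ?Q\<^esub> ?K Y" if e: "E \<in> star {X} {Y}" "X \<in> S" "Y \<in> S" for E X Y
  proof -
    have "E \<in> S" using tsub_ext[OF S e] .
    then obtain f g h where "(X, E, Y, f, g, h) \<in> Tri ?Q" using e by (auto elim!: starE)
    then show ?thesis using K0_class_triangle[of ?Q] typed by blast
  qed
  have uadd: "u (?K E) = u (?K X) + u (?K Y)" if e: "E \<in> star {X} {Y}" "X \<in> S" "Y \<in> S" for E X Y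
    using Kt[OF e] hom_mult[OF u Kc[OF e(2)] Kc[OF e(3)]] by simp
  have Zadd: "Z (?K E) = Z (?K X) + Z (?K Y)" if e: "E \<in> star {X} {Y}" "X \<in> S" "Y \<in> S" for E X Y
    using Kt[OF e] hom_mult[OF Zh Kc[OF e(2)] Kc[OF e(3)]] by (simp add: complex_group_def)
  have keys: "Poly_Mapping.keys (u (?K E)) \<subseteq> {..<n}" if "E \<in> S" for E
    using hom_in_carrier[OF u Kc[OF that]] by simp
  have supp: "\<forall>i\<ge>n. real_of_int (Poly_Mapping.lookup (u (?K E)) i) = 0" if "E \<in> S" for E
    using keys[OF that] by (auto simp: in_keys_iff subset_iff)
  interpret hn_slicing D S P 1 by (rule hn_slicing_of_slicing[OF S sl])
  have "charged_subcategory D S P (\<lambda>E. Z (?K E)) (\<lambda>E. N (coeffs (u (?K E)))) C"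
  proof
    fix E X Y assume e: "E \<in> star {X} {Y}" "X \<in> S" "Y \<in> S"
    show "Z (?K E) = Z (?K X) + Z (?K Y)" by (rule Zadd[OF e])
    show "N (coeffs (u (?K E)))
      \<le> N (coeffs (u (?K X))) + N (coeffs (u (?K Y)))"
      unfolding uadd[OF e] lookup_add of_int_add
        by (rule norm_Rn_add[OF N supp[OF e(2)] supp[OF e(3)]])
  next
    fix E assume E: "zero_object D E"
    have "E \<in> S" using tsub_zero[OF S E] .
    then have "u (?K E) = u (?K E) + u (?K E)" using uadd[OF star_sing_refl(1)[OF zero_Ob[OF E] E]]
      by blast
    then have "u (?K E) = 0" by simp
    then show "N (coeffs (u (?K E))) = 0"
      using norm_Rn_eq_0[OF N, of "\<lambda>i. 0"] by simp
  next
    fix E \<phi> assume E: "E \<in> P \<phi>" "\<not> zero_object D E"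
    then have nz: "\<not> zero_object ?Q E" using zero_full_sub[OF S] by simp
    show "Z (?K E) \<in> ray \<phi>" unfolding ray_def using ry E(1) nz by blast
    show "N (coeffs (u (?K E))) \<le> C * cmod (Z (?K E))" using bd E(1) nz by blast
  qed (rule C)
  then have "lattice_data S Z P n u z N C"
    unfolding lattice_data_def Let_def using z N Zu Kc keys uadd by (intro conjI ballI) simp_all
  then show ?thesis by blast
qed

end

lemma alternating_cuts:
  assumes "0 < \<alpha>" "\<alpha> < 1" shows "cuts (\<lambda>k. of_int (k div 2) + (if even k then 0 else \<alpha>))"
proof
  fix k :: int
  show "of_int (k div 2) + (if even k then 0 else \<alpha>) < of_int ((k + 1) div 2) + (if even (k + 1)
    then 0 else \<alpha>)"
  proof (cases "even k")
    case True
    then show ?thesis using assms by (auto elim!: evenE)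
  next
    case False
    then show ?thesis using assms by (auto elim!: oddE)
  qed
  show "of_int ((k + 2) div 2) + (if even (k + 2) then 0 else \<alpha>) = of_int (k div 2) + (if even k
    then 0 else \<alpha>) + 1"
    by simp
qed

theorem proposition1p6:
  fixes D :: "('o, 'm) tricat" and \<A> \<B> :: "'o set"
    and Z\<^sub>\<A> Z\<^sub>\<B> :: "('o \<Rightarrow>\<^sub>0 int) set \<Rightarrow> complex"
    and P\<^sub>\<A> P\<^sub>\<B> :: "real \<Rightarrow> 'o set"
  assumes "triangulated_category D"
    and "semiorthogonal_decomposition D \<A> \<B>"
    and "stability_condition (full_sub D \<A>) Z\<^sub>\<A> P\<^sub>\<A>"
    and "stability_condition (full_sub D \<B>) Z\<^sub>\<B> P\<^sub>\<B>"
    and CP1: "Hom_le0_vanishes D (slice_interval (full_sub D \<A>) P\<^sub>\<A> {0<..1})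
                                 (slice_interval (full_sub D \<B>) P\<^sub>\<B> {0<..1})"
    and CP2: "\<exists>\<alpha>. 0 < \<alpha> \<and> \<alpha> < 1 \<and>
                Hom_le0_vanishes D (slice_interval (full_sub D \<A>) P\<^sub>\<A> {\<alpha><..\<alpha> + 1})
                                   (slice_interval (full_sub D \<B>) P\<^sub>\<B> {\<alpha><..\<alpha> + 1})"
  shows "glue_to_stability_condition D \<A> \<B> Z\<^sub>\<A> P\<^sub>\<A> Z\<^sub>\<B> P\<^sub>\<B>"
proof -
  interpret semiorthogonal D \<A> \<B>
    by (intro semiorthogonal.intro triangulated.intro semiorthogonal_axioms.intro assms(1,2))
  have slA: "slicing (full_sub D \<A>) P\<^sub>\<A>" and slB: "slicing (full_sub D \<B>) P\<^sub>\<B>"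
    using assms(3,4) unfolding stability_condition_def pre_stability_condition_def by auto
  interpret TS: two_slicings D \<A> \<B> P\<^sub>\<A> P\<^sub>\<B>
    by (intro two_slicings.intro hn_slicing_of_slicing tsA tsB slA slB)
  note siA = slice_interval_full_sub[OF TS.A.hn_slicing_axioms]
    and siB = slice_interval_full_sub[OF TS.B.hn_slicing_axioms]
  obtain \<alpha> where \<alpha>: "0 < \<alpha>" "\<alpha> < 1" "TS.cut_condition \<alpha>"
    using CP2 TS.cut_condition_of_vanishing siA siB by auto
  have cut0: "TS.cut_condition 0" using CP1 TS.cut_condition_of_vanishing[of 0] siA siB by simp
  \<comment> \<open>The cut points alternate between integers and integer translates of \<alpha>;
    \<open>div\<close> rounds down, so negative indices fit as well.\<close>
  define x :: "int \<Rightarrow> real" where "x k = of_int (k div 2) + (if even k then 0 else \<alpha>)" for k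
  have cutsx: "cuts x" unfolding x_def using alternating_cuts[OF \<alpha>(1,2)] .
  have x02: "x 0 = 0" "x 2 = 1" unfolding x_def by auto
  have cutx: "Orth (TS.A.HN {x k<..}) (TS.B.HN {..x k + 1})" for k
    using TS.cut_condition_int[OF cut0, of "k div 2"] TS.cut_condition_int[OF \<alpha>(3), of "k div 2"]
    unfolding TS.cut_condition_def x_def by (cases "even k") (auto simp: add.commute)
  have glu: "gluing D \<A> \<B> P\<^sub>\<A> P\<^sub>\<B> x"
    by (intro gluing.intro TS.A.hn_slicing_axioms TS.B.hn_slicing_axioms cutsx gluing_axioms.intro
      Orth_BA Ob_star cutx)
  let ?KA = "K0_class (full_sub D \<A>)" and ?KB = "K0_class (full_sub D \<B>)"
  obtain nA uA zA NA CA where dA: "lattice_data \<A> Z\<^sub>\<A> P\<^sub>\<A> nA uA zA NA CA"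
    using lattice_data_exists[OF tsA assms(3)] by blast
  have A: "zA \<in> hom (free_Abelian_group {..<nA}) complex_group" "norm_on_Rn nA NA"
    "\<And>E. E \<in> \<A> \<Longrightarrow> Z\<^sub>\<A> (?KA E) = zA (uA (?KA E))"
    "\<And>E. E \<in> \<A> \<Longrightarrow> Poly_Mapping.keys (uA (?KA E)) \<subseteq> {..<nA}"
    "\<And>E X Y. \<lbrakk>E \<in> star {X} {Y}; X \<in> \<A>; Y \<in> \<A>\<rbrakk> \<Longrightarrow> uA (?KA E) = uA (?KA X) + uA (?KA Y)"
    "charged_subcategory D \<A> P\<^sub>\<A> (\<lambda>E. Z\<^sub>\<A> (?KA E)) (\<lambda>E. NA (coeffs (uA (?KA E)))) CA"
    using dA[unfolded lattice_data_def Let_def] by simp_all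
  obtain nB uB zB NB CB where dB: "lattice_data \<B> Z\<^sub>\<B> P\<^sub>\<B> nB uB zB NB CB"
    using lattice_data_exists[OF tsB assms(4)] by blast
  have B: "zB \<in> hom (free_Abelian_group {..<nB}) complex_group" "norm_on_Rn nB NB"
    "\<And>E. E \<in> \<B> \<Longrightarrow> Z\<^sub>\<B> (?KB E) = zB (uB (?KB E))"
    "\<And>E. E \<in> \<B> \<Longrightarrow> Poly_Mapping.keys (uB (?KB E)) \<subseteq> {..<nB}"
    "\<And>E X Y. \<lbrakk>E \<in> star {X} {Y}; X \<in> \<B>; Y \<in> \<B>\<rbrakk> \<Longrightarrow> uB (?KB E) = uB (?KB X) + uB (?KB Y)"
    "charged_subcategory D \<B> P\<^sub>\<B> (\<lambda>E. Z\<^sub>\<B> (?KB E)) (\<lambda>E. NB (coeffs (uB (?KB E)))) CB"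
    using dB[unfolded lattice_data_def Let_def] by simp_all
  \<comment> \<open>The lattice classes of the two components; \<open>w\<close> joins them in the
    direct sum, with \<open>\<A>\<close> on the indices below \<open>nA\<close>.\<close>
  define vA vB where "vA E = uA (?KA (iA E))" and "vB E = uB (?KB (iB E))" for E
  define w where "w E = vA E + shift_frag nA (vB E)" for E
  define n where "n = nA + nB"
  \<comment> \<open>Prescribing the values on the basis makes additivity immediate;
    \<open>hom_complex_sum\<close> recovers \<open>zA\<close> and \<open>zB\<close> on the
    summands.\<close>
  define z where "z c = (\<Sum>i<n. of_int (Poly_Mapping.lookup c i) *
     (if i < nA then zA (frag_of i) else zB (frag_of (i - nA))))" for c :: "nat \<Rightarrow>\<^sub>0 int"
  \<comment> \<open>With the sum of the two norms, \<open>N\<close> of the class \<open>w E\<close>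
    is exactly the \<open>\<nu> E\<close> of the glued setting.\<close>
  define N where "N v = NA (\<lambda>i. if i < nA then v i else 0) + NB (\<lambda>i. if i < nB then v (nA + i) else
    0)" for v
  have kA: "Poly_Mapping.keys (vA E) \<subseteq> {..<nA}" and kB: "Poly_Mapping.keys (vB E) \<subseteq> {..<nB}"
    if "E \<in> Ob D" for E
    unfolding vA_def vB_def using A(4) B(4) decomposition[OF that] by blast+
  have lA: "Poly_Mapping.lookup (vA E) i = 0" if "E \<in> Ob D" "nA \<le> i" for E i
    using kA[OF that(1)] that(2) by (auto simp: in_keys_iff subset_iff)
  have lB: "Poly_Mapping.lookup (vB E) i = 0" if "E \<in> Ob D" "nB \<le> i" for E i
    using kB[OF that(1)] that(2) by (auto simp: in_keys_iff subset_iff)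
  have lw: "Poly_Mapping.lookup (w E) i = (if i < nA then Poly_Mapping.lookup (vA E) i else
    Poly_Mapping.lookup (vB E) (i - nA))"
    if "E \<in> Ob D" for E i
    unfolding w_def using lA[OF that, of i] by (simp add: lookup_add lookup_shift_frag)
  have kw: "Poly_Mapping.keys (w E) \<subseteq> {..<n}" if "E \<in> Ob D" for E
  proof
    fix i assume "i \<in> Poly_Mapping.keys (w E)"
    then have nz: "Poly_Mapping.lookup (w E) i \<noteq> 0" by (simp add: in_keys_iff)
    show "i \<in> {..<n}"
    proof (rule ccontr)
      assume "i \<notin> {..<n}"
      then have "\<not> i < nA" "nB \<le> i - nA" unfolding n_def by auto
      then show False using nz lw[OF that, of i] lB[OF that, of "i - nA"] by simp
    qed
  qed
  have wadd: "w E = w X + w Y" if "E \<in> star {X} {Y}" for E X Y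
  proof -
    note d = decomposition[OF star_sing_Ob(1)[OF that]] decomposition[OF star_sing_Ob(2)[OF that]]
    have "vA E = vA X + vA Y" "vB E = vB X + vB Y"
      unfolding vA_def vB_def using A(5)[OF adjoints_additive(1)[OF that]] B(5)[OF
        adjoints_additive(2)[OF that]] d by auto
    then show ?thesis unfolding w_def by (simp add: shift_frag_add)
  qed
  have zhom: "z \<in> hom (free_Abelian_group {..<n}) complex_group"
    by (rule homI) (auto simp: complex_group_def z_def lookup_add sum.distrib algebra_simps)
  have zw: "z (w E) = Z\<^sub>\<A> (?KA (iA E)) + Z\<^sub>\<B> (?KB (iB E))" if E: "E \<in> Ob D" for E
  proof -
    have 0: "{..<n} = {..<nA} \<union> (+) nA ` {..<nB}" unfolding n_def
      by (auto simp: image_iff) (metis add_diff_inverse_nat nat_add_left_cancel_less lessThan_iff)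
    have "z (w E) = (\<Sum>i<nA. of_int (Poly_Mapping.lookup (vA E) i) * zA (frag_of i))
       + (\<Sum>i\<in>(+) nA ` {..<nB}. of_int (Poly_Mapping.lookup (vB E) (i - nA)) * zB (frag_of (i -
         nA)))"
      unfolding z_def 0 by (subst sum.union_disjoint) (auto simp: lw[OF E] intro!: arg_cong2[where f
        = "(+)"] sum.cong)
    also have "(\<Sum>i\<in>(+) nA ` {..<nB}. of_int (Poly_Mapping.lookup (vB E) (i - nA)) * zB (frag_of (i -
      nA)))
      = (\<Sum>i<nB. of_int (Poly_Mapping.lookup (vB E) i) * zB (frag_of i))"
      by (subst sum.reindex) auto
    also have "(\<Sum>i<nB. of_int (Poly_Mapping.lookup (vB E) i) * zB (frag_of i)) = zB (vB E)"
      by (rule hom_complex_sum[OF B(1) kB[OF E], symmetric])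
    also have "(\<Sum>i<nA. of_int (Poly_Mapping.lookup (vA E) i) * zA (frag_of i)) = zA (vA E)"
      by (rule hom_complex_sum[OF A(1) kA[OF E], symmetric])
    finally show ?thesis using A(3) B(3) decomposition[OF E] unfolding vA_def vB_def by simp
  qed
  have Nw: "N (coeffs (w E)) =
     NA (coeffs (vA E)) + NB (coeffs (vB E))"
    if E: "E \<in> Ob D" for E
  proof -
    have "(\<lambda>i. if i < nA then real_of_int (Poly_Mapping.lookup (w E) i) else 0) = (coeffs (vA E))"
      using lw[OF E] lA[OF E] by (auto simp: not_less)
    moreover have "(\<lambda>i. if i < nB then real_of_int (Poly_Mapping.lookup (w E) (nA + i)) else 0) =
      (coeffs (vB E))"
      using lw[OF E] lB[OF E] by (auto simp: not_less)
    ultimately show ?thesis unfolding N_def by simp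
  qed
  have normN: "norm_on_Rn n N"
    unfolding norm_on_Rn_def
  proof (intro allI impI conjI)
    fix v :: "nat \<Rightarrow> real" assume v: "\<forall>i\<ge>n. v i = 0"
    let ?a = "\<lambda>v i. if i < nA then v i else 0 :: real"
      and ?b = "\<lambda>v i. if i < nB then v (nA + i) else 0 :: real"
    have s: "\<forall>i\<ge>nA. ?a v i = 0" "\<forall>i\<ge>nB. ?b v i = 0" for v by auto
    have nn: "0 \<le> NA (?a v)" "0 \<le> NB (?b v)"
      using norm_Rn_nonneg[OF A(2) s(1)] norm_Rn_nonneg[OF B(2) s(2)] .
    then show "0 \<le> N v" unfolding N_def by simp
    have "N v = 0 \<longleftrightarrow> NA (?a v) = 0 \<and> NB (?b v) = 0" unfolding N_def using nn by auto
    also have "\<dots> \<longleftrightarrow> ?a v = (\<lambda>i. 0) \<and> ?b v = (\<lambda>i. 0)"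
      using norm_Rn_eq_0[OF A(2) s(1)] norm_Rn_eq_0[OF B(2) s(2)] by simp
    also have "\<dots> \<longleftrightarrow> v = (\<lambda>i. 0)"
    proof
      assume h: "?a v = (\<lambda>i. 0) \<and> ?b v = (\<lambda>i. 0)"
      show "v = (\<lambda>i. 0)"
      proof
        fix i
        show "v i = 0"
        proof (cases "i < nA")
          case True
          then show ?thesis using fun_cong[OF conjunct1[OF h], of i] by simp
        next
          case False
          then have e: "nA + (i - nA) = i" by simp
          show ?thesis
          proof (cases "i < n")
            case True
            then have "i - nA < nB" using False unfolding n_def by auto
            then show ?thesis using fun_cong[OF conjunct2[OF h], of "i - nA"] e by simp
          qed (use v in simp)
        qed
      qed
    qed auto
    finally show "N v = 0 \<longleftrightarrow> v = (\<lambda>i. 0)" .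
    show "N (\<lambda>i. c * v i) = \<bar>c\<bar> * N v" for c
    proof -
      have "?a (\<lambda>i. c * v i) = (\<lambda>i. c * ?a v i)" "?b (\<lambda>i. c * v i) = (\<lambda>i. c * ?b v i)" by auto
      then show ?thesis unfolding N_def
        using norm_Rn_scale[OF A(2) s(1), of c v] norm_Rn_scale[OF B(2) s(2), of c v]
          by (simp add: distrib_left)
    qed
    show "N (\<lambda>i. v i + v' i) \<le> N v + N v'" for v'
    proof -
      have "?a (\<lambda>i. v i + v' i) = (\<lambda>i. ?a v i + ?a v' i)" "?b (\<lambda>i. v i + v' i) = (\<lambda>i. ?b v i + ?b v'
        i)" by auto
      then show ?thesis unfolding N_def
        using norm_Rn_add[OF A(2) s(1) s(1), of v v'] norm_Rn_add[OF B(2) s(2) s(2), of v v']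
          by simp
    qed
  qed
  \<comment> \<open>\<open>w\<close> is additive on triangles and so descends to the Grothendieck
    group of \<open>D\<close>.\<close>
  obtain u where u: "u \<in> hom (K0 D) (free_Abelian_group {..<n})" "\<forall>E\<in>Ob D. u (K0_class D E) = w E"
  proof -
    have "\<exists>k\<in>hom (K0 D) (free_Abelian_group {..<n}). \<forall>E\<in>Ob D. k (K0_class D E) = w E"
    proof (rule K0_hom_ex)
      show "w ` Ob D \<subseteq> carrier (free_Abelian_group {..<n})" using kw by auto
      fix X Y Z' f g h assume t: "T X Y Z' f g h"
      show "X \<in> Ob D \<and> Y \<in> Ob D \<and> Z' \<in> Ob D" using T_Ob[OF t] by blast
      show "w Y = w X \<otimes>\<^bsub>free_Abelian_group {..<n}\<^esub> w Z'" using wadd[of Y X Z'] starI[OF t] by simp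
    qed (rule abelian_free_Abelian_group)
    then show thesis using that by blast
  qed
  \<comment> \<open>The glued charge is defined through the lattice, so the factorisation in the
    support property holds by definition.\<close>
  define Zg where "Zg c = z (u c)" for c
  define ZZ where "ZZ E = Zg (K0_class D E)" for E
  define \<nu> where "\<nu> E = NA (coeffs (vA E)) + NB (coeffs (vB E))" for E
  have ZZ: "ZZ E = z (w E)" if "E \<in> Ob D" for E unfolding ZZ_def Zg_def using u(2) that by simp
  have Zghom: "Zg \<in> hom (K0 D) complex_group"
    unfolding Zg_def[abs_def] using hom_compose[OF u(1) zhom] unfolding comp_def .
  interpret GL: glued D \<A> \<B> P\<^sub>\<A> P\<^sub>\<B> x "\<lambda>E. Z\<^sub>\<A> (?KA E)" "\<lambda>E. NA (coeffs (uA (?KA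
    E)))" CA
     "\<lambda>E. Z\<^sub>\<B> (?KB E)" "\<lambda>E. NB (coeffs (uB (?KB E)))" CB ZZ \<nu>
  proof (intro glued.intro glued_axioms.intro semiorthogonal_axioms glu A(6) B(6))
    show "ZZ E = Z\<^sub>\<A> (?KA (iA E)) + Z\<^sub>\<B> (?KB (iB E))" if "E \<in> Ob D" for E
      using ZZ[OF that] zw[OF that] by simp
    show "\<nu> E = NA (coeffs (uA (?KA (iA E)))) + NB (coeffs (uB (?KB (iB E))))" for E
      unfolding \<nu>_def vA_def vB_def ..
    show "0 \<le> NA (coeffs (uA (?KA E)))" if "E \<in> \<A>" for E
      by (rule norm_Rn_nonneg[OF A(2)]) (use A(4)[OF that] in \<open>auto simp: in_keys_iff subset_iff\<close>)
    show "0 \<le> NB (coeffs (uB (?KB E)))" if "E \<in> \<B>" for E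
      by (rule norm_Rn_nonneg[OF B(2)]) (use B(4)[OF that] in \<open>auto simp: in_keys_iff subset_iff\<close>)
    \<comment> \<open>The charge factors through \<open>w\<close>, and only finitely many lattice
      points have norm at most \<open>M\<close>.\<close>
    show "finite {ZZ E | E. E \<in> Ob D \<and> \<nu> E \<le> M}" for M
    proof (rule finite_subset)
      show "{ZZ E | E. E \<in> Ob D \<and> \<nu> E \<le> M} \<subseteq>
        z ` {c. Poly_Mapping.keys c \<subseteq> {..<n} \<and> N (coeffs c) \<le> M}"
        using ZZ kw Nw unfolding \<nu>_def by fastforce
      show "finite (z ` {c. Poly_Mapping.keys c \<subseteq> {..<n} \<and> N (coeffs c) \<le> M})"
        using finite_lattice_points[OF normN] by simp
    qed
  qed
  let ?P = GL.R.refined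
  obtain \<mu> where \<mu>: "\<mu> > 0" "\<forall>k E. E \<in> GL.G k \<longrightarrow> \<not> zero_object D E \<longrightarrow> \<mu> \<le> cmod (ZZ E)"
    using GL.R.Z_lower by blast
  \<comment> \<open>This bound on all objects of the sectors specialises to the support inequality
    for the refined slices.\<close>
  obtain C where C: "C > 0" "\<forall>k E. E \<in> GL.G k \<longrightarrow> \<nu> E \<le> C * cmod (ZZ E)" using GL.\<nu>_bound by blast
  have PO: "E \<in> Ob D" if "E \<in> ?P \<phi>" for E \<phi> using GL.R.refined_G that GL.R.G_Ob by blast
  interpret CS: charged_slicing D ?P ZZ \<mu>
  proof
    show "ZZ E = ZZ X + ZZ Y" if "E \<in> star {X} {Y}" for E X Y using GL.R.Z_add[OF that] .
    show "ZZ E \<in> ray \<phi>" if "E \<in> ?P \<phi>" "\<not> zero_object D E" for E \<phi> using GL.R.refined_ray[OF that] .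
    show "\<mu> \<le> cmod (ZZ E)" if "E \<in> ?P \<phi>" "\<not> zero_object D E" for E \<phi> using \<mu>(2) GL.R.refined_G that
      by blast
    show "\<mu> > 0" by (rule \<mu>(1))
  qed
  have "pre_stability_condition D Zg ?P"
    unfolding pre_stability_condition_def
  proof (intro conjI allI ballI impI)
    show "Zg \<in> hom (K0 D) complex_group" by (rule Zghom)
    show "slicing D ?P" by (rule slicing_of_hn_slicing[OF GL.R.refined.hn_slicing_axioms])
    show "\<exists>r>0. Zg (K0_class D E) = complex_of_real r * cis (pi * \<phi>)"
      if "E \<in> ?P \<phi>" "\<not> zero_object D E" for \<phi> E
      using GL.R.refined_ray[OF that] unfolding ray_def ZZ_def by blast
    show "locally_finite D ?P" by (rule CS.locally_finite)
  qed
  moreover have "support_property D Zg ?P"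
    unfolding support_property_def
  proof (intro exI[of _ n] exI[of _ u] exI[of _ z] exI[of _ N] exI[of _ C] conjI allI ballI impI)
    fix \<phi> E assume E: "E \<in> ?P \<phi>" "\<not> zero_object D E"
    have "\<nu> E \<le> C * cmod (ZZ E)" using C(2) GL.R.refined_G E(1) by blast
    moreover have "u (K0_class D E) = w E" using u(2) PO[OF E(1)] by blast
    ultimately show "N (coeffs (u (K0_class D E))) \<le> C * cmod (Zg (K0_class D E))"
      using Nw[OF PO[OF E(1)]] unfolding \<nu>_def ZZ_def by simp
  qed (use u(1) zhom normN C(1) in \<open>auto simp: Zg_def\<close>)
  ultimately have "stability_condition D Zg ?P" unfolding stability_condition_def by blast
  moreover have "slice_interval D ?P {0<..1} = gl D (slice_interval (full_sub D \<A>) P\<^sub>\<A>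
    {0<..1}) (slice_interval (full_sub D \<B>) P\<^sub>\<B> {0<..1})"
  proof -
    have "GL.R.refined.order_convex {0<..1 :: real}" unfolding GL.R.refined.order_convex_def
      by (auto intro: less_le_trans exI[of _ 1])
    then have "slice_interval D ?P {0<..1} = GL.R.refined.HN {0<..1}" unfolding slice_interval_def
      by (rule GL.R.refined.slice_interval_HN)
    then show ?thesis using GL.heart siA[of 0 1] siB[of 0 1] unfolding gl_def x02 by simp
  qed
  ultimately have "heart_stability_condition D (gl D (slice_interval (full_sub D \<A>) P\<^sub>\<A>
    {0<..1}) (slice_interval (full_sub D \<B>) P\<^sub>\<B> {0<..1})) Zg"
    unfolding heart_stability_condition_def by blast
  then show ?thesis
    unfolding glue_to_stability_condition_def using ZZ zw unfolding ZZ_def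
      by (intro exI[of _ Zg]) simp
qed

end
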